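(* Let $\omega=(\omega_i)_{i\in\mathbb Z}$ be i.i.d. random variables with law $P$ such that: (1) there is $\delta\in(0,1/2)$ with $P\{\delta\le\omega_0\le 1-\delta\}=1$; (2) $E[\log\frac{1-\omega_0}{\omega_0}]=0$; (3) $\sigma^2:=\mathrm{Var}[\log\frac{1-\omega_0}{\omega_0}]>0$. Let $(X_n)_{n\ge0}$ be the random walk in random environment $\omega$ started at $0$, let $\xi=(\xi(x))_{x\in\mathbb Z}$ (also written $\xi_x$) be i.i.d. real random variables with law $Q$, independent of $(\omega,(X_n)_{n\ge 0})$, and let $Z_n:=\sum_{i=0}^n\xi(X_i)$. Assume $a:=\mathrm{ess\,sup}\,\xi_0<\infty$, and put $\xi_0^-:=\max\{-\xi_0,0\}$. (i) If $Q\{\xi_0^->\lambda\}\le \frac{1}{(\log\lambda)^{2+\varepsilon}}$ for some $\varepsilon>0$ and all large $\lambda$, then $$\mathbb P\otimes Q\Big\{\limsup_{n\to\infty}\frac{Z_n}{n}=a\Big\}=1.$$ (ii) If $Q\{\xi_0^->\lambda\}\ge \frac{1}{(\log\lambda)^{2-\varepsilon}}$ for some $\varepsilon>0$ and all large $\lambda$, then $$\mathbb P\otimes Q\Big\{\lim_{n\to\infty}\frac{Z_n}{n}=-\infty\Big\}=1.$$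
   Context: Given $\omega$, the random walk in random environment $(X_n)_{n\ge0}$ is the Markov chain on $\mathbb Z$ with $X_0=0$ and $P_\omega\{X_{n+1}=x+1\mid X_n=x\}=\omega_x=1-P_\omega\{X_{n+1}=x-1\mid X_n=x\}$. $P_\omega$ denotes the law of the walk for fixed $\omega$ (quenched law), $\mathbb P$ the joint law of $(\omega,(X_n)_{n\ge0})$ when $\omega$ has law $P$, and $\mathbb P\otimes Q$ the joint law of $(\omega,(X_n)_{n\ge0},\xi)$, where $\xi$ is independent of $(\omega,(X_n)_{n\ge0})$. *)

theory Defs
  imports "HOL-Probability.Probability"
begin

text \<open>Environments and sceneries are both real-valued families indexed by the integers; trajectories
  are integer sequences.\<close>

abbreviation real_fields :: "(int \<Rightarrow> real) measure" where
  "real_fields \<equiv> PiM UNIV (\<lambda>_. borel)"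

abbreviation trajectories :: "(nat \<Rightarrow> int) measure" where
  "trajectories \<equiv> PiM UNIV (\<lambda>_. count_space UNIV)"

definition iid_law :: "(int \<Rightarrow> real) measure \<Rightarrow> bool" where
  "iid_law P \<longleftrightarrow>
     prob_space P \<and> sets P = sets real_fields \<and>
     prob_space.indep_vars P (\<lambda>_. borel) (\<lambda>i \<omega>. \<omega> i) UNIV \<and>
     (\<forall>i. distr P borel (\<lambda>\<omega>. \<omega> i) = distr P borel (\<lambda>\<omega>. \<omega> 0))"

text \<open>The conditional law of \<open>X n\<close> given \<open>X 0, \<dots>, X (n - 1)\<close>. The Bernoulli distribution
  truncates its parameter to \<open>[0, 1]\<close>; this only makes the walk well-defined for
  every real field, and has no effect on environments with values in \<open>[0, 1]\<close>.\<close>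

definition walk_step :: "(int \<Rightarrow> real) \<Rightarrow> nat \<Rightarrow> (nat \<Rightarrow> int) \<Rightarrow> int pmf" where
  "walk_step \<omega> n X =
     (case n of
        0 \<Rightarrow> return_pmf 0
      | Suc m \<Rightarrow> map_pmf (\<lambda>b. if b then X m + 1 else X m - 1) (bernoulli_pmf (\<omega> (X m))))"

text \<open>\<open>P\<^sub>\<omega>\<close>: the law on trajectories with the above conditional laws, given by the
  Ionescu-Tulcea theorem.\<close>

definition quenched_law :: "(int \<Rightarrow> real) \<Rightarrow> (nat \<Rightarrow> int) measure" where
  "quenched_law \<omega> =
     projective_family.lim UNIV
       (Ionescu_Tulcea.CI (\<lambda>n X. measure_pmf (walk_step \<omega> n X)) (\<lambda>_. count_space UNIV))
       (\<lambda>_. count_space UNIV)"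

text \<open>The joint law of the environment and the walk, \<open>\<integral> \<delta>\<^sub>\<omega> \<otimes> P\<^sub>\<omega> P(d\<omega>)\<close>.\<close>

definition annealed_law ::
  "(int \<Rightarrow> real) measure \<Rightarrow> ((int \<Rightarrow> real) \<times> (nat \<Rightarrow> int)) measure" where
  "annealed_law P =
     P \<bind> (\<lambda>\<omega>. distr (quenched_law \<omega>) (real_fields \<Otimes>\<^sub>M trajectories) (\<lambda>X. (\<omega>, X)))"

definition walk_in_scenery :: "(int \<Rightarrow> real) \<Rightarrow> (nat \<Rightarrow> int) \<Rightarrow> nat \<Rightarrow> real" where
  "walk_in_scenery \<xi> X n = (\<Sum>i\<le>n. \<xi> (X i))"


context
begin

interpretation pmf_as_function .

lemma pmf_bernoulli_truncate:
  "pmf (bernoulli_pmf p) b = (if b then min 1 (max 0 p) else 1 - min 1 (max 0 p))"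
  by transfer simp

end

lemma emeasure_walk_step_Suc:
  "emeasure (measure_pmf (walk_step \<omega> (Suc m) X)) A =
     ennreal (min 1 (max 0 (\<omega> (X m)))) * indicator A (X m + 1) +
     ennreal (1 - min 1 (max 0 (\<omega> (X m)))) * indicator A (X m - 1)"
proof -
  have "emeasure (measure_pmf (walk_step \<omega> (Suc m) X)) A =
      (\<integral>\<^sup>+ b. indicator A (if b then X m + 1 else X m - 1) \<partial>measure_pmf (bernoulli_pmf (\<omega> (X m))))"
    by (simp add: walk_step_def flip: nn_integral_indicator)
       (rule nn_integral_cong, simp split: split_indicator)
  also have "\<dots> = (\<integral>\<^sup>+ b. ennreal (pmf (bernoulli_pmf (\<omega> (X m))) b) *
      indicator A (if b then X m + 1 else X m - 1) \<partial>count_space UNIV)"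
    by (rule nn_integral_measure_pmf)
  also have "\<dots> = (\<Sum>b\<in>UNIV. ennreal (pmf (bernoulli_pmf (\<omega> (X m))) b) *
      indicator A (if b then X m + 1 else X m - 1))"
    by (rule nn_integral_count_space_finite) simp
  also have "(\<Sum>b\<in>UNIV. h b) = h True + h False" for h :: "bool \<Rightarrow> ennreal"
    by (simp add: UNIV_bool add.commute)
  finally show ?thesis
    by (simp only: pmf_bernoulli_truncate if_True if_False)
qed

lemma measurable_walk_step:
  assumes [measurable]: "f \<in> N \<rightarrow>\<^sub>M real_fields" "\<And>m. n = Suc m \<Longrightarrow> (\<lambda>x. g x m) \<in> N \<rightarrow>\<^sub>M count_space UNIV"
  shows "(\<lambda>x. measure_pmf (walk_step (f x) n (g x))) \<in> N \<rightarrow>\<^sub>M subprob_algebra (count_space UNIV)"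
proof (rule measurable_subprob_algebra)
  fix A :: "int set"
  show "(\<lambda>x. emeasure (measure_pmf (walk_step (f x) n (g x))) A) \<in> borel_measurable N"
  proof (cases n)
    case 0
    then show ?thesis by (simp add: walk_step_def)
  next
    case (Suc m)
    note [measurable] = assms(2)[OF Suc]
    have [measurable]: "(\<lambda>x. f x (g x m)) \<in> borel_measurable N"
      by (rule measurable_compose_countable[where f = "\<lambda>i x. f x i"]) measurable
    show ?thesis
      unfolding Suc emeasure_walk_step_Suc by measurable
  qed
qed (auto simp: measure_pmf.subprob_space_axioms)

lemma Ionescu_Tulcea_walk_step:
  "Ionescu_Tulcea (\<lambda>n X. measure_pmf (walk_step \<omega> n X)) (\<lambda>_. count_space UNIV)"
proof
  show "(\<lambda>X. measure_pmf (walk_step \<omega> n X)) \<in>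
      PiM {0..<n} (\<lambda>_. count_space UNIV) \<rightarrow>\<^sub>M subprob_algebra (count_space UNIV)" for n
    by (rule measurable_walk_step) (auto simp: space_PiM)
qed

context
  fixes \<omega> :: "int \<Rightarrow> real"
begin

interpretation IT: Ionescu_Tulcea "\<lambda>n X. measure_pmf (walk_step \<omega> n X)" "\<lambda>_. count_space UNIV"
  by (rule Ionescu_Tulcea_walk_step)

lemma sets_quenched_law [measurable_cong]: "sets (quenched_law \<omega>) = sets trajectories"
  by (simp add: quenched_law_def)

lemma prob_space_quenched_law: "prob_space (quenched_law \<omega>)"
proof -
  have "emeasure (quenched_law \<omega>) (prod_emb UNIV (\<lambda>_. count_space UNIV) {} {\<lambda>_. undefined}) =
      emeasure (IT.CI {}) {\<lambda>_. undefined}"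
    unfolding quenched_law_def by (rule IT.lim) (auto simp: PiM_empty)
  also have "\<dots> = 1"
    using prob_space.emeasure_space_1[OF IT.PF.prob_space_P[of "{}"]]
    by (simp add: IT.CI_def space_PiM_empty)
  finally show ?thesis
    by (intro prob_spaceI)
       (simp add: prod_emb_def sets_eq_imp_space_eq[OF sets_quenched_law] space_PiM restrict_def vimage_def)
qed

lemma emeasure_quenched_law_path:
  "emeasure (quenched_law \<omega>) {X. \<forall>i<n. X i = x i} = (\<Prod>i<n. ennreal (pmf (walk_step \<omega> i x) (x i)))"
proof -
  have sing: "{restrict x {0..<n}} \<in> sets (PiM {0..<n} (\<lambda>_. count_space UNIV))" for n
  proof -
    have "{restrict x {0..<n}} = (\<Pi>\<^sub>E i\<in>{0..<n}. {x i})"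
      by (auto simp: PiE_iff extensional_def restrict_def fun_eq_iff)
    then show ?thesis by (auto intro!: sets_PiM_I_finite)
  qed
  have "emeasure (quenched_law \<omega>) {X. \<forall>i<n. X i = x i} =
      emeasure (quenched_law \<omega>) (prod_emb UNIV (\<lambda>_. count_space UNIV) {0..<n} {restrict x {0..<n}})"
  proof (rule arg_cong[where f = "emeasure _"])
    have "restrict X {0..<n} = restrict x {0..<n} \<longleftrightarrow> (\<forall>i<n. X i = x i)" for X
      unfolding restrict_def fun_eq_iff by (metis atLeast0LessThan lessThan_iff)
    then show "{X. \<forall>i<n. X i = x i} =
        prod_emb UNIV (\<lambda>_. count_space UNIV) {0..<n} {restrict x {0..<n}}"
      by (auto simp: prod_emb_def space_PiM)
  qed
  also have "\<dots> = emeasure (IT.CI {0..<n}) {restrict x {0..<n}}"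
    unfolding quenched_law_def by (rule IT.lim) (auto simp: sing)
  also have "\<dots> = emeasure (IT.C 0 n (\<lambda>_. undefined)) {restrict x {0..<n}}"
    by (subst IT.emeasure_CI[of _ n]) (auto simp: sing prod_emb_id)
  also have "\<dots> = (\<Prod>i<n. ennreal (pmf (walk_step \<omega> i x) (x i)))"
  proof (induction n)
    case 0
    then show ?case by (simp add: restrict_def sets_PiM_empty)
  next
    case (Suc n)
    have [simp]: "(\<lambda>_. undefined) \<in> space (PiM {0..<0::nat} (\<lambda>_. count_space (UNIV :: int set)))"
      by (simp add: space_PiM)
    have step: "emeasure (IT.eP n y) {restrict x {0..<Suc n}} =
        ennreal (pmf (walk_step \<omega> n x) (x n)) * indicator {restrict x {0..<n}} y"
      if y: "y \<in> space (PiM {0..<n} (\<lambda>_. count_space UNIV))" for y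
    proof -
      have und: "y i = undefined" if "\<not> i < n" for i
        using y that by (auto simp: space_PiM PiE_def extensional_def)
      have "y(n := z) = restrict x {0..<Suc n} \<longleftrightarrow> z = x n \<and> y = restrict x {0..<n}" for z
      proof
        assume eq: "y(n := z) = restrict x {0..<Suc n}"
        have "y i = restrict x {0..<n} i" for i
          using fun_cong[OF eq, of i] und[of i] by (cases "i < n") auto
        with fun_cong[OF eq, of n] show "z = x n \<and> y = restrict x {0..<n}"
          by auto
      qed (auto simp: fun_eq_iff)
      then have "{z. y(n := z) = restrict x {0..<Suc n}} =
          (if y = restrict x {0..<n} then {x n} else {})"
        by auto
      moreover have "walk_step \<omega> n (restrict x {0..<n}) = walk_step \<omega> n x"
        by (simp add: walk_step_def cong: if_cong split: nat.split)
      ultimately show ?thesis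
        using IT.emeasure_eP[OF y sing]
        by (auto simp: vimage_def emeasure_pmf_single split: split_indicator)
    qed
    have "emeasure (IT.C 0 (Suc n) (\<lambda>_. undefined)) {restrict x {0..<Suc n}} =
        (\<integral>\<^sup>+ y. emeasure (IT.eP n y) {restrict x {0..<Suc n}} \<partial>IT.C 0 n (\<lambda>_. undefined))"
      using IT.space_C[of "\<lambda>_. undefined" 0 n] IT.sets_C[of "\<lambda>_. undefined" 0 n]
      by (subst IT.C.simps, subst emeasure_bind[where N = "PiM {0..<Suc n} (\<lambda>_. count_space UNIV)"])
         (auto simp: sing measurable_cong_sets[OF IT.sets_C refl] prob_space.not_empty[OF IT.prob_space_C]
               simp del: IT.C.simps)
    also have "\<dots> = (\<integral>\<^sup>+ y. ennreal (pmf (walk_step \<omega> n x) (x n)) * indicator {restrict x {0..<n}} y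
        \<partial>IT.C 0 n (\<lambda>_. undefined))"
      by (intro nn_integral_cong step) (simp add: IT.space_C)
    also have "\<dots> = ennreal (pmf (walk_step \<omega> n x) (x n)) *
        emeasure (IT.C 0 n (\<lambda>_. undefined)) {restrict x {0..<n}}"
      by (rule nn_integral_cmult_indicator) (simp add: IT.sets_C sing)
    finally show ?case
      by (simp only: Suc.IH mult.commute prod.lessThan_Suc)
  qed
  finally show ?thesis .
qed

end

lemma measurable_quenched_law [measurable]:
  "quenched_law \<in> real_fields \<rightarrow>\<^sub>M prob_algebra trajectories"
proof (rule measurable_prob_algebra_generated[OF sets_PiM Int_stable_prod_algebra prod_algebra_sets_into_space])
  let ?M = "\<lambda>_::nat. count_space (UNIV :: int set)"
  let ?K = "\<lambda>\<omega> n X. measure_pmf (walk_step \<omega> n X)"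
  let ?C = "\<lambda>\<omega> n. Ionescu_Tulcea.C (?K \<omega>) ?M 0 n (\<lambda>_. undefined)"
  note IT = Ionescu_Tulcea_walk_step
  have C: "(\<lambda>\<omega>. ?C \<omega> n) \<in> real_fields \<rightarrow>\<^sub>M subprob_algebra (PiM {0..<n} ?M)" for n
  proof (induction n)
    case 0
    have "(\<lambda>_. undefined) \<in> space (PiM {0..<0::nat} ?M)"
      by (simp add: space_PiM)
    then show ?case
      unfolding Ionescu_Tulcea.C.simps[OF IT] add_0
      by (intro measurable_compose[OF measurable_const return_measurable])
  next
    case (Suc n)
    have step: "(\<lambda>p. distr (?K (fst p) n (snd p)) (PiM {0..<Suc n} ?M) (fun_upd (snd p) n)) \<in>
        real_fields \<Otimes>\<^sub>M PiM {0..<n} ?M \<rightarrow>\<^sub>M subprob_algebra (PiM {0..<Suc n} ?M)"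
    proof (rule measurable_distr2[where M = "count_space UNIV"])
      show "case_prod (\<lambda>p. fun_upd (snd p) n) \<in>
          (real_fields \<Otimes>\<^sub>M PiM {0..<n} ?M) \<Otimes>\<^sub>M count_space UNIV \<rightarrow>\<^sub>M PiM {0..<Suc n} ?M"
        unfolding case_prod_beta
        by (rule measurable_fun_upd[where J = "{0..<n}"]) auto
      show "(\<lambda>p. ?K (fst p) n (snd p)) \<in>
          real_fields \<Otimes>\<^sub>M PiM {0..<n} ?M \<rightarrow>\<^sub>M subprob_algebra (count_space UNIV)"
        by (rule measurable_walk_step) auto
    qed
    show ?case
      unfolding Ionescu_Tulcea.C.simps[OF IT] Ionescu_Tulcea.eP_def[OF IT] add_0
      by (intro measurable_bind[OF Suc] step)
  qed
  fix A assume "A \<in> prod_algebra UNIV ?M"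
  then obtain J E where J: "finite J" "A = prod_emb UNIV ?M J (Pi\<^sub>E J E)"
    by (auto elim!: prod_algebraE)
  have E: "Pi\<^sub>E J E \<in> sets (PiM J ?M)"
    using J by (intro sets_PiM_I_finite) auto
  obtain n where n: "J \<subseteq> {0..<n}"
    using finite_nat_iff_bounded[of J] J by (auto simp: atLeast0LessThan)
  have "emeasure (quenched_law \<omega>) A = emeasure (?C \<omega> n) (prod_emb {0..<n} ?M J (Pi\<^sub>E J E))" for \<omega>
    unfolding quenched_law_def J(2)
    by (simp only: Ionescu_Tulcea.lim[OF IT J(1) E] Ionescu_Tulcea.emeasure_CI[OF IT n E])
  then show "(\<lambda>\<omega>. emeasure (quenched_law \<omega>) A) \<in> borel_measurable real_fields"
    using measurable_emeasure_kernel[OF C measurable_prod_emb[OF n E]]  by simp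
qed (simp_all add: prob_space_quenched_law sets_quenched_law)

lemma measurable_quenched_law_Pair:
  "(\<lambda>\<omega>. distr (quenched_law \<omega>) (real_fields \<Otimes>\<^sub>M trajectories) (\<lambda>X. (\<omega>, X)))
     \<in> real_fields \<rightarrow>\<^sub>M prob_algebra (real_fields \<Otimes>\<^sub>M trajectories)"
  by measurable

lemma
  assumes "prob_space P" "sets P = sets real_fields"
  shows prob_space_annealed_law: "prob_space (annealed_law P)"
    and sets_annealed_law: "sets (annealed_law P) = sets (real_fields \<Otimes>\<^sub>M trajectories)"
proof -
  have "P \<in> space (prob_algebra real_fields)"
    using assms by (simp add: space_prob_algebra)
  from measurable_bind_prob_space[OF measurable_const[OF this, of "count_space UNIV"]
      measurable_quenched_law_Pair, THEN measurable_space, of undefined]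
  show "prob_space (annealed_law P)"
    "sets (annealed_law P) = sets (real_fields \<Otimes>\<^sub>M trajectories)"
    by (simp_all add: annealed_law_def space_prob_algebra)
qed

end

theory Submission
  imports Defs "HOL-Real_Asymp.Real_Asymp"
begin

text \<open>
  The environment acts on the walk through its potential \<open>V\<close>, which is itself a walk, with
  increment \<open>ln ((1 - \<omega> x) / \<omega> x)\<close> at the site \<open>x\<close>.  To climb by \<open>H\<close> in \<open>V\<close> takes the walk a
  time of order \<open>exp H\<close>, and while it is held in a valley of \<open>V\<close> the time it spends at \<open>x\<close> is
  proportional to \<open>exp (- V x)\<close>.  As \<open>V\<close> is centred with bounded increments, it varies by about
  \<open>sqrt L\<close> on an interval of length \<open>L\<close>, so up to the time \<open>n\<close> the walk sees about \<open>(ln n)\<^sup>2\<close>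
  sites.  Among the values of \<open>- \<xi>\<close> at so many sites there is one larger than \<open>n\<close> if and only
  if, roughly, the tail exponent of the logarithm of \<open>\<xi>\<^sup>-\<close> is smaller than \<open>2\<close>.  This is where
  the two cases come from.

  Exponent larger than \<open>2\<close>.  Let \<open>g x = max 0 (a - \<eta> - x)\<close> be the cost of a scenery value \<open>x\<close>.
  It is enough to find, for every \<open>\<eta>\<close>, infinitely many \<open>n\<close> for which the quenched probability
  that the costs up to \<open>n\<close> sum up to \<open>\<eta> * n\<close> is small (\<open>frequently_localized\<close>): by Fatou's lemma
  the walk then almost surely has averages close to \<open>a\<close> at infinitely many times
  (\<open>AE_frequently_small_cost\<close>, \<open>limsup_averages_eq\<close>).  Such times are produced by valleys.  When
  the walk is held in a valley with bottom \<open>b\<close>, the cost per step is at most a constant times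
  the sum of \<open>g (\<xi> x) * exp (- (V x - V b))\<close> over the valley (\<open>walk_in_valley\<close>).  The proof is a
  maximal inequality for an explicit solution of the Poisson equation of the walk
  (\<open>quenched_stopped_bound\<close>, \<open>poisson_drift\<close>).  That sum is tight, uniformly in the width of the
  valley (\<open>prob_valley_sum_large\<close>): about \<open>h\<^sup>2\<close> sites lie within the height \<open>h\<close> of the minimum,
  and a site at the height \<open>h\<close> matters only if its cost exceeds \<open>exp h\<close>, which has a probability
  of order \<open>h powr - (2 + \<epsilon>)\<close>.  To make the sum small and not only bounded, a block of \<open>2 * M\<close>
  sites with zero cost is inserted at the bottom, through which \<open>V\<close> first falls and then rises
  by a multiple of \<open>M\<close>.  This lifts all other sites relative to the bottom, and it reduces the
  probability by a constant factor only (\<open>prob_right_valley_ge\<close>), because the place of the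
  insertion can be read off from the result.  So valleys with small sums have a probability
  bounded from below at every scale; scales that use disjoint sets of sites are independent,
  hence almost surely infinitely many of them have such a valley
  (\<open>independent_infinitely_often\<close>).

  Exponent smaller than \<open>2\<close>.  At the times \<open>2 ^ 2 ^ k\<close> and on the intervals from \<open>- L\<close> to \<open>L\<close>
  with \<open>L = 2 powr (k * (2 - \<epsilon> / 2))\<close>, the potential is, almost surely for large \<open>k\<close>, at most
  \<open>2 ^ k / 8\<close> (Kolmogorov's inequality), so the walk leaves the interval in time and has then
  visited all sites of one of its halves (\<open>AE_quenched_exits\<close>, \<open>nearest_neighbour_visits\<close>).
  Each half contains a site with a value so negative (\<open>AE_deep_site\<close>) that the bounded positive
  values cannot make up for it before the next time \<open>2 ^ 2 ^ Suc k\<close>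
  (\<open>walk_in_scenery_diverges\<close>).

  Both arguments concern almost every pair of an environment and a scenery and the quenched law
  given this pair; \<open>measure_annealed_eq_1\<close> carries the conclusions over to the joint law.
\<close>

section \<open>The quenched walk up to a finite time\<close>

text \<open>The quenched law is a projective limit.  Paths of finite length are treated as lists, for
  which conditioning on the first step is structural recursion.\<close>
primrec walk_path :: "(int \<Rightarrow> real) \<Rightarrow> nat \<Rightarrow> int \<Rightarrow> int list pmf" where
  "walk_path \<omega> 0 x = return_pmf [x]"
| "walk_path \<omega> (Suc n) x = bernoulli_pmf (\<omega> x) \<bind>
     (\<lambda>b. map_pmf ((#) x) (walk_path \<omega> n (if b then x + 1 else x - 1)))"

definition step_prob :: "(int \<Rightarrow> real) \<Rightarrow> int \<Rightarrow> int \<Rightarrow> real" where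
  "step_prob \<omega> x y = pmf (map_pmf (\<lambda>b. if b then x + 1 else x - 1) (bernoulli_pmf (\<omega> x))) y"

lemma set_walk_path:
  assumes "l \<in> set_pmf (walk_path \<omega> n x)"
  shows "length l = Suc n" "l ! 0 = x" "i < n \<Longrightarrow> \<bar>l ! Suc i - l ! i\<bar> = 1"
  using assms
proof (induction n arbitrary: x l i)
  case (Suc n)
  { case 1 with Suc.IH show ?case by auto }
  { case 2 with Suc.IH show ?case by auto }
  { case 3
    then obtain b l' where l: "l = x # l'" "l' \<in> set_pmf (walk_path \<omega> n (if b then x + 1 else x - 1))"
      by (auto simp del: set_pmf_bernoulli)
    then show ?case
      using Suc.IH(2)[OF l(2)] Suc.IH(3)[OF _ l(2)] 3(1) by (cases i) (auto split: if_splits) }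
qed auto

lemma pmf_walk_path_Cons:
  "pmf (walk_path \<omega> (Suc n) x) (z # l) =
     (if z = x then step_prob \<omega> x (hd l) * pmf (walk_path \<omega> n (hd l)) l else 0)"
proof -
  let ?y = "\<lambda>b. if b then x + 1 else x - 1"
  have cons: "pmf (map_pmf ((#) x) q) (z # l) = (if z = x then pmf q l else 0)" for q
  proof (cases "z = x")
    case True
    then show ?thesis by (simp add: pmf_map_inj')
  next
    case False
    then have "z # l \<notin> set_pmf (map_pmf ((#) x) q)" by auto
    then have "pmf (map_pmf ((#) x) q) (z # l) = 0" by (simp only: set_pmf_iff not_not)
    with False show ?thesis by simp
  qed
  have hd: "pmf (walk_path \<omega> n y) l = (if y = hd l then pmf (walk_path \<omega> n (hd l)) l else 0)" for y
  proof (cases "l \<in> set_pmf (walk_path \<omega> n y)")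
    case True
    then show ?thesis using set_walk_path(1,2)[OF True] by (cases l) auto
  next
    case False
    then show ?thesis by (auto simp: set_pmf_iff)
  qed

  have "pmf (walk_path \<omega> (Suc n) x) (z # l) =
      (LINT b|bernoulli_pmf (\<omega> x). (if z = x then pmf (walk_path \<omega> n (?y b)) l else 0))"
    by (simp add: pmf_bind cons)
  also have "\<dots> = (LINT b|bernoulli_pmf (\<omega> x). indicator {hd l} (?y b) *
      (if z = x then pmf (walk_path \<omega> n (hd l)) l else 0))"
    by (intro integral_cong_AE AE_pmfI) (auto simp: hd[of "x + 1"] hd[of "x - 1"])
  also have "\<dots> = (LINT b|bernoulli_pmf (\<omega> x). indicator {hd l} (?y b)) *
      (if z = x then pmf (walk_path \<omega> n (hd l)) l else 0)"
    by (rule integral_mult_left_zero)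
  also have "(LINT b|bernoulli_pmf (\<omega> x). indicator {hd l} (?y b)) =
      (LINT y|map_pmf ?y (bernoulli_pmf (\<omega> x)). indicator {hd l} y :: real)"
    by (rule integral_map_pmf[symmetric])
  also have "\<dots> = step_prob \<omega> x (hd l)"
    by (simp add: step_prob_def pmf.rep_eq)
  finally show ?thesis by simp
qed

lemma pmf_walk_path:
  assumes "length l = Suc n"
  shows "pmf (walk_path \<omega> n x) l =
    (if l ! 0 = x then (\<Prod>i<n. step_prob \<omega> (l ! i) (l ! Suc i)) else 0)"
  using assms
proof (induction n arbitrary: x l)
  case 0
  then obtain z where "l = [z]" by (cases l) auto
  then show ?case by (auto simp: pmf_return)
next
  case (Suc n)
  then obtain z l' where l: "l = z # l'" "length l' = Suc n" by (cases l) auto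
  then have "hd l' = l' ! 0" by (cases l') auto
  with l Suc.IH[OF l(2), of "hd l'"] show ?case
    by (simp only: pmf_walk_path_Cons) (simp add: prod.lessThan_Suc_shift del: prod.lessThan_Suc)
qed

lemma measurable_quenched_law_path:
  "(\<lambda>X. map X [0..<n]) \<in> quenched_law \<omega> \<rightarrow>\<^sub>M count_space UNIV"
proof -
  have "(\<lambda>X. map X [0..<n]) \<in> trajectories \<rightarrow>\<^sub>M count_space UNIV"
  proof (induction n)
    case (Suc n)
    note [measurable] = Suc
    have "(\<lambda>X. map X [0..<n] @ [X n]) \<in> trajectories \<rightarrow>\<^sub>M count_space UNIV"
      by (rule measurable_compose_countable[where g = "\<lambda>X. X n"],
          rule measurable_compose_countable[where g = "\<lambda>X. map X [0..<n]"]) auto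
    then show ?case by simp
  qed simp
  then show ?thesis by (simp only: measurable_cong_sets[OF sets_quenched_law refl])
qed

text \<open>Both laws give a finite path the product of its one-step probabilities, and lists of integers
  form a countable set.\<close>

lemma distr_quenched_law_path:
  "distr (quenched_law \<omega>) (count_space UNIV) (\<lambda>X. map X [0..<Suc n]) = measure_pmf (walk_path \<omega> n 0)"
proof (rule measure_eqI_countable[of _ UNIV])
  note meas = measurable_quenched_law_path[of "Suc n" \<omega>]
  fix l :: "int list"
  show "emeasure (distr (quenched_law \<omega>) (count_space UNIV) (\<lambda>X. map X [0..<Suc n])) {l} =
    emeasure (measure_pmf (walk_path \<omega> n 0)) {l}"
  proof (cases "length l = Suc n")
    case True
    have "emeasure (distr (quenched_law \<omega>) (count_space UNIV) (\<lambda>X. map X [0..<Suc n])) {l} =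
        emeasure (quenched_law \<omega>) {X. \<forall>i<Suc n. X i = l ! i}"
      using True by (subst emeasure_distr[OF meas])
        (auto simp: list_eq_iff_nth_eq sets_eq_imp_space_eq[OF sets_quenched_law] space_PiM
           simp del: upt_Suc intro!: arg_cong[where f = "emeasure _"])
    also have "\<dots> = (\<Prod>i<Suc n. ennreal (pmf (walk_step \<omega> i ((!) l)) (l ! i)))"
      by (rule emeasure_quenched_law_path)
    also have "\<dots> = ennreal (pmf (walk_path \<omega> n 0) l)"
      by (subst prod.lessThan_Suc_shift)
        (auto simp: walk_step_def pmf_return pmf_walk_path[OF True] step_prob_def prod_ennreal)
    finally show ?thesis by (simp add: emeasure_pmf_single)
  next
    case False
    then have "(\<lambda>X. map X [0..<Suc n]) -` {l} = {}" by auto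
    moreover have "l \<notin> set_pmf (walk_path \<omega> n 0)" using False set_walk_path(1) by blast
    ultimately show ?thesis
      by (simp only: emeasure_distr[OF meas] sets_count_space Pow_UNIV UNIV_I emeasure_pmf_single set_pmf_iff not_not) simp
  qed
qed simp_all

text \<open>A nonnegative function \<open>F\<close> that decreases along the walk by at least \<open>g - \<theta>\<close> on average while
  the walk stays in \<open>D\<close> dominates the accumulated cost \<open>g\<close>.  Outside \<open>D\<close> the walk is stopped,
  and the value of \<open>F\<close> there is a penalty for leaving.\<close>

fun stopped_cost :: "int set \<Rightarrow> (int \<Rightarrow> real) \<Rightarrow> (int \<Rightarrow> real) \<Rightarrow> int list \<Rightarrow> real" where
  "stopped_cost D g F [] = 0"
| "stopped_cost D g F [x] = F x"
| "stopped_cost D g F (x # y # l) = (if x \<in> D then g x + stopped_cost D g F (y # l) else F x)"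

lemma stopped_cost_nonneg:
  "(\<And>x. 0 \<le> F x) \<Longrightarrow> (\<And>x. 0 \<le> g x) \<Longrightarrow> 0 \<le> stopped_cost D g F l"
  by (induction D g F l rule: stopped_cost.induct) auto

lemma stopped_cost_ge:
  assumes F: "\<And>x. 0 \<le> F x" and g: "\<And>x. 0 \<le> g x" and "\<And>x. x \<notin> D \<Longrightarrow> c \<le> F x"
    and "l \<noteq> []" "(\<exists>x\<in>set l. x \<notin> D) \<or> c \<le> sum_list (map g (butlast l))"
  shows "c \<le> stopped_cost D g F l"
  using assms(3-5)
proof (induction l arbitrary: c rule: induct_list012)
  case (2 x)
  then show ?case by (auto intro: order_trans[OF _ F])
next
  case (3 x y l)
  show ?case
  proof (cases "x \<in> D")
    case True
    have "c - g x \<le> stopped_cost D g F (y # l)"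
    proof (rule "3.IH"(2))
      show "c - g x \<le> F z" if "z \<notin> D" for z using "3.prems"(1)[OF that] g[of x] by linarith
      show "(\<exists>z\<in>set (y # l). z \<notin> D) \<or> c - g x \<le> sum_list (map g (butlast (y # l)))"
        using "3.prems"(3) True by auto
    qed simp
    with True show ?thesis by simp
  qed (use 3 in simp)
qed simp

lemma stopped_cost_ge_sum:
  assumes "\<And>x. 0 \<le> F x" "set l \<subseteq> D"
  shows "sum_list (map g (butlast l)) \<le> stopped_cost D g F l"
  using assms(2) by (induction l rule: induct_list012) (auto simp: assms(1))

text \<open>Conditioning on the first step gives a recursion in \<open>n\<close> for the expected stopped cost; the
  drift condition says that \<open>F x + \<theta> * n\<close> is a supersolution of it.\<close>
lemma nn_integral_stopped_cost:
  assumes F: "\<And>x. 0 \<le> F x" and g: "\<And>x. 0 \<le> g x" and \<theta>: "0 \<le> \<theta>"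
    and \<omega>: "\<And>x. 0 \<le> \<omega> x" "\<And>x. \<omega> x \<le> 1"
    and drift: "\<And>x. x \<in> D \<Longrightarrow> \<omega> x * F (x + 1) + (1 - \<omega> x) * F (x - 1) + g x \<le> F x + \<theta>"
  shows "(\<integral>\<^sup>+ l. ennreal (stopped_cost D g F l) \<partial>walk_path \<omega> n x) \<le> ennreal (F x + \<theta> * n)"
proof (induction n arbitrary: x)
  case (Suc n)
  note [simp] = F g \<theta> \<omega> stopped_cost_nonneg
  let ?E = "\<lambda>x. \<integral>\<^sup>+ l. ennreal (stopped_cost D g F l) \<partial>walk_path \<omega> n x"
  have cons: "stopped_cost D g F (x # l) = (if x \<in> D then g x + stopped_cost D g F l else F x)"
    if "l \<in> set_pmf (walk_path \<omega> n y)" for l y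
    using set_walk_path(1)[OF that] by (cases l) auto
  have step: "(\<integral>\<^sup>+ l. ennreal (stopped_cost D g F (x # l)) \<partial>walk_path \<omega> n y) =
      (if x \<in> D then ennreal (g x) + ?E y else ennreal (F x))" for y
  proof -
    have "(\<integral>\<^sup>+ l. ennreal (stopped_cost D g F (x # l)) \<partial>walk_path \<omega> n y) =
      (\<integral>\<^sup>+ l. (if x \<in> D then ennreal (g x) + ennreal (stopped_cost D g F l) else ennreal (F x)) \<partial>walk_path \<omega> n y)"
      by (intro nn_integral_cong_AE AE_pmfI) (simp add: cons)
    also have "\<dots> = (if x \<in> D then ennreal (g x) + ?E y else ennreal (F x))"
      by (simp add: nn_integral_add)
    finally show ?thesis .
  qed
  have "(\<integral>\<^sup>+ l. ennreal (stopped_cost D g F l) \<partial>walk_path \<omega> (Suc n) x) =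
      (if x \<in> D then ennreal (g x) + ?E (x + 1) else ennreal (F x)) * ennreal (\<omega> x) +
      (if x \<in> D then ennreal (g x) + ?E (x - 1) else ennreal (F x)) * ennreal (1 - \<omega> x)"
    by (simp add: nn_integral_bind_pmf nn_integral_map_pmf step)
  also have "\<dots> \<le> ennreal (F x + \<theta> * Suc n)"
  proof (cases "x \<in> D")
    case True
    have "(ennreal (g x) + ?E (x + 1)) * ennreal (\<omega> x) + (ennreal (g x) + ?E (x - 1)) * ennreal (1 - \<omega> x)
      \<le> (ennreal (g x) + ennreal (F (x + 1) + \<theta> * n)) * ennreal (\<omega> x) +
         (ennreal (g x) + ennreal (F (x - 1) + \<theta> * n)) * ennreal (1 - \<omega> x)"
      by (intro add_mono mult_right_mono Suc.IH) auto
    also have "\<dots> = ennreal ((g x + (F (x + 1) + \<theta> * n)) * \<omega> x + (g x + (F (x - 1) + \<theta> * n)) * (1 - \<omega> x))"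
      by (simp add: ennreal_plus ennreal_mult del: ennreal_plus flip: ennreal_plus ennreal_mult)
    also have "\<dots> \<le> ennreal (F x + \<theta> * Suc n)"
      using drift[OF True] by (intro ennreal_leI) (simp add: algebra_simps)
    finally show ?thesis using True by simp
  next
    case False
    have "ennreal (F x) * ennreal (\<omega> x) + ennreal (F x) * ennreal (1 - \<omega> x) = ennreal (F x)"
      by (simp flip: ennreal_plus ennreal_mult distrib_left)
    also have "\<dots> \<le> ennreal (F x + \<theta> * Suc n)" by (intro ennreal_leI) simp
    finally show ?thesis using False by simp
  qed
  finally show ?case .
qed simp

lemma quenched_stopped_markov:
  assumes F: "\<And>x. 0 \<le> F x" and g: "\<And>x. 0 \<le> g x" and \<theta>: "0 \<le> \<theta>"
    and \<omega>: "\<And>x. 0 \<le> \<omega> x" "\<And>x. \<omega> x \<le> 1"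
    and drift: "\<And>x. x \<in> D \<Longrightarrow> \<omega> x * F (x + 1) + (1 - \<omega> x) * F (x - 1) + g x \<le> F x + \<theta>"
    and c: "0 < c" and B: "\<And>l. l \<noteq> [] \<Longrightarrow> l \<in> B \<Longrightarrow> c \<le> stopped_cost D g F l"
  shows "emeasure (quenched_law \<omega>) {X \<in> space (quenched_law \<omega>). map X [0..<Suc n] \<in> B} \<le> ennreal ((F 0 + \<theta> * n) / c)"
proof -
  let ?f = "\<lambda>X. map X [0..<Suc n]"
  have meas: "?f \<in> quenched_law \<omega> \<rightarrow>\<^sub>M count_space UNIV"
    by (rule measurable_quenched_law_path)
  have "{X \<in> space (quenched_law \<omega>). ?f X \<in> B} = ?f -` B \<inter> space (quenched_law \<omega>)" by auto
  then have "emeasure (quenched_law \<omega>) {X \<in> space (quenched_law \<omega>). ?f X \<in> B}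
     = emeasure (distr (quenched_law \<omega>) (count_space UNIV) ?f) B"
    by (simp add: emeasure_distr[OF meas] del: upt_Suc)
  also have "\<dots> = (\<integral>\<^sup>+ l. indicator B l \<partial>walk_path \<omega> n 0)"
    by (simp only: distr_quenched_law_path) (rule nn_integral_indicator[symmetric], simp)
  also have "\<dots> \<le> (\<integral>\<^sup>+ l. ennreal (1 / c) * ennreal (stopped_cost D g F l) \<partial>walk_path \<omega> n 0)"
  proof (intro nn_integral_mono_AE AE_pmfI)
    fix l assume "l \<in> set_pmf (walk_path \<omega> n 0)"
    then have "l \<noteq> []" using set_walk_path(1) by fastforce
    have "ennreal 1 \<le> ennreal (1 / c * stopped_cost D g F l)" if "l \<in> B"
      using B[OF \<open>l \<noteq> []\<close> that] c by (intro ennreal_leI) (auto simp: field_simps)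
    then show "indicator B l \<le> ennreal (1 / c) * ennreal (stopped_cost D g F l)"
      using c stopped_cost_nonneg[of F g D l] F g by (simp split: split_indicator flip: ennreal_mult)
  qed
  also have "\<dots> = ennreal (1 / c) * (\<integral>\<^sup>+ l. ennreal (stopped_cost D g F l) \<partial>walk_path \<omega> n 0)"
    by (rule nn_integral_cmult) simp
  also have "\<dots> \<le> ennreal (1 / c) * ennreal (F 0 + \<theta> * n)"
    by (intro mult_left_mono nn_integral_stopped_cost F g \<theta> \<omega> drift) auto
  also have "\<dots> = ennreal ((F 0 + \<theta> * n) / c)"
    using c F[of 0] \<theta> by (simp del: ennreal_plus flip: ennreal_mult)
  finally show ?thesis .
qed

lemma path_list_simps:
  "set (map X [0..<Suc n]) = X ` {..n}" "butlast (map X [0..<Suc n]) = map X [0..<n]"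
  "sum_list (map g (map X [0..<n])) = (\<Sum>i<n. g (X i) :: real)"
  by (auto simp: atLeast0LessThan lessThan_Suc_atMost interv_sum_list_conv_sum_set_nat comp_def simp del: upt_Suc)
    simp

text \<open>Since \<open>F\<close> is at least \<open>c\<close> outside \<open>D\<close>, a walk that leaves \<open>D\<close> has already paid \<open>c\<close>.  So one
  application of Markov's inequality controls at the same time whether the walk leaves a valley
  and what it pays inside.\<close>
proposition quenched_stopped_bound:
  assumes F: "\<And>x. 0 \<le> F x" and g: "\<And>x. 0 \<le> g x" and \<theta>: "0 \<le> \<theta>"
    and \<omega>: "\<And>x. 0 \<le> \<omega> x" "\<And>x. \<omega> x \<le> 1"
    and drift: "\<And>x. x \<in> D \<Longrightarrow> \<omega> x * F (x + 1) + (1 - \<omega> x) * F (x - 1) + g x \<le> F x + \<theta>"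
    and c: "0 < c" "\<And>x. x \<notin> D \<Longrightarrow> c \<le> F x"
  shows "emeasure (quenched_law \<omega>) {X \<in> space (quenched_law \<omega>). (\<exists>i\<le>n. X i \<notin> D) \<or> c \<le> (\<Sum>i<n. g (X i))}
    \<le> ennreal ((F 0 + \<theta> * n) / c)"
proof -
  have "{X \<in> space (quenched_law \<omega>). (\<exists>i\<le>n. X i \<notin> D) \<or> c \<le> (\<Sum>i<n. g (X i))} =
      {X \<in> space (quenched_law \<omega>). map X [0..<Suc n] \<in> {l. (\<exists>x\<in>set l. x \<notin> D) \<or> c \<le> sum_list (map g (butlast l))}}"
    unfolding mem_Collect_eq path_list_simps by auto
  moreover have "emeasure (quenched_law \<omega>) {X \<in> space (quenched_law \<omega>). map X [0..<Suc n] \<in> {l. (\<exists>x\<in>set l. x \<notin> D) \<or> c \<le> sum_list (map g (butlast l))}}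
      \<le> ennreal ((F 0 + \<theta> * n) / c)"
    by (rule quenched_stopped_markov[OF F g \<theta> \<omega> drift c(1)]) (auto intro!: stopped_cost_ge F g c(2))
  ultimately show ?thesis by (simp only:)
qed

text \<open>With unit cost, a walk that stays in \<open>D\<close> up to the time \<open>n\<close> has paid \<open>n\<close>.\<close>
proposition quenched_exit_bound:
  assumes F: "\<And>x. 0 \<le> F x" and \<omega>: "\<And>x. 0 \<le> \<omega> x" "\<And>x. \<omega> x \<le> 1"
    and drift: "\<And>x. x \<in> D \<Longrightarrow> \<omega> x * F (x + 1) + (1 - \<omega> x) * F (x - 1) + 1 \<le> F x" and n: "0 < n"
  shows "emeasure (quenched_law \<omega>) {X \<in> space (quenched_law \<omega>). \<forall>i\<le>n. X i \<in> D} \<le> ennreal (F 0 / n)"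
proof -
  have "emeasure (quenched_law \<omega>) {X \<in> space (quenched_law \<omega>). map X [0..<Suc n] \<in> {l. set l \<subseteq> D \<and> length l = Suc n}} \<le>
      ennreal ((F 0 + (0 :: real) * real n) / real n)"
  proof (rule quenched_stopped_markov[where g = "\<lambda>_. 1" and D = D, OF F _ _ \<omega>])
    fix l :: "int list" assume "l \<noteq> []" "l \<in> {l. set l \<subseteq> D \<and> length l = Suc n}"
    then show "real n \<le> stopped_cost D (\<lambda>_. 1) F l"
      using stopped_cost_ge_sum[OF F, of l D "\<lambda>_. 1"] by (simp add: sum_list_triv)
  qed (use drift n in auto)
  moreover have "{X \<in> space (quenched_law \<omega>). map X [0..<Suc n] \<in> {l. set l \<subseteq> D \<and> length l = Suc n}} =
      {X \<in> space (quenched_law \<omega>). \<forall>i\<le>n. X i \<in> D}"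
    unfolding mem_Collect_eq path_list_simps by auto
  ultimately show ?thesis by simp
qed

lemma AE_quenched_nearest_neighbour:
  "AE X in quenched_law \<omega>. X 0 = 0 \<and> (\<forall>i. \<bar>X (Suc i) - X i\<bar> = 1)"
proof -
  have "AE X in quenched_law \<omega>. X 0 = 0 \<and> \<bar>X (Suc i) - X i\<bar> = 1" for i
  proof -
    let ?f = "\<lambda>X. map X [0..<Suc (Suc i)]"
    have "AE l in walk_path \<omega> (Suc i) 0. l ! 0 = 0 \<and> \<bar>l ! Suc i - l ! i\<bar> = 1"
      by (intro AE_pmfI conjI) (blast intro: set_walk_path)+
    then have "AE X in quenched_law \<omega>. ?f X ! 0 = 0 \<and> \<bar>?f X ! Suc i - ?f X ! i\<bar> = 1"
      unfolding distr_quenched_law_path[symmetric]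
      by (rule AE_distrD[OF measurable_quenched_law_path])
    then show ?thesis by (simp del: upt_Suc)
  qed
  then show ?thesis by (simp add: AE_all_countable flip: all_simps)
qed

section \<open>Explicit solutions of the Poisson equation in a potential\<close>

text \<open>In the language of electrical networks, \<open>exp (V x)\<close> is the resistance of the edge from \<open>x\<close> to
  \<open>x + 1\<close>, and \<open>step_weight V\<close> is the reversible measure of the walk.  A current flows towards
  \<open>b\<close>: on its way it collects the cost \<open>step_weight V z * g z\<close> of every site that it passes, and
  it enters at the boundary with the strength \<open>j\<close>.  Current times resistance, summed from \<open>x\<close> to
  \<open>b\<close>, solves the Poisson equation.\<close>
definition step_weight :: "(int \<Rightarrow> real) \<Rightarrow> int \<Rightarrow> real" where
  "step_weight V x = exp (- V x) + exp (- V (x - 1))"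

definition flux_left :: "(int \<Rightarrow> real) \<Rightarrow> (int \<Rightarrow> real) \<Rightarrow> int \<Rightarrow> real \<Rightarrow> int \<Rightarrow> real" where
  "flux_left V g lo j y = j + (\<Sum>z\<in>{lo<..y}. step_weight V z * g z)"

definition flux_right :: "(int \<Rightarrow> real) \<Rightarrow> (int \<Rightarrow> real) \<Rightarrow> int \<Rightarrow> real \<Rightarrow> int \<Rightarrow> real" where
  "flux_right V g hi j y = j + (\<Sum>z\<in>{y<..<hi}. step_weight V z * g z)"

definition poisson_left :: "(int \<Rightarrow> real) \<Rightarrow> (int \<Rightarrow> real) \<Rightarrow> int \<Rightarrow> real \<Rightarrow> int \<Rightarrow> int \<Rightarrow> real" where
  "poisson_left V g lo j b x = (\<Sum>y\<in>{x..<b}. flux_left V g lo j y * exp (V y))"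

definition poisson_right :: "(int \<Rightarrow> real) \<Rightarrow> (int \<Rightarrow> real) \<Rightarrow> int \<Rightarrow> real \<Rightarrow> int \<Rightarrow> int \<Rightarrow> real" where
  "poisson_right V g hi j b x = (\<Sum>y\<in>{b..<x}. flux_right V g hi j y * exp (V y))"

lemma step_weight_pos: "0 < step_weight V x"
  by (simp add: step_weight_def add_pos_pos)

lemma flux_nonneg:
  assumes "\<And>x. 0 \<le> g x" "0 \<le> j"
  shows "0 \<le> flux_left V g lo j y" "0 \<le> flux_right V g hi j y" "j \<le> flux_left V g lo j y" "j \<le> flux_right V g hi j y"
  using assms step_weight_pos[of V] unfolding flux_left_def flux_right_def
  by (auto intro!: add_nonneg_nonneg sum_nonneg mult_nonneg_nonneg simp: less_imp_le)

lemma poisson_nonneg: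
  assumes "\<And>x. 0 \<le> g x" "0 \<le> j"
  shows "0 \<le> poisson_left V g lo j b x" "0 \<le> poisson_right V g hi j b x"
  using assms unfolding poisson_left_def poisson_right_def
  by (auto intro!: sum_nonneg mult_nonneg_nonneg flux_nonneg)

lemma sum_int_Suc_left: "x < b \<Longrightarrow> (\<Sum>y\<in>{x..<b::int}. f y) = f x + (\<Sum>y\<in>{x + 1..<b}. f y :: real)"
proof -
  assume "x < b"
  then have "{x..<b} = insert x {x + 1..<b}" by auto
  then show ?thesis by simp
qed

lemma sum_int_Suc_right: "b \<le> x \<Longrightarrow> (\<Sum>y\<in>{b..<x + 1::int}. f y) = (\<Sum>y\<in>{b..<x}. f y :: real) + f x"
proof -
  assume "b \<le> x"
  then have "{b..<x + 1} = insert x {b..<x}" by auto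
  then show ?thesis by simp
qed

lemma poisson_left_diff:
  "x < b \<Longrightarrow> poisson_left V g lo j b x = flux_left V g lo j x * exp (V x) + poisson_left V g lo j b (x + 1)"
  unfolding poisson_left_def by (rule sum_int_Suc_left)

lemma poisson_right_diff:
  "b \<le> x \<Longrightarrow> poisson_right V g hi j b (x + 1) = poisson_right V g hi j b x + flux_right V g hi j x * exp (V x)"
  unfolding poisson_right_def by (rule sum_int_Suc_right)

lemma flux_left_diff: "lo < x \<Longrightarrow> flux_left V g lo j x = flux_left V g lo j (x - 1) + step_weight V x * g x"
proof -
  assume "lo < x"
  then have "{lo<..x} = insert x {lo<..x - 1}" by auto
  then show ?thesis by (simp add: flux_left_def)
qed

lemma flux_right_diff: "x < hi \<Longrightarrow> flux_right V g hi j (x - 1) = flux_right V g hi j x + step_weight V x * g x"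
proof -
  assume "x < hi"
  then have "{x - 1<..<hi} = insert x {x<..<hi}" by auto
  then show ?thesis by (simp add: flux_right_def)
qed

text \<open>The mean step of a function in terms of its two increments at \<open>x\<close>: the weights \<open>p * exp (V x)\<close>
  and \<open>(1 - p) * exp (V (x - 1))\<close> of the two currents agree, because the walk is reversible.\<close>
lemma flux_balance:
  fixes V :: "int \<Rightarrow> real"
  assumes p: "p = exp (- V x) / step_weight V x"
    and "F1 = F0 + A * exp (V x)" "F2 = F0 + B * exp (V (x - 1))" "A + B = step_weight V x * e"
  shows "p * F1 + (1 - p) * F2 = F0 + e"
proof -
  have w: "step_weight V x \<noteq> 0" using step_weight_pos[of V x] by simp
  have p': "1 - p = exp (- V (x - 1)) / step_weight V x"
    using w unfolding p by (simp add: field_simps) (simp add: step_weight_def)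
  have "p * F1 + (1 - p) * F2 = F0 + (p * exp (V x)) * A + ((1 - p) * exp (V (x - 1))) * B"
    unfolding assms(2,3) by (simp add: algebra_simps)
  also have "p * exp (V x) = 1 / step_weight V x" by (simp add: p exp_minus field_simps)
  also have "(1 - p) * exp (V (x - 1)) = 1 / step_weight V x" by (simp add: p' exp_minus field_simps)
  finally have "p * F1 + (1 - p) * F2 = F0 + (A + B) / step_weight V x" by (simp add: add_divide_distrib)
  then show ?thesis using w assms(4) by simp
qed

lemma poisson_left_drift:
  assumes p: "p = exp (- V x) / step_weight V x" and x: "lo < x" "x < b"
  shows "p * poisson_left V g lo j b (x + 1) + (1 - p) * poisson_left V g lo j b (x - 1) + g x = poisson_left V g lo j b x"
proof -
  have "p * poisson_left V g lo j b (x + 1) + (1 - p) * poisson_left V g lo j b (x - 1) = poisson_left V g lo j b x + (- g x)"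
    by (rule flux_balance[OF p, where A = "- flux_left V g lo j x" and B = "flux_left V g lo j (x - 1)"])
      (use x poisson_left_diff[of x b V g lo j] poisson_left_diff[of "x - 1" b V g lo j] flux_left_diff[OF x(1), of V g j]
       in \<open>simp_all add: algebra_simps\<close>)
  then show ?thesis by simp
qed

text \<open>The two one-sided solutions are glued at \<open>b\<close>, where both currents end.  There the equation
  fails by the total current divided by the weight of \<open>b\<close>, and this is the price \<open>\<theta>\<close> of one
  step.\<close>

lemma poisson_drift:
  fixes V g :: "int \<Rightarrow> real" and lo hi b :: int and jl jr :: real
  defines "F \<equiv> \<lambda>x. poisson_left V g lo jl b x + poisson_right V g hi jr b x"
  defines "\<theta> \<equiv> (jl + jr + (\<Sum>z\<in>{lo<..<hi}. step_weight V z * g z)) / step_weight V b"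
  assumes p: "p = exp (- V x) / step_weight V x" and x: "lo < x" "x < hi" and b: "lo < b" "b < hi"
    and nonneg: "\<And>x. 0 \<le> g x" "0 \<le> jl" "0 \<le> jr"
  shows "p * F (x + 1) + (1 - p) * F (x - 1) + g x \<le> F x + \<theta>"
proof -
  have \<theta>: "0 \<le> \<theta>"
    unfolding \<theta>_def using nonneg step_weight_pos[of V]
    by (intro divide_nonneg_nonneg add_nonneg_nonneg sum_nonneg mult_nonneg_nonneg) (auto simp: less_imp_le)
  have l0: "poisson_left V g lo jl b y = 0" if "b \<le> y" for y using that by (simp add: poisson_left_def)
  have r0: "poisson_right V g hi jr b y = 0" if "y \<le> b" for y using that by (simp add: poisson_right_def)
  consider "x < b" | "x > b" | "x = b" by linarith
  then show ?thesis
  proof cases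
    case 1
    then show ?thesis using poisson_left_drift[OF p x(1) 1, of g jl] \<theta> by (simp add: F_def r0)
  next
    case 2
    have "p * F (x + 1) + (1 - p) * F (x - 1) = F x + (- g x)"
      by (rule flux_balance[OF p, where A = "flux_right V g hi jr x" and B = "- flux_right V g hi jr (x - 1)"])
        (use 2 poisson_right_diff[of b x V g hi jr] poisson_right_diff[of b "x - 1" V g hi jr] flux_right_diff[OF x(2), of V g jr]
         in \<open>simp_all add: algebra_simps F_def l0\<close>)
    with \<theta> show ?thesis by simp
  next
    case 3
    have "flux_right V g hi jr x + flux_left V g lo jl (x - 1) = step_weight V x * (\<theta> - g x)"
    proof -
      have "{lo<..<hi} = insert b ({lo<..b - 1} \<union> {b<..<hi})" using b by auto
      then have "(\<Sum>z\<in>{lo<..<hi}. step_weight V z * g z) =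
          step_weight V b * g b + ((\<Sum>z\<in>{lo<..b - 1}. step_weight V z * g z) + (\<Sum>z\<in>{b<..<hi}. step_weight V z * g z))"
        by (subst \<open>{lo<..<hi} = _\<close>, subst sum.insert) (auto intro!: sum.union_disjoint)
      then show ?thesis
        using step_weight_pos[of V b] unfolding 3 \<theta>_def flux_left_def flux_right_def
        by (simp add: field_simps)
    qed
    then have "p * F (x + 1) + (1 - p) * F (x - 1) = F x + (\<theta> - g x)"
      by (intro flux_balance[OF p, where A = "flux_right V g hi jr x" and B = "flux_left V g lo jl (x - 1)"])
        (use 3 poisson_right_diff[of b x V g hi jr] poisson_left_diff[of "x - 1" b V g lo jl]
         in \<open>simp_all add: F_def l0 r0\<close>)
    then show ?thesis by simp
  qed
qed

text \<open>The boundary current \<open>j\<close> raises the solution outside the valley: with \<open>j = c * exp (- V lo)\<close>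
  it is at least \<open>c\<close> there, as \<open>quenched_stopped_bound\<close> demands.\<close>

lemma poisson_left_ge:
  assumes "\<And>x. 0 \<le> g x" "0 \<le> j" "x \<le> lo" "lo < b"
  shows "j * exp (V lo) \<le> poisson_left V g lo j b x"
proof -
  have "j * exp (V lo) = flux_left V g lo j lo * exp (V lo)" by (simp add: flux_left_def)
  also have "\<dots> \<le> poisson_left V g lo j b x"
    unfolding poisson_left_def using assms by (intro member_le_sum) (auto intro!: mult_nonneg_nonneg flux_nonneg)
  finally show ?thesis .
qed

lemma poisson_right_ge:
  assumes "\<And>x. 0 \<le> g x" "0 \<le> j" "hi \<le> x" "b < hi"
  shows "j * exp (V (hi - 1)) \<le> poisson_right V g hi j b x"
proof -
  have "{hi - 1<..<hi} = {}" by auto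
  then have "j * exp (V (hi - 1)) = flux_right V g hi j (hi - 1) * exp (V (hi - 1))" by (simp add: flux_right_def)
  also have "\<dots> \<le> poisson_right V g hi j b x"
    unfolding poisson_right_def using assms by (intro member_le_sum) (auto intro!: mult_nonneg_nonneg flux_nonneg)
  finally show ?thesis .
qed

section \<open>Independent fields\<close>

text \<open>Independence is formulated with sets of sites instead of the \<open>\<sigma>\<close>-algebras that they generate.\<close>

definition determined_by :: "int set \<Rightarrow> ((int \<Rightarrow> real) \<times> (int \<Rightarrow> real)) set \<Rightarrow> bool" where
  "determined_by K A \<longleftrightarrow> (\<forall>\<omega> \<omega>' \<xi> \<xi>'. (\<forall>i\<in>K. \<omega> i = \<omega>' i \<and> \<xi> i = \<xi>' i) \<longrightarrow>
     ((\<omega>, \<xi>) \<in> A \<longleftrightarrow> (\<omega>', \<xi>') \<in> A))"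

lemma determined_byI:
  assumes "\<And>\<omega> \<omega>' \<xi> \<xi>'. (\<And>i. i \<in> K \<Longrightarrow> \<omega> i = \<omega>' i \<and> \<xi> i = \<xi>' i) \<Longrightarrow> (\<omega>, \<xi>) \<in> A \<Longrightarrow> (\<omega>', \<xi>') \<in> A"
  shows "determined_by K A"
  unfolding determined_by_def
proof (intro allI impI iffI)
  fix \<omega> \<omega>' \<xi> \<xi>' :: "int \<Rightarrow> real"
  assume eq: "\<forall>i\<in>K. \<omega> i = \<omega>' i \<and> \<xi> i = \<xi>' i"
  show "(\<omega>', \<xi>') \<in> A" if "(\<omega>, \<xi>) \<in> A" by (rule assms[OF _ that]) (use eq in simp)
  show "(\<omega>, \<xi>) \<in> A" if "(\<omega>', \<xi>') \<in> A" by (rule assms[OF _ that]) (use eq in simp)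
qed

lemma determined_by_mono: "determined_by K A \<Longrightarrow> K \<subseteq> K' \<Longrightarrow> determined_by K' A"
  unfolding determined_by_def by blast

lemma determined_by_Int: "determined_by K A \<Longrightarrow> determined_by K B \<Longrightarrow> determined_by K (A \<inter> B)"
  unfolding determined_by_def Int_iff by blast

lemma determined_by_Compl: "determined_by K A \<Longrightarrow> determined_by K (- A)"
  unfolding determined_by_def Compl_iff by blast

locale iid_fields = E0: prob_space \<mu> + S0: prob_space \<rho> for \<mu> \<rho> :: "real measure" +
  assumes sets_env [measurable_cong]: "sets \<mu> = sets borel"
    and sets_scen [measurable_cong]: "sets \<rho> = sets borel"
begin

abbreviation "Env \<equiv> PiM (UNIV :: int set) (\<lambda>_. \<mu>)"
abbreviation "Scen \<equiv> PiM (UNIV :: int set) (\<lambda>_. \<rho>)"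
abbreviation "Fields \<equiv> Env \<Otimes>\<^sub>M Scen"

sublocale E: product_prob_space "\<lambda>_. \<mu>" "UNIV :: int set" ..
sublocale S: product_prob_space "\<lambda>_. \<rho>" "UNIV :: int set" ..
sublocale ES: pair_prob_space Env Scen ..

lemma space_env: "space \<mu> = UNIV" and space_scen: "space \<rho> = UNIV"
  using sets_eq_imp_space_eq[OF sets_env] sets_eq_imp_space_eq[OF sets_scen] by auto

lemma space_Env: "space Env = UNIV" and space_Scen: "space Scen = UNIV" and space_Fields: "space Fields = UNIV"
  by (auto simp: space_PiM space_env space_scen space_pair_measure)

lemma sets_Env: "sets Env = sets real_fields" and sets_Scen: "sets Scen = sets real_fields"
  by (auto intro!: sets_PiM_cong simp: sets_env sets_scen)

text \<open>Environment and scenery are read as one family, indexed by a site and a Boolean, so that the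
  independence of disjoint groups of coordinates applies to both at once.\<close>
definition field_coord :: "int \<times> bool \<Rightarrow> (int \<Rightarrow> real) \<times> (int \<Rightarrow> real) \<Rightarrow> real" where
  "field_coord k p = (if snd k then fst p (fst k) else snd p (fst k))"

lemma measurable_field_coord [measurable]: "field_coord k \<in> borel_measurable Fields"
  unfolding field_coord_def by (cases "snd k") simp_all

lemma indep_field_coord: "ES.indep_vars (\<lambda>_. borel) field_coord UNIV"
proof (subst ES.indep_vars_iff_distr_eq_PiM)
  show "distr Fields (\<Pi>\<^sub>M i\<in>UNIV. borel) (\<lambda>x. \<lambda>i\<in>UNIV. field_coord i x) =
    (\<Pi>\<^sub>M i\<in>UNIV. distr Fields borel (field_coord i))"
  proof -
    interpret P: product_prob_space "\<lambda>i. distr Fields borel (field_coord i)" UNIV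
      by (intro product_prob_spaceI ES.prob_space_distr) simp
    show ?thesis
    proof (rule P.PiM_eq)
      show "sets (distr Fields (\<Pi>\<^sub>M i\<in>UNIV. borel) (\<lambda>x. \<lambda>i\<in>UNIV. field_coord i x)) =
        sets (\<Pi>\<^sub>M i\<in>UNIV. distr Fields borel (field_coord i))"
        by (auto intro!: sets_PiM_cong)
      fix J :: "(int \<times> bool) set" and F
      assume J: "finite J" and F: "\<And>j. j \<in> J \<Longrightarrow> F j \<in> sets (distr Fields borel (field_coord j))"
      let ?J = "\<lambda>b. (\<lambda>i. (i, b)) -` J"
      have finJ: "finite (?J b)" for b using J by (intro finite_vimageI) (auto simp: inj_on_def)
      have [measurable]: "F (i, b) \<in> sets borel" if "i \<in> ?J b" for i b using F that by auto
      have single: "emeasure (distr Fields borel (field_coord (i, b))) (F (i, b)) =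
          emeasure (if b then \<mu> else \<rho>) (F (i, b))" if "i \<in> ?J b" for i b
      proof -
        have Fb[measurable]: "F (i, b) \<in> sets borel" using F that by auto
        have mE: "{\<omega>\<in>space Env. \<omega> i \<in> F (i, b)} \<in> sets Env" by measurable
        have mS: "{\<xi>\<in>space Scen. \<xi> i \<in> F (i, b)} \<in> sets Scen" by measurable
        have "emeasure (distr Fields borel (field_coord (i, b))) (F (i, b)) =
            emeasure Fields (if b then {\<omega>\<in>space Env. \<omega> i \<in> F (i, b)} \<times> space Scen
              else space Env \<times> {\<xi>\<in>space Scen. \<xi> i \<in> F (i, b)})"
          by (subst emeasure_distr) (auto simp: field_coord_def space_pair_measure intro!: arg_cong[where f = "emeasure _"])
        also have "\<dots> = emeasure (if b then \<mu> else \<rho>) (F (i, b))"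
          using E.emeasure_space_1 S.emeasure_space_1
            mE mS Fb
          by (cases b) (auto simp: S.emeasure_pair_measure_Times E.emeasure_PiM_Collect_single S.emeasure_PiM_Collect_single
               sets_env sets_scen space_env space_scen)
        finally show ?thesis .
      qed
      have "emeasure (distr Fields (\<Pi>\<^sub>M i\<in>UNIV. borel) (\<lambda>x. \<lambda>i\<in>UNIV. field_coord i x))
          (prod_emb UNIV (\<lambda>i. distr Fields borel (field_coord i)) J (\<Pi>\<^sub>E j\<in>J. F j)) =
        emeasure Fields ({\<omega>\<in>space Env. \<forall>i\<in>?J True. \<omega> i \<in> F (i, True)} \<times> {\<xi>\<in>space Scen. \<forall>i\<in>?J False. \<xi> i \<in> F (i, False)})"
      proof -
        have m: "(\<lambda>x. \<lambda>i\<in>UNIV. field_coord i x) \<in> Fields \<rightarrow>\<^sub>M (\<Pi>\<^sub>M i\<in>UNIV. borel)" by measurable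
        have e: "prod_emb UNIV (\<lambda>i. distr Fields borel (field_coord i)) J (\<Pi>\<^sub>E j\<in>J. F j) = {x. \<forall>j\<in>J. x j \<in> F j}"
          by (auto simp: prod_emb_def PiE_iff space_PiM)
        have "{x. \<forall>j\<in>J. x j \<in> F j} = prod_emb UNIV (\<lambda>_. borel) J (\<Pi>\<^sub>E j\<in>J. F j)"
          by (auto simp: prod_emb_def PiE_iff space_PiM)
        also have "\<dots> \<in> sets (\<Pi>\<^sub>M i\<in>UNIV. borel)" using J F by (intro sets_PiM_I) auto
        finally show ?thesis
          unfolding e by (subst emeasure_distr[OF m])
            (auto simp: field_coord_def space_pair_measure intro!: arg_cong[where f = "emeasure _"] split: if_splits)
      qed
      also have "\<dots> = (\<Prod>i\<in>?J True. emeasure \<mu> (F (i, True))) * (\<Prod>i\<in>?J False. emeasure \<rho> (F (i, False)))"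
        using finJ F by (subst S.emeasure_pair_measure_Times)
          (auto simp: E.emeasure_PiM_Collect S.emeasure_PiM_Collect sets_env sets_scen)
      also have "\<dots> = (\<Prod>b\<in>UNIV. \<Prod>i\<in>?J b. emeasure (distr Fields borel (field_coord (i, b))) (F (i, b)))"
        by (simp add: UNIV_bool single mult.commute)
      also have "\<dots> = (\<Prod>(b, i)\<in>(SIGMA b:UNIV. ?J b). emeasure (distr Fields borel (field_coord (i, b))) (F (i, b)))"
        using finJ by (intro prod.Sigma) auto
      also have "\<dots> = (\<Prod>j\<in>J. emeasure (distr Fields borel (field_coord j)) (F j))"
        by (rule prod.reindex_bij_witness[of _ "\<lambda>(i, b). (b, i)" "\<lambda>(b, i). (i, b)"]) auto
      finally show "emeasure (distr Fields (\<Pi>\<^sub>M i\<in>UNIV. borel) (\<lambda>x. \<lambda>i\<in>UNIV. field_coord i x))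
          (prod_emb UNIV (\<lambda>i. distr Fields borel (field_coord i)) J (\<Pi>\<^sub>E j\<in>J. F j)) =
        (\<Prod>j\<in>J. emeasure (distr Fields borel (field_coord j)) (F j))" .
    qed
  qed
qed auto

text \<open>An event determined by \<open>K\<close> is the preimage of itself under the map that keeps the coordinates
  in \<open>K\<close> and replaces all others by \<open>0\<close>; so it is an event about this group of coordinates.\<close>
proposition prob_INT_determined:
  fixes K :: "'j \<Rightarrow> int set"
  assumes J: "finite J" "J \<noteq> {}" and K: "disjoint_family_on K J"
    and A: "\<And>j. j \<in> J \<Longrightarrow> A j \<in> sets Fields" "\<And>j. j \<in> J \<Longrightarrow> determined_by (K j) (A j)"
  shows "measure Fields (\<Inter>j\<in>J. A j) = (\<Prod>j\<in>J. measure Fields (A j))"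
proof -
  let ?K = "\<lambda>j. K j \<times> (UNIV :: bool set)"
  let ?Y = "\<lambda>j p. restrict (\<lambda>i. field_coord i p) (?K j)"
  define glue where "glue j z = ((\<lambda>i. if i \<in> K j then z (i, True) else 0 :: real), (\<lambda>i. if i \<in> K j then z (i, False) else 0 :: real))"
    for j :: 'j and z :: "int \<times> bool \<Rightarrow> real"
  have glue: "glue j \<in> PiM (?K j) (\<lambda>_. borel) \<rightarrow>\<^sub>M Fields" for j
  proof -
    have "(\<lambda>z i. if i \<in> K j then z (i, b) else 0) \<in> PiM (?K j) (\<lambda>_. borel) \<rightarrow>\<^sub>M real_fields" for b
    proof (rule measurable_PiM_single')
      show "(\<lambda>z. if i \<in> K j then z (i, b) else 0) \<in> borel_measurable (PiM (?K j) (\<lambda>_. borel))" for i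
        by (cases "i \<in> K j") (auto intro!: measurable_component_singleton)
    qed simp
    then show ?thesis
      unfolding glue_def by (intro measurable_Pair) (simp_all add: measurable_cong_sets[OF refl sets_Env] measurable_cong_sets[OF refl sets_Scen])
  qed
  have "ES.indep_vars (\<lambda>j. PiM (?K j) (\<lambda>_. borel)) ?Y J"
    using K by (intro ES.indep_vars_restrict[OF indep_field_coord]) (auto simp: disjoint_family_on_def)
  moreover have "glue j -` A j \<inter> space (PiM (?K j) (\<lambda>_. borel)) \<in> sets (PiM (?K j) (\<lambda>_. borel))" if "j \<in> J" for j
    using A(1)[OF that] by (rule measurable_sets[OF glue])
  ultimately have prod: "measure Fields (\<Inter>j\<in>J. ?Y j -` (glue j -` A j \<inter> space (PiM (?K j) (\<lambda>_. borel))) \<inter> space Fields) =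
      (\<Prod>j\<in>J. measure Fields (?Y j -` (glue j -` A j \<inter> space (PiM (?K j) (\<lambda>_. borel))) \<inter> space Fields))"
    using J by (intro ES.indep_varsD) auto
  have eq: "?Y j -` (glue j -` A j \<inter> space (PiM (?K j) (\<lambda>_. borel))) \<inter> space Fields = A j" if "j \<in> J" for j
  proof -
    have "glue j (?Y j (\<omega>, \<xi>)) \<in> A j \<longleftrightarrow> (\<omega>, \<xi>) \<in> A j" for \<omega> \<xi>
      using A(2)[OF that] unfolding glue_def determined_by_def
      by (elim allE impE) (auto simp: field_coord_def)
    then have "glue j (?Y j p) \<in> A j \<longleftrightarrow> p \<in> A j" for p by (cases p) simp
    moreover have "?Y j -` (glue j -` A j \<inter> space (PiM (?K j) (\<lambda>_. borel))) \<inter> space Fields = {p. glue j (?Y j p) \<in> A j}"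
      by (simp add: set_eq_iff space_Fields space_PiM PiE_def Pi_def del: restrict_apply)
    ultimately show ?thesis by blast
  qed
  have "(\<Inter>j\<in>J. A j) = (\<Inter>j\<in>J. ?Y j -` (glue j -` A j \<inter> space (PiM (?K j) (\<lambda>_. borel))) \<inter> space Fields)"
    by (intro INF_cong refl eq[symmetric])
  moreover have "(\<Prod>j\<in>J. measure Fields (A j)) =
      (\<Prod>j\<in>J. measure Fields (?Y j -` (glue j -` A j \<inter> space (PiM (?K j) (\<lambda>_. borel))) \<inter> space Fields))"
    by (intro prod.cong refl arg_cong[where f = "measure Fields"] eq[symmetric])
  ultimately show ?thesis using prod by simp
qed

lemma prob_Int_determined:
  assumes "A \<in> sets Fields" "B \<in> sets Fields" "determined_by K A" "determined_by L B" "K \<inter> L = {}"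
  shows "measure Fields (A \<inter> B) = measure Fields A * measure Fields B"
  using prob_INT_determined[of UNIV "\<lambda>b. if b then K else L" "\<lambda>b. if b then A else B"] assms
  by (auto simp: UNIV_bool disjoint_family_on_def Int_commute mult.commute)

lemma distr_Env_reindex:
  assumes t: "inj t"
  shows "distr Env Env (\<lambda>\<omega> i. \<omega> (t i)) = Env" "distr Scen Scen (\<lambda>\<omega> i. \<omega> (t i)) = Scen"
  using distr_PiM_reindex[of UNIV "\<lambda>_. \<mu>" t UNIV] distr_PiM_reindex[of UNIV "\<lambda>_. \<rho>" t UNIV] t
  by (simp_all add: E0.prob_space_axioms S0.prob_space_axioms restrict_UNIV)

lemma measurable_reindex [measurable]:
  "(\<lambda>\<omega> i. \<omega> (t i)) \<in> Env \<rightarrow>\<^sub>M Env" "(\<lambda>\<omega> i. \<omega> (t i)) \<in> Scen \<rightarrow>\<^sub>M Scen"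
  by (rule measurable_PiM_single'; auto simp: space_PiM space_env space_scen)+

lemma distr_Fields_reindex:
  assumes t: "inj t"
  shows "distr Fields Fields (\<lambda>(\<omega>, \<xi>). (\<lambda>i. \<omega> (t i), \<lambda>i. \<xi> (t i))) = Fields"
proof -
  have "distr Env Env (\<lambda>\<omega> i. \<omega> (t i)) \<Otimes>\<^sub>M distr Scen Scen (\<lambda>\<omega> i. \<omega> (t i)) =
      distr Fields Fields (\<lambda>(\<omega>, \<xi>). (\<lambda>i. \<omega> (t i), \<lambda>i. \<xi> (t i)))"
    using t by (intro pair_measure_distr) (auto simp: distr_Env_reindex intro!: S.sigma_finite_measure_axioms)
  then show ?thesis using t by (simp add: distr_Env_reindex)
qed

lemma prob_Fields_reindex:
  assumes t: "inj t" and A: "A \<in> sets Fields"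
  shows "(\<lambda>(\<omega>, \<xi>). (\<lambda>i. \<omega> (t i), \<lambda>i. \<xi> (t i))) -` A \<in> sets Fields"
    "measure Fields ((\<lambda>(\<omega>, \<xi>). (\<lambda>i. \<omega> (t i), \<lambda>i. \<xi> (t i))) -` A) = measure Fields A"
proof -
  let ?f = "\<lambda>(\<omega>, \<xi>). (\<lambda>i. \<omega> (t i) :: real, \<lambda>i. \<xi> (t i) :: real)"
  have f: "?f \<in> Fields \<rightarrow>\<^sub>M Fields" by measurable
  show "?f -` A \<in> sets Fields" using measurable_sets[OF f A] by (simp add: space_Fields)
  have "measure (distr Fields Fields ?f) A = measure Fields (?f -` A)"
    using A by (subst measure_distr[OF f]) (auto simp: space_Fields)
  then show "measure Fields (?f -` A) = measure Fields A" using distr_Fields_reindex[OF t] by simp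
qed

text \<open>For an injective \<open>t\<close> the potential is read along the sites \<open>t 0, t 1, \<dots>\<close>, to the right or to
  the left of a given site; in either direction its increments are
  independent and identically distributed.\<close>
lemma distr_Env_steps:
  fixes t :: "nat \<Rightarrow> int"
  assumes t: "inj t" and f[measurable]: "f \<in> borel_measurable borel"
  shows "distr Env (PiM UNIV (\<lambda>_. borel)) (\<lambda>\<omega> k. f (\<omega> (t k))) = PiM UNIV (\<lambda>_. distr \<mu> borel f)"
proof -
  interpret P: product_prob_space "\<lambda>_. distr \<mu> borel f" "UNIV :: nat set"
    by (intro product_prob_spaceI E0.prob_space_distr) simp
  show ?thesis
  proof (rule P.PiM_eq)
    fix J :: "nat set" and F
    assume J: "finite J" and F: "\<And>j. j \<in> J \<Longrightarrow> F j \<in> sets (distr \<mu> borel f)"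
    let ?emb = "prod_emb UNIV (\<lambda>_. distr \<mu> borel f) J (\<Pi>\<^sub>E j\<in>J. F j)"
    have inv: "inv t (t k) = k" for k using t by simp
    have e: "?emb \<in> sets (PiM UNIV (\<lambda>_. borel))"
    proof -
      have "?emb = prod_emb UNIV (\<lambda>_. borel) J (\<Pi>\<^sub>E j\<in>J. F j)" by (auto simp: prod_emb_def)
      also have "\<dots> \<in> sets (\<Pi>\<^sub>M i\<in>UNIV. borel)" using J F by (intro sets_PiM_I) auto
      finally show ?thesis .
    qed
    have m: "(\<lambda>\<omega> k. f (\<omega> (t k))) \<in> Env \<rightarrow>\<^sub>M PiM UNIV (\<lambda>_. borel)"
      by (rule measurable_PiM_single') simp_all
    have "emeasure (distr Env (PiM UNIV (\<lambda>_. borel)) (\<lambda>\<omega> k. f (\<omega> (t k)))) ?emb =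
        emeasure Env {\<omega> \<in> space Env. \<forall>i\<in>t ` J. \<omega> i \<in> f -` F (inv t i)}"
      by (subst emeasure_distr[OF m e])
        (auto simp: inv prod_emb_def PiE_iff space_PiM intro!: arg_cong[where f = "emeasure _"])
    also have "\<dots> = (\<Prod>i\<in>t ` J. emeasure \<mu> (f -` F (inv t i)))"
    proof (rule E.emeasure_PiM_Collect)
      show "f -` F (inv t i) \<in> sets \<mu>" if "i \<in> t ` J" for i
        using measurable_sets[OF f, of "F (inv t i)"] F that by (auto simp: inv sets_env)
    qed (use J in auto)
    also have "\<dots> = (\<Prod>j\<in>J. emeasure \<mu> (f -` F j))"
      using t by (subst prod.reindex) (auto simp: inv inj_on_def)
    also have "\<dots> = (\<Prod>j\<in>J. emeasure (distr \<mu> borel f) (F j))"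
      using F by (intro prod.cong refl) (auto simp: emeasure_distr space_env)
    finally show "emeasure (distr Env (PiM UNIV (\<lambda>_. borel)) (\<lambda>\<omega> k. f (\<omega> (t k)))) ?emb =
      (\<Prod>j\<in>J. emeasure (distr \<mu> borel f) (F j))" .
  qed (auto intro!: sets_PiM_cong)
qed

lemma prob_single_site:
  assumes W: "W \<in> sets borel" and G: "G \<in> sets borel"
  shows "{z. fst z i \<in> W \<and> snd z i \<in> G} \<in> sets Fields"
    "measure Fields {z. fst z i \<in> W \<and> snd z i \<in> G} = measure \<mu> W * measure \<rho> G"
proof -
  have e: "{z. fst z i \<in> W \<and> snd z i \<in> G} = {\<omega> \<in> space Env. \<omega> i \<in> W} \<times> {\<xi> \<in> space Scen. \<xi> i \<in> G}"
    by (auto simp: space_Env space_Scen)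
  have m: "{\<omega> \<in> space Env. \<omega> i \<in> W} \<in> sets Env" "{\<xi> \<in> space Scen. \<xi> i \<in> G} \<in> sets Scen"
    using W G by measurable
  show "{z. fst z i \<in> W \<and> snd z i \<in> G} \<in> sets Fields" unfolding e using m by auto
  have "emeasure Fields {z. fst z i \<in> W \<and> snd z i \<in> G} = emeasure \<mu> W * emeasure \<rho> G"
    unfolding e using m W G
    by (simp add: S.emeasure_pair_measure_Times E.emeasure_PiM_Collect_single S.emeasure_PiM_Collect_single sets_env sets_scen)
  then show "measure Fields {z. fst z i \<in> W \<and> snd z i \<in> G} = measure \<mu> W * measure \<rho> G"
    by (simp add: measure_def enn2real_mult)
qed

end

section \<open>Bounded centred random walks\<close>

locale bounded_centred_step = T: prob_space \<tau> for \<tau> :: "real measure" +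
  fixes c \<sigma> :: real
  assumes sets_step [measurable_cong]: "sets \<tau> = sets borel"
    and bounded: "AE y in \<tau>. \<bar>y\<bar> \<le> c"
    and mean: "(\<integral>y. y \<partial>\<tau>) = 0"
    and variance: "(\<integral>y. y\<^sup>2 \<partial>\<tau>) = \<sigma>\<^sup>2"
    and \<sigma>_pos: "0 < \<sigma>"
begin

abbreviation "Steps \<equiv> PiM (UNIV :: nat set) (\<lambda>_. \<tau>)"

sublocale sequence_space \<tau> ..

lemma space_step: "space \<tau> = UNIV"
  using sets_eq_imp_space_eq[OF sets_step] by simp

lemma space_Steps: "space Steps = UNIV"
  by (auto simp: space_PiM space_step)

lemma c_nonneg: "0 \<le> c"
proof -
  have "AE y in \<tau>. 0 \<le> c" using bounded by eventually_elim linarith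
  then show ?thesis by simp
qed

lemma integrable_step [simp]: "integrable \<tau> (\<lambda>y. y)" "integrable \<tau> (\<lambda>y. y\<^sup>2)"
proof -
  show "integrable \<tau> (\<lambda>y. y)" using bounded by (intro T.integrable_const_bound[where B = c]) auto
  show "integrable \<tau> (\<lambda>y. y\<^sup>2)"
  proof (rule T.integrable_const_bound[where B = "c\<^sup>2"])
    show "AE y in \<tau>. norm (y\<^sup>2) \<le> c\<^sup>2"
      using bounded by eventually_elim (use c_nonneg abs_le_square_iff in fastforce)
  qed simp
qed

lemma integral_quadratic:
  "integrable \<tau> (\<lambda>y. p + q * (s + y) + r * (s + y)\<^sup>2)"
  "(\<integral>y. p + q * (s + y) + r * (s + y)\<^sup>2 \<partial>\<tau>) = p + q * s + r * (s\<^sup>2 + \<sigma>\<^sup>2)"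
proof -
  have e: "p + q * (s + y) + r * (s + y)\<^sup>2 = (p + q * s + r * s\<^sup>2) + (q + 2 * r * s) * y + r * y\<^sup>2" for y
    by (simp add: power2_eq_square algebra_simps)
  show "integrable \<tau> (\<lambda>y. p + q * (s + y) + r * (s + y)\<^sup>2)" unfolding e by simp
  show "(\<integral>y. p + q * (s + y) + r * (s + y)\<^sup>2 \<partial>\<tau>) = p + q * s + r * (s\<^sup>2 + \<sigma>\<^sup>2)"
    unfolding e by (simp add: mean variance T.prob_space algebra_simps)
qed

text \<open>The estimates for the walk come from the recursion in \<open>m\<close> that \<open>stay\<close> satisfies (lemma
  \<open>stay_Suc\<close> below): its subsolutions and supersolutions are quadratic functions of the starting
  point, whose means after one step are explicit.\<close>
definition stay :: "real set \<Rightarrow> nat \<Rightarrow> real \<Rightarrow> real" where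
  "stay G m s = measure Steps {y. \<forall>k\<le>m. s + (\<Sum>i<k. y i) \<in> G}"

lemma measurable_stay [measurable]:
  assumes [measurable]: "G \<in> sets borel"
  shows "{(s, y). \<forall>k\<le>m. s + (\<Sum>i<k. y i) \<in> G} \<in> sets (borel \<Otimes>\<^sub>M Steps)"
proof -
  have "{p \<in> space (borel \<Otimes>\<^sub>M Steps). \<forall>k\<le>m. fst p + (\<Sum>i<k. snd p i) \<in> G} \<in> sets (borel \<Otimes>\<^sub>M Steps)"
    by measurable
  also have "{p \<in> space (borel \<Otimes>\<^sub>M Steps). \<forall>k\<le>m. fst p + (\<Sum>i<k. snd p i) \<in> G} =
      {(s, y). \<forall>k\<le>m. s + (\<Sum>i<k. y i) \<in> G}"
    by (auto simp: space_pair_measure space_Steps)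
  finally show ?thesis .
qed

lemma measurable_stay1 [measurable]:
  assumes [measurable]: "G \<in> sets borel"
  shows "{y. \<forall>k\<le>m. s + (\<Sum>i<k. y i) \<in> G} \<in> sets Steps"
proof -
  have "{y \<in> space Steps. \<forall>k\<le>m. s + (\<Sum>i<k. y i) \<in> G} \<in> sets Steps" by measurable
  then show ?thesis by (simp add: space_Steps)
qed

lemma borel_measurable_stay [measurable]:
  assumes G: "G \<in> sets borel"
  shows "stay G m \<in> borel_measurable borel"
proof -
  have "(\<lambda>s. emeasure Steps (Pair s -` {(s, y). \<forall>k\<le>m. s + (\<Sum>i<k. y i) \<in> G})) \<in> borel_measurable borel"
    by (rule P.measurable_emeasure_Pair[OF measurable_stay[OF G]])
  then show ?thesis unfolding stay_def measure_def by simp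
qed

lemma stay_bounds: "0 \<le> stay G m s" "stay G m s \<le> 1"
  by (auto simp: stay_def)

lemma stay_outside: "s \<notin> G \<Longrightarrow> stay G m s = 0"
proof -
  assume "s \<notin> G"
  then have "{y :: nat \<Rightarrow> real. \<forall>k\<le>m. s + (\<Sum>i<k. y i) \<in> G} = {}" by force
  then show ?thesis by (simp only: stay_def measure_empty)
qed

lemma stay_0: "stay G 0 s = indicator G s"
  using P.prob_space by (simp add: stay_def space_Steps split: split_indicator)

lemma integrable_stay [simp]: "G \<in> sets borel \<Longrightarrow> integrable \<tau> (\<lambda>y. stay G m (s + y))"
  by (intro T.integrable_const_bound[where B = 1]) (auto simp: stay_bounds)

text \<open>Conditioning on the first step.\<close>

lemma stay_Suc:
  assumes G: "G \<in> sets borel"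
  shows "stay G (Suc m) s = indicator G s * (\<integral>y. stay G m (s + y) \<partial>\<tau>)"
proof (cases "s \<in> G")
  case True
  let ?A = "\<lambda>m s. {y :: nat \<Rightarrow> real. \<forall>k\<le>m. s + (\<Sum>i<k. y i) \<in> G}"
  have "emeasure Steps (?A (Suc m) s) = emeasure (distr (\<tau> \<Otimes>\<^sub>M Steps) Steps (\<lambda>(s, \<omega>). case_nat s \<omega>)) (?A (Suc m) s)"
    by (simp add: PiM_iter)
  also have "\<dots> = emeasure (\<tau> \<Otimes>\<^sub>M Steps) ((\<lambda>(s, \<omega>). case_nat s \<omega>) -` ?A (Suc m) s \<inter> space (\<tau> \<Otimes>\<^sub>M Steps))"
    using G by (intro emeasure_distr) auto
  also have "\<dots> = (\<integral>\<^sup>+ y. emeasure Steps (Pair y -` ((\<lambda>(s, \<omega>). case_nat s \<omega>) -` ?A (Suc m) s \<inter> space (\<tau> \<Otimes>\<^sub>M Steps))) \<partial>\<tau>)"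
    using G by (intro P.emeasure_pair_measure_alt measurable_sets[where A = Steps]) auto
  also have "\<dots> = (\<integral>\<^sup>+ y. ennreal (stay G m (s + y)) \<partial>\<tau>)"
  proof (rule nn_integral_cong)
    fix y
    have "Pair y -` ((\<lambda>(s, \<omega>). case_nat s \<omega>) -` ?A (Suc m) s \<inter> space (\<tau> \<Otimes>\<^sub>M Steps)) = ?A m (s + y)"
    proof -
      have "(\<forall>k\<le>Suc m. s + (\<Sum>i<k. case_nat y \<omega> i) \<in> G) \<longleftrightarrow> (\<forall>k\<le>m. s + y + (\<Sum>i<k. \<omega> i) \<in> G)" for \<omega>
      proof -
        have "(\<forall>k\<le>Suc m. s + (\<Sum>i<k. case_nat y \<omega> i) \<in> G) \<longleftrightarrow> (\<forall>k\<le>m. s + (\<Sum>i<Suc k. case_nat y \<omega> i) \<in> G)"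
          using True by (metis Suc_le_mono add.right_neutral le_0_eq lessThan_0 not0_implies_Suc sum.empty zero_le)
        then show ?thesis by (simp add: sum.lessThan_Suc_shift add.assoc del: sum.lessThan_Suc)
      qed
      then show ?thesis by (auto simp: space_pair_measure space_Steps space_step)
    qed
    then show "emeasure Steps (Pair y -` ((\<lambda>(s, \<omega>). case_nat s \<omega>) -` ?A (Suc m) s \<inter> space (\<tau> \<Otimes>\<^sub>M Steps)))
        = ennreal (stay G m (s + y))"
      by (simp add: stay_def P.emeasure_eq_measure)
  qed
  also have "\<dots> = ennreal (\<integral>y. stay G m (s + y) \<partial>\<tau>)"
    using G by (intro nn_integral_eq_integral) (auto simp: stay_bounds)
  finally have "measure Steps (?A (Suc m) s) = (\<integral>y. stay G m (s + y) \<partial>\<tau>)"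
    by (simp add: P.emeasure_eq_measure stay_bounds)
  with True show ?thesis by (simp add: stay_def)
qed (simp add: stay_outside)

text \<open>Kolmogorov's maximal inequality: \<open>1 - (s\<^sup>2 + m \<sigma>\<^sup>2) / t\<^sup>2\<close> is a subsolution of the recursion.\<close>

lemma stay_strip_ge:
  assumes t: "0 < t"
  shows "1 - (s\<^sup>2 + m * \<sigma>\<^sup>2) / t\<^sup>2 \<le> stay {-t<..<t} m s"
proof (induction m arbitrary: s)
  case 0
  show ?case
  proof (cases "s \<in> {-t<..<t}")
    case False
    then have "t\<^sup>2 \<le> s\<^sup>2" using t by (auto simp: abs_le_square_iff[symmetric])
    with False t show ?thesis by (simp add: stay_0)
  qed (simp add: stay_0)
next
  case (Suc m)
  show ?case
  proof (cases "s \<in> {-t<..<t}")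
    case False
    then have "t\<^sup>2 \<le> s\<^sup>2" using t by (auto simp: abs_le_square_iff[symmetric])
    then have "t\<^sup>2 \<le> s\<^sup>2 + Suc m * \<sigma>\<^sup>2" by (simp add: add_increasing2)
    then have "1 - (s\<^sup>2 + Suc m * \<sigma>\<^sup>2) / t\<^sup>2 \<le> 0" using t by (simp add: field_simps)
    then show ?thesis using stay_bounds(1) order_trans by blast
  next
    case True
    have e: "1 - ((s + y)\<^sup>2 + m * \<sigma>\<^sup>2) / t\<^sup>2 = (1 - m * \<sigma>\<^sup>2 / t\<^sup>2) + 0 * (s + y) + (- 1 / t\<^sup>2) * (s + y)\<^sup>2" for y
      using t by (simp add: field_simps)
    have "1 - (s\<^sup>2 + Suc m * \<sigma>\<^sup>2) / t\<^sup>2 = (\<integral>y. 1 - ((s + y)\<^sup>2 + m * \<sigma>\<^sup>2) / t\<^sup>2 \<partial>\<tau>)"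
      unfolding e integral_quadratic using t by (simp add: field_simps)
    also have "\<dots> \<le> (\<integral>y. stay {-t<..<t} m (s + y) \<partial>\<tau>)"
    proof (rule integral_mono)
      show "integrable \<tau> (\<lambda>y. 1 - ((s + y)\<^sup>2 + m * \<sigma>\<^sup>2) / t\<^sup>2)" unfolding e by (rule integral_quadratic)
    qed (use Suc.IH in simp_all)
    also have "\<dots> = stay {-t<..<t} (Suc m) s" using True by (simp add: stay_Suc)
    finally show ?thesis .
  qed
qed

text \<open>Up to time \<open>N\<close> the expected time before a walk from \<open>s\<close> turns negative is at most
  \<open>B u - u\<^sup>2 / \<sigma>\<^sup>2\<close> with \<open>u = s + c\<close>: this function decreases by \<open>1\<close> on average at each step, is
  nonnegative below \<open>0\<close>, and is at least \<open>N\<close> at the right end of the interval where it is used.\<close>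

definition persist_const :: "nat \<Rightarrow> real" where
  "persist_const N = 2 * sqrt (N + c\<^sup>2 / \<sigma>\<^sup>2) / \<sigma>"

lemma persist_const: "0 \<le> persist_const N" "(persist_const N)\<^sup>2 * \<sigma>\<^sup>2 / 4 = N + c\<^sup>2 / \<sigma>\<^sup>2"
  using \<sigma>_pos by (auto simp: persist_const_def power_mult_distrib power_divide field_simps)

lemma sum_stay_le:
  fixes N m :: nat
  defines "B \<equiv> persist_const N"
  assumes m: "m \<le> N" and s: "- c \<le> s" "s + c \<le> B * \<sigma>\<^sup>2 / 2"
  shows "(\<Sum>k<m. stay {0..} k s) \<le> B * (s + c) - (s + c)\<^sup>2 / \<sigma>\<^sup>2"
  using m s
proof (induction m arbitrary: s)
  have pos: "0 \<le> B * (s + c) - (s + c)\<^sup>2 / \<sigma>\<^sup>2" if "- c \<le> s" "s + c \<le> B * \<sigma>\<^sup>2 / 2" for s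
  proof -
    have "(s + c) * (s + c) \<le> (B * \<sigma>\<^sup>2) * (s + c)"
      using that persist_const(1)[of N] by (intro mult_right_mono) (auto simp: B_def)
    then show ?thesis using \<sigma>_pos by (simp add: field_simps power2_eq_square)
  qed
  {
    case 0
    then show ?case using pos by simp
  next
    case (Suc m)
    consider "s < 0" | "0 \<le> s" "s + 2 * c > B * \<sigma>\<^sup>2 / 2" | "0 \<le> s" "s + 2 * c \<le> B * \<sigma>\<^sup>2 / 2" by linarith
    then show ?case
    proof cases
      case 1
      then show ?thesis using pos[OF Suc.prems(2,3)] by (simp add: stay_outside)
    next
      case 2
      define d where "d = B * \<sigma>\<^sup>2 / 2 - (s + c)"
      have d: "0 \<le> d" "d \<le> c" using 2 Suc.prems by (auto simp: d_def)
      have "B * (s + c) - (s + c)\<^sup>2 / \<sigma>\<^sup>2 = B\<^sup>2 * \<sigma>\<^sup>2 / 4 - d\<^sup>2 / \<sigma>\<^sup>2"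
        unfolding d_def using \<sigma>_pos by (simp add: field_simps power2_eq_square)
      moreover have "d\<^sup>2 / \<sigma>\<^sup>2 \<le> c\<^sup>2 / \<sigma>\<^sup>2" using d by (intro divide_right_mono power_mono) auto
      ultimately have "real N \<le> B * (s + c) - (s + c)\<^sup>2 / \<sigma>\<^sup>2"
        using persist_const(2)[of N] by (simp add: B_def)
      moreover have "(\<Sum>k<Suc m. stay {0..} k s) \<le> real (card {..<Suc m}) * 1"
        by (rule sum_bounded_above) (simp add: stay_bounds)
      ultimately show ?thesis using Suc.prems(1) by simp
    next
      case 3
      have e: "B * (s + y + c) - (s + y + c)\<^sup>2 / \<sigma>\<^sup>2 = 0 + B * ((s + c) + y) + (- 1 / \<sigma>\<^sup>2) * ((s + c) + y)\<^sup>2" for y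
        by (simp add: algebra_simps)
      have "(\<Sum>k<Suc m. stay {0..} k s) = 1 + (\<Sum>k<m. \<integral>y. stay {0..} k (s + y) \<partial>\<tau>)"
        using 3 by (subst sum.lessThan_Suc_shift) (simp add: stay_0 stay_Suc)
      also have "(\<Sum>k<m. \<integral>y. stay {0..} k (s + y) \<partial>\<tau>) = (\<integral>y. (\<Sum>k<m. stay {0..} k (s + y)) \<partial>\<tau>)"
        by (intro Bochner_Integration.integral_sum[symmetric]) simp
      also have "\<dots> \<le> (\<integral>y. B * (s + y + c) - (s + y + c)\<^sup>2 / \<sigma>\<^sup>2 \<partial>\<tau>)"
      proof (rule integral_mono_AE)
        show "integrable \<tau> (\<lambda>y. B * (s + y + c) - (s + y + c)\<^sup>2 / \<sigma>\<^sup>2)" unfolding e by (rule integral_quadratic)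
        show "AE y in \<tau>. (\<Sum>k<m. stay {0..} k (s + y)) \<le> B * (s + y + c) - (s + y + c)\<^sup>2 / \<sigma>\<^sup>2"
          using bounded
        proof eventually_elim
          case (elim y)
          then show ?case using Suc.prems 3 by (intro Suc.IH) auto
        qed
      qed simp
      also have "\<dots> = B * (s + c) - (s + c)\<^sup>2 / \<sigma>\<^sup>2 - 1"
        unfolding e integral_quadratic using \<sigma>_pos by (simp add: field_simps)
      finally show ?thesis by simp
    qed
  }
qed

lemma stay_antimono:
  assumes "G \<in> sets borel" "m \<le> n"
  shows "stay G n s \<le> stay G m s"
  unfolding stay_def using assms by (intro P.finite_measure_mono) auto

text \<open>The probability of not having turned negative decreases in time, so its value at \<open>n\<close> is at
  most the average of the values up to \<open>n\<close>.\<close>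
proposition stay_nonneg_le:
  assumes s: "0 \<le> s"
  shows "stay {0..} n s \<le> persist_const (Suc n) * (s + c) / Suc n"
proof (cases "s + c \<le> persist_const (Suc n) * \<sigma>\<^sup>2 / 2")
  case True
  have "Suc n * stay {0..} n s = (\<Sum>k<Suc n. stay {0..} n s)" by simp
  also have "\<dots> \<le> (\<Sum>k<Suc n. stay {0..} k s)" by (intro sum_mono stay_antimono) auto
  also have "\<dots> \<le> persist_const (Suc n) * (s + c) - (s + c)\<^sup>2 / \<sigma>\<^sup>2"
    using s True c_nonneg by (intro sum_stay_le) auto
  also have "\<dots> \<le> persist_const (Suc n) * (s + c)" by simp
  finally show ?thesis by (simp add: field_simps)
next
  case False
  have "Suc n \<le> (persist_const (Suc n))\<^sup>2 * \<sigma>\<^sup>2 / 2"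
    using persist_const(2)[of "Suc n"] by (simp add: field_simps)
  also have "\<dots> = persist_const (Suc n) * (persist_const (Suc n) * \<sigma>\<^sup>2 / 2)" by (simp add: power2_eq_square)
  also have "\<dots> \<le> persist_const (Suc n) * (s + c)"
    using False persist_const(1) by (intro mult_left_mono) auto
  finally have "1 \<le> persist_const (Suc n) * (s + c) / Suc n" by simp
  then show ?thesis using stay_bounds(2) order_trans by blast
qed

definition persist_rate :: real where
  "persist_rate = 2 * (1 + c / \<sigma>) * (1 + c) / \<sigma>"

corollary stay_nonneg_le_sqrt:
  assumes s: "0 \<le> s"
  shows "stay {0..} n s \<le> persist_rate * (s + 1) / sqrt (Suc n)"
proof -
  have "sqrt (Suc n + c\<^sup>2 / \<sigma>\<^sup>2) \<le> sqrt (Suc n) + sqrt (c\<^sup>2 / \<sigma>\<^sup>2)"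
    by (intro sqrt_add_le_add_sqrt) auto
  also have "sqrt (c\<^sup>2 / \<sigma>\<^sup>2) = c / \<sigma>" using c_nonneg \<sigma>_pos by (simp add: real_sqrt_divide)
  also have "sqrt (Suc n) + c / \<sigma> \<le> sqrt (Suc n) + c / \<sigma> * sqrt (Suc n)"
    using c_nonneg \<sigma>_pos mult_left_mono[of 1 "sqrt (Suc n)" "c / \<sigma>"] by simp
  finally have *: "persist_const (Suc n) \<le> 2 * (1 + c / \<sigma>) / \<sigma> * sqrt (Suc n)"
    unfolding persist_const_def using \<sigma>_pos by (simp add: field_simps)
  have "s + c \<le> (1 + c) * (s + 1)" using s c_nonneg by (simp add: algebra_simps)
  then have "persist_const (Suc n) * (s + c) \<le> (2 * (1 + c / \<sigma>) / \<sigma> * sqrt (Suc n)) * ((1 + c) * (s + 1))"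
    using * s c_nonneg persist_const(1)[of "Suc n"] by (intro mult_mono) auto
  also have "\<dots> = persist_rate * (s + 1) * sqrt (Suc n)" by (simp add: persist_rate_def)
  finally have "persist_const (Suc n) * (s + c) / Suc n \<le> persist_rate * (s + 1) * sqrt (Suc n) / Suc n"
    by (intro divide_right_mono) auto
  also have "\<dots> = persist_rate * (s + 1) / sqrt (Suc n)"
  proof -
    have "a * q / (q * q) = a / q" for a q :: real by (cases "q = 0") simp_all
    from this[of _ "sqrt (Suc n)"] show ?thesis by (simp only: real_sqrt_mult_self abs_of_nat)
  qed
  finally show ?thesis using stay_nonneg_le[OF s] by (rule order_trans[rotated])
qed

lemma distr_step: "distr Steps borel (\<lambda>y. y n) = \<tau>"
proof -
  have "distr Steps borel (\<lambda>y. y n) = distr Steps \<tau> (\<lambda>y. y n)"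
    by (rule distr_cong) (simp_all add: sets_step)
  then show ?thesis by (simp add: PiM_component)
qed

lemma indep_steps: "P.indep_vars (\<lambda>_. borel) (\<lambda>n y. y n) UNIV"
proof (subst P.indep_vars_iff_distr_eq_PiM)
  have "sets Steps = sets (PiM (UNIV :: nat set) (\<lambda>_. borel :: real measure))"
    by (auto intro!: sets_PiM_cong simp: sets_step)
  then show "distr Steps (\<Pi>\<^sub>M i\<in>UNIV. borel) (\<lambda>x. \<lambda>i\<in>UNIV. x i) = (\<Pi>\<^sub>M i\<in>UNIV. distr Steps borel (\<lambda>y. y i))"
    by (simp add: distr_step restrict_UNIV distr_id2)
qed auto

lemma std_normal_cdf_1: "isCont (cdf std_normal_distribution) 1" "cdf std_normal_distribution 1 < 1"
proof -
  interpret N: real_distribution std_normal_distribution by (rule real_dist_normal_dist)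
  have "emeasure std_normal_distribution {1} = 0"
    by (subst emeasure_density) (auto intro!: nn_integral_zero' AE_I'[of "{1}"] simp: null_sets_def split: split_indicator)
  then show "isCont (cdf std_normal_distribution) 1" by (simp add: N.isCont_cdf measure_def)
  have "measure std_normal_distribution {..1} \<noteq> 1"
  proof
    assume "measure std_normal_distribution {..1} = 1"
    then have "AE x in std_normal_distribution. x \<in> {..1}" by (subst (asm) N.prob_eq_1) auto
    then have "AE x in lborel. x \<in> {..1::real}"
      by (subst (asm) AE_density) (auto simp: std_normal_density_def)
    then have "emeasure lborel {1::real<..} = 0"
      by (subst (asm) AE_iff_measurable[of "{1<..}"]) auto
    moreover have "emeasure lborel {1<..2::real} \<le> emeasure lborel {1::real<..}"
      by (rule emeasure_mono) auto
    ultimately show False by (simp add: emeasure_lborel_Ioc)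
  qed
  then show "cdf std_normal_distribution 1 < 1"
    using N.prob_le_1[of "{..1}"] unfolding cdf_def by linarith
qed

text \<open>By the central limit theorem the probability tends to the Gaussian tail beyond \<open>1\<close>, and it
  eventually exceeds half of this limit.\<close>
lemma end_point_above:
  "\<forall>\<^sub>F l in sequentially. (1 - cdf std_normal_distribution 1) / 2 \<le> measure Steps {y. \<sigma> * sqrt l \<le> (\<Sum>i<l. y i)}"
proof -
  have "weak_conv_m (\<lambda>n. distr Steps borel (\<lambda>x. (\<Sum>i<n. x i) / sqrt (n * \<sigma>\<^sup>2))) std_normal_distribution"
  proof (rule P.central_limit_theorem_zero_mean[OF indep_steps, where \<mu> = \<tau>])
    fix n
    have tr: "integral\<^sup>L Steps (\<lambda>x. f (x n)) = integral\<^sup>L \<tau> f" "integrable Steps (\<lambda>x. f (x n)) \<longleftrightarrow> integrable \<tau> f"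
      if [measurable]: "f \<in> borel_measurable borel" for f :: "real \<Rightarrow> real"
      using integral_distr[of "\<lambda>y. y n" Steps borel f] integrable_distr_eq[of "\<lambda>y. y n" Steps borel f] by (simp_all add: distr_step)
    show m: "P.expectation (\<lambda>x. x n) = 0" using tr(1)[of "\<lambda>y. y"] mean by simp
    show "integrable Steps (\<lambda>x. (x n)\<^sup>2)" using tr(2)[of "\<lambda>y. y\<^sup>2"] by simp
    show "P.variance (\<lambda>x. x n) = \<sigma>\<^sup>2" using tr(1)[of "\<lambda>y. y\<^sup>2"] m variance by simp
  qed (auto simp: \<sigma>_pos distr_step)
  then have "(\<lambda>n. cdf (distr Steps borel (\<lambda>x. (\<Sum>i<n. x i) / sqrt (n * \<sigma>\<^sup>2))) 1) \<longlonglongrightarrow> cdf std_normal_distribution 1"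
    using std_normal_cdf_1(1) by (simp add: weak_conv_m_def weak_conv_def)
  moreover have "cdf std_normal_distribution 1 < (1 + cdf std_normal_distribution 1) / 2"
    using std_normal_cdf_1(2) by simp
  ultimately have "\<forall>\<^sub>F n in sequentially. cdf (distr Steps borel (\<lambda>x. (\<Sum>i<n. x i) / sqrt (n * \<sigma>\<^sup>2))) 1 < (1 + cdf std_normal_distribution 1) / 2"
    by (rule order_tendstoD(2))
  then show ?thesis
    using eventually_gt_at_top[of 0]
  proof eventually_elim
    case (elim n)
    have sq: "sqrt (n * \<sigma>\<^sup>2) = \<sigma> * sqrt n" using \<sigma>_pos by (simp add: real_sqrt_mult)
    have "cdf (distr Steps borel (\<lambda>x. (\<Sum>i<n. x i) / sqrt (n * \<sigma>\<^sup>2))) 1 =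
        measure Steps {y \<in> space Steps. (\<Sum>i<n. y i) \<le> \<sigma> * sqrt n}"
      unfolding cdf_def sq using \<sigma>_pos elim by (subst measure_distr) (auto simp: vimage_def Int_def conj_commute field_simps)
    moreover have "1 \<le> measure Steps {y \<in> space Steps. (\<Sum>i<n. y i) \<le> \<sigma> * sqrt n} + measure Steps {y \<in> space Steps. \<sigma> * sqrt n \<le> (\<Sum>i<n. y i)}"
    proof -
      have "1 = measure Steps (space Steps)" by (simp add: P.prob_space)
      also have "\<dots> \<le> measure Steps ({y \<in> space Steps. (\<Sum>i<n. y i) \<le> \<sigma> * sqrt n} \<union> {y \<in> space Steps. \<sigma> * sqrt n \<le> (\<Sum>i<n. y i)})"
        by (intro P.finite_measure_mono) auto
      also have "\<dots> \<le> measure Steps {y \<in> space Steps. (\<Sum>i<n. y i) \<le> \<sigma> * sqrt n} + measure Steps {y \<in> space Steps. \<sigma> * sqrt n \<le> (\<Sum>i<n. y i)}"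
        by (intro measure_Un_le) auto
      finally show ?thesis .
    qed
    ultimately show ?case using elim by (simp add: space_Steps field_simps)
  qed
qed

text \<open>The central limit theorem gives an end point above \<open>\<sigma> * sqrt l\<close> with probability at least
  \<open>2 * p\<close>.  The path leaves the strip with probability at most \<open>\<sigma>\<^sup>2 / K\<^sup>2\<close> by Kolmogorov's
  inequality, and \<open>K\<^sub>0\<close> makes this at most \<open>p\<close>.\<close>
proposition up_block:
  obtains p K\<^sub>0 :: real where "0 < p" "1 \<le> K\<^sub>0"
    "\<And>K. K\<^sub>0 \<le> K \<Longrightarrow> \<forall>\<^sub>F l in sequentially.
       p \<le> measure Steps {y. \<sigma> * sqrt l \<le> (\<Sum>i<l. y i) \<and> (\<forall>k\<le>l. \<bar>\<Sum>i<k. y i\<bar> \<le> K * sqrt l)}"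
proof -
  define p where "p = (1 - cdf std_normal_distribution 1) / 4"
  have p: "0 < p" using std_normal_cdf_1(2) by (simp add: p_def)
  define K\<^sub>0 where "K\<^sub>0 = max 1 (\<sigma> / sqrt p)"
  have "\<forall>\<^sub>F l in sequentially.
      p \<le> measure Steps {y. \<sigma> * sqrt l \<le> (\<Sum>i<l. y i) \<and> (\<forall>k\<le>l. \<bar>\<Sum>i<k. y i\<bar> \<le> K * sqrt l)}" if K: "K\<^sub>0 \<le> K" for K
    using end_point_above eventually_gt_at_top[of 0]
  proof eventually_elim
    case (elim l)
    have K1: "1 \<le> K" "\<sigma> / sqrt p \<le> K" using K by (auto simp: K\<^sub>0_def)
    define t where "t = K * sqrt l"
    have t: "0 < t" using K1 elim by (simp add: t_def)
    have "\<sigma>\<^sup>2 \<le> (K * sqrt p)\<^sup>2" using K1 p \<sigma>_pos by (intro power_mono) (auto simp: field_simps)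
    then have "l * \<sigma>\<^sup>2 / t\<^sup>2 \<le> p" using K1 p elim by (simp add: t_def power_mult_distrib field_simps)
    then have stay: "1 - p \<le> stay {-t<..<t} l 0" using stay_strip_ge[OF t, of 0 l] by simp
    let ?A = "{y. \<sigma> * sqrt l \<le> (\<Sum>i<l. y i)}" and ?B = "{y. \<forall>k\<le>l. 0 + (\<Sum>i<k. y i) \<in> {-t<..<t}}"
    have A: "?A \<in> sets Steps"
    proof -
      have "{y \<in> space Steps. \<sigma> * sqrt l \<le> (\<Sum>i<l. y i)} \<in> sets Steps" by measurable
      then show ?thesis by (simp add: space_Steps)
    qed
    have B: "?B \<in> sets Steps" by (rule measurable_stay1) simp
    have C: "{y. \<sigma> * sqrt l \<le> (\<Sum>i<l. y i) \<and> (\<forall>k\<le>l. \<bar>\<Sum>i<k. y i\<bar> \<le> K * sqrt l)} \<in> sets Steps"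
    proof -
      have "{y \<in> space Steps. \<sigma> * sqrt l \<le> (\<Sum>i<l. y i) \<and> (\<forall>k\<le>l. \<bar>\<Sum>i<k. y i\<bar> \<le> K * sqrt l)} \<in> sets Steps" by measurable
      then show ?thesis by (simp add: space_Steps)
    qed
    have "2 * p + (1 - p) \<le> measure Steps ?A + measure Steps ?B"
      using elim(1) stay by (intro add_mono) (auto simp: p_def stay_def)
    also have "\<dots> = measure Steps (?A \<union> ?B) + measure Steps (?A \<inter> ?B)"
      using A B by (simp add: P.finite_measure_Union' P.finite_measure_Diff' Int_commute)
    also have "\<dots> \<le> 1 + measure Steps {y. \<sigma> * sqrt l \<le> (\<Sum>i<l. y i) \<and> (\<forall>k\<le>l. \<bar>\<Sum>i<k. y i\<bar> \<le> K * sqrt l)}"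
      using C by (intro add_mono P.prob_le_1 P.finite_measure_mono) (auto simp: t_def abs_le_iff less_imp_le)
    finally show ?case by simp
  qed
  with p show thesis by (intro that[of p K\<^sub>0]) (auto simp: K\<^sub>0_def)
qed

end

section \<open>The random potential\<close>

definition log_ratio :: "real \<Rightarrow> real" where
  "log_ratio w = ln ((1 - w) / w)"

definition potential :: "(int \<Rightarrow> real) \<Rightarrow> int \<Rightarrow> real" where
  "potential \<omega> x = (if 0 \<le> x then \<Sum>i\<in>{1..x}. log_ratio (\<omega> i) else - (\<Sum>i\<in>{x + 1..0}. log_ratio (\<omega> i)))"

lemma measurable_log_ratio [measurable]: "log_ratio \<in> borel_measurable borel"
  unfolding log_ratio_def by measurable

lemma potential_0 [simp]: "potential \<omega> 0 = 0"
  by (simp add: potential_def)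

lemma potential_step: "potential \<omega> x - potential \<omega> (x - 1) = log_ratio (\<omega> x)"
proof (cases "0 < x")
  case True
  then have "{1..x} = insert x {1..x - 1}" by auto
  with True show ?thesis by (simp add: potential_def)
next
  case False
  then have "{x..0} = insert x {x + 1..0}" by auto
  with False show ?thesis by (simp add: potential_def)
qed

lemma potential_Suc: "potential \<omega> (x + 1) = potential \<omega> x + log_ratio (\<omega> (x + 1))"
  using potential_step[of \<omega> "x + 1"] by simp

lemma potential_forward:
  "potential \<omega> (m + int k) - potential \<omega> m = (\<Sum>i<k. log_ratio (\<omega> (m + 1 + int i)))"
proof (induction k)
  case (Suc k)
  then show ?case using potential_Suc[of \<omega> "m + int k"] by (simp add: algebra_simps)
qed simp

lemma potential_backward:
  "potential \<omega> (m - int k) - potential \<omega> m = (\<Sum>i<k. - log_ratio (\<omega> (m - int i)))"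
proof (induction k)
  case (Suc k)
  have "potential \<omega> (m - int k) - potential \<omega> (m - int k - 1) = log_ratio (\<omega> (m - int k))"
    by (rule potential_step)
  with Suc show ?case by (simp add: algebra_simps)
qed simp

lemma sum_inverse_sqrt: "(\<Sum>k<n. 1 / sqrt (Suc k)) \<le> 2 * sqrt n"
proof (induction n)
  case (Suc n)
  define a b where "a = sqrt n" and "b = sqrt (Suc n)"
  have ab: "0 \<le> a" "0 < b" "a \<le> b" "b * b = a * a + 1" by (auto simp: a_def b_def)
  have "a * b \<le> (a * a + b * b) / 2" using sum_squares_bound[of a b] by (simp add: power2_eq_square)
  then have "2 * a * b + 1 \<le> 2 * (b * b)" using ab(4) by simp
  then have "2 * a + 1 / b \<le> 2 * b" using ab(2) by (simp add: field_simps)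
  with Suc show ?case by (simp add: a_def b_def)
qed simp

text \<open>A discrete form of the integral of \<open>1 / sqrt (t * (1 - t))\<close> over the unit interval.  That the
  bound is uniform in \<open>n\<close> is what keeps the expected number of sites near the minimum of the
  potential bounded.  One of the two factors is always at most \<open>2 / sqrt (Suc n)\<close>.\<close>
lemma sum_inverse_sqrt_conv: "(\<Sum>k\<le>n. 1 / (sqrt (Suc k) * sqrt (Suc (n - k)))) \<le> 8"
proof -
  let ?r = "2 / sqrt (Suc n)"
  have "1 / (sqrt (Suc k) * sqrt (Suc (n - k))) \<le> ?r * (1 / sqrt (Suc k)) + ?r * (1 / sqrt (Suc (n - k)))" if "k \<le> n" for k
  proof -
    have key: "1 / (sqrt x * sqrt y) \<le> 2 / sqrt (Suc n) * (1 / sqrt y)" if "Suc n \<le> 2 * x" "0 < x" "0 < y" for x y :: nat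
    proof -
      have "sqrt (Suc n) \<le> sqrt (2 * 2 * x)" using that by (intro real_sqrt_le_mono) linarith
      also have "\<dots> = 2 * sqrt x" by (simp add: real_sqrt_mult)
      finally show ?thesis using that by (simp add: field_simps)
    qed
    have "Suc n \<le> 2 * Suc k \<or> Suc n \<le> 2 * Suc (n - k)" using that by arith
    then consider "Suc n \<le> 2 * Suc k" | "Suc n \<le> 2 * Suc (n - k)" by blast
    then show ?thesis
    proof cases
      case 1
      then have "1 / (sqrt (Suc k) * sqrt (Suc (n - k))) \<le> ?r * (1 / sqrt (Suc (n - k)))" by (rule key) auto
      moreover have "0 \<le> ?r * (1 / sqrt (Suc k))" by simp
      ultimately show ?thesis by linarith
    next
      case 2
      then have "1 / (sqrt (Suc (n - k)) * sqrt (Suc k)) \<le> ?r * (1 / sqrt (Suc k))" by (rule key) auto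
      moreover have "0 \<le> ?r * (1 / sqrt (Suc (n - k)))" by simp
      ultimately show ?thesis unfolding mult.commute[of "sqrt (Suc k)" "sqrt (Suc (n - k))"] by linarith
    qed
  qed
  then have "(\<Sum>k\<le>n. 1 / (sqrt (Suc k) * sqrt (Suc (n - k)))) \<le> (\<Sum>k\<le>n. ?r * (1 / sqrt (Suc k)) + ?r * (1 / sqrt (Suc (n - k))))"
    by (intro sum_mono) auto
  also have "\<dots> = ?r * (\<Sum>k\<le>n. 1 / sqrt (Suc k)) + ?r * (\<Sum>k\<le>n. 1 / sqrt (Suc (n - k)))"
    by (simp add: sum.distrib sum_distrib_left)
  also have "(\<Sum>k\<le>n. 1 / sqrt (Suc (n - k))) = (\<Sum>k\<le>n. 1 / sqrt (Suc k))"
    by (rule sum.reindex_bij_witness[of _ "\<lambda>k. n - k" "\<lambda>k. n - k"]) auto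
  also have "?r * (\<Sum>k\<le>n. 1 / sqrt (Suc k)) + ?r * (\<Sum>k\<le>n. 1 / sqrt (Suc k)) \<le> ?r * (2 * sqrt (Suc n)) + ?r * (2 * sqrt (Suc n))"
    using sum_inverse_sqrt[of "Suc n"] by (intro add_mono mult_left_mono) (simp_all add: lessThan_Suc_atMost)
  also have "\<dots> = 8" by simp
  finally show ?thesis .
qed

locale sinai_environment = iid_fields +
  fixes \<delta> :: real
  assumes \<delta>: "0 < \<delta>" "\<delta> < 1 / 2"
    and elliptic: "AE w in \<mu>. \<delta> \<le> w \<and> w \<le> 1 - \<delta>"
    and recurrent: "(\<integral>w. log_ratio w \<partial>\<mu>) = 0"
    and nondegenerate: "0 < (\<integral>w. (log_ratio w)\<^sup>2 \<partial>\<mu>)"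
begin

definition "c = ln ((1 - \<delta>) / \<delta>)"
definition "\<sigma> = sqrt (\<integral>w. (log_ratio w)\<^sup>2 \<partial>\<mu>)"

lemma log_ratio_le: "\<delta> \<le> w \<Longrightarrow> w \<le> 1 - \<delta> \<Longrightarrow> \<bar>log_ratio w\<bar> \<le> c"
proof -
  assume w: "\<delta> \<le> w" "w \<le> 1 - \<delta>"
  have "log_ratio w \<le> c" unfolding log_ratio_def c_def
    using w \<delta> by (subst ln_le_cancel_iff) (auto intro!: divide_pos_pos frac_le)
  moreover have "- log_ratio w \<le> c"
  proof -
    have "- log_ratio w = ln (w / (1 - w))" using w \<delta> by (simp add: log_ratio_def ln_div)
    also have "\<dots> \<le> c" unfolding c_def
      using w \<delta> by (subst ln_le_cancel_iff) (auto intro!: divide_pos_pos frac_le)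
    finally show ?thesis .
  qed
  ultimately show ?thesis by linarith
qed

lemma c_pos: "0 < c"
  unfolding c_def using \<delta> by (intro ln_gt_zero) (simp add: field_simps)

lemma \<sigma>_pos: "0 < \<sigma>"
  using nondegenerate by (simp add: \<sigma>_def)

sublocale Up: bounded_centred_step "distr \<mu> borel log_ratio" c \<sigma>
proof -
  interpret D: prob_space "distr \<mu> borel log_ratio" by (rule E0.prob_space_distr) simp
  show "bounded_centred_step (distr \<mu> borel log_ratio) c \<sigma>"
  proof
    show "AE y in distr \<mu> borel log_ratio. \<bar>y\<bar> \<le> c"
      using elliptic by (subst AE_distr_iff) (auto intro: log_ratio_le)
  qed (auto simp: integral_distr recurrent \<sigma>_pos, auto simp: \<sigma>_def)
qed

sublocale Down: bounded_centred_step "distr \<mu> borel (\<lambda>w. - log_ratio w)" c \<sigma>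
proof -
  interpret D: prob_space "distr \<mu> borel (\<lambda>w. - log_ratio w)" by (rule E0.prob_space_distr) simp
  show "bounded_centred_step (distr \<mu> borel (\<lambda>w. - log_ratio w)) c \<sigma>"
  proof
    show "AE y in distr \<mu> borel (\<lambda>w. - log_ratio w). \<bar>y\<bar> \<le> c"
      using elliptic by (subst AE_distr_iff) (auto intro: log_ratio_le)
  qed (auto simp: integral_distr recurrent \<sigma>_pos, auto simp: \<sigma>_def)
qed

lemma prob_Env_steps:
  fixes t :: "nat \<Rightarrow> int" and f :: "real \<Rightarrow> real"
  assumes t: "inj t" and f[measurable]: "f \<in> borel_measurable borel"
    and B: "B \<in> sets (PiM UNIV (\<lambda>_. distr \<mu> borel f))"
  shows "{p. (\<lambda>k. f (fst p (t k))) \<in> B} \<in> sets Fields"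
    "measure Fields {p. (\<lambda>k. f (fst p (t k))) \<in> B} = measure (PiM UNIV (\<lambda>_. distr \<mu> borel f)) B"
proof -
  have s: "sets (PiM UNIV (\<lambda>_. distr \<mu> borel f)) = sets (PiM (UNIV :: nat set) (\<lambda>_. borel :: real measure))"
    by (intro sets_PiM_cong) auto
  have m: "(\<lambda>\<omega> k. f (\<omega> (t k))) \<in> Env \<rightarrow>\<^sub>M PiM UNIV (\<lambda>_. borel)"
    by (rule measurable_PiM_single') simp_all
  have m2: "(\<lambda>p k. f (fst p (t k))) \<in> Fields \<rightarrow>\<^sub>M PiM UNIV (\<lambda>_. borel)"
    using measurable_compose[OF measurable_fst m] .
  have e: "{p. (\<lambda>k. f (fst p (t k))) \<in> B} = (\<lambda>p k. f (fst p (t k))) -` B \<inter> space Fields"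
    by (auto simp: space_Fields)
  show "{p. (\<lambda>k. f (fst p (t k))) \<in> B} \<in> sets Fields"
    unfolding e using m2 B s by (intro measurable_sets[OF m2]) simp
  have "measure Fields {p. (\<lambda>k. f (fst p (t k))) \<in> B} = measure (distr (distr Fields Env fst) (PiM UNIV (\<lambda>_. borel)) (\<lambda>\<omega> k. f (\<omega> (t k)))) B"
    using B s by (subst distr_distr[OF m], simp, subst measure_distr)
      (auto simp: comp_def m2 space_Fields vimage_def)
  also have "distr Fields Env fst = Env"
    by (rule S.distr_pair_fst)
  finally show "measure Fields {p. (\<lambda>k. f (fst p (t k))) \<in> B} = measure (PiM UNIV (\<lambda>_. distr \<mu> borel f)) B"
    by (simp add: distr_Env_steps[OF t f])
qed

lemma measurable_potential: "(\<lambda>\<omega>. potential \<omega> x) \<in> borel_measurable Env"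
  unfolding potential_def by measurable

lemma measurable_potential_fst [measurable]: "(\<lambda>p. potential (fst p) x) \<in> borel_measurable Fields"
  by (rule measurable_compose[OF measurable_fst measurable_potential])

definition near_min :: "nat \<Rightarrow> real \<Rightarrow> nat \<Rightarrow> (int \<Rightarrow> real) \<Rightarrow> bool" where
  "near_min N h k \<omega> \<longleftrightarrow> (\<forall>i\<le>N. potential \<omega> (int k) \<le> potential \<omega> (int i) + h)"

text \<open>Seen from \<open>k\<close>, being within \<open>h\<close> of the minimum says that the two independent walks leaving \<open>k\<close>
  in opposite directions do not fall below \<open>- h\<close>.\<close>

lemma prob_near_min:
  assumes k: "k \<le> N" and h: "0 \<le> h"
  shows "measure Fields {p. near_min N h k (fst p)} \<le>
    (Up.persist_rate * (h + 1))\<^sup>2 * (1 / (sqrt (Suc k) * sqrt (Suc (N - k))))"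
proof -
  let ?S = "\<lambda>m. {y :: nat \<Rightarrow> real. \<forall>j\<le>m. h + (\<Sum>i<j. y i) \<in> {0..}}"
  let ?R = "{p. (\<lambda>i. log_ratio (fst p (int k + 1 + int i))) \<in> ?S (N - k)} :: ((int \<Rightarrow> real) \<times> (int \<Rightarrow> real)) set"
  let ?L = "{p. (\<lambda>i. - log_ratio (fst p (int k - int i))) \<in> ?S k} :: ((int \<Rightarrow> real) \<times> (int \<Rightarrow> real)) set"
  have injR: "inj (\<lambda>i. int k + 1 + int i)" and injL: "inj (\<lambda>i. int k - int i)" by (auto simp: inj_on_def)
  have R: "?R \<in> sets Fields" "measure Fields ?R = Up.stay {0..} (N - k) h"
    using prob_Env_steps[OF injR measurable_log_ratio Up.measurable_stay1[of "{0..}" "N - k" h]]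
    by (simp_all add: Up.stay_def)
  have m: "(\<lambda>w. - log_ratio w) \<in> borel_measurable borel" by measurable
  have L: "?L \<in> sets Fields" "measure Fields ?L = Down.stay {0..} k h"
    using prob_Env_steps[OF injL m Down.measurable_stay1[of "{0..}" k h]]
    by (simp_all add: Down.stay_def)
  have eq: "{p. near_min N h k (fst p)} = ?R \<inter> ?L"
  proof -
    have "near_min N h k \<omega> \<longleftrightarrow> (\<forall>j\<le>N - k. h + (potential \<omega> (int k + int j) - potential \<omega> (int k)) \<ge> 0) \<and>
        (\<forall>j\<le>k. h + (potential \<omega> (int k - int j) - potential \<omega> (int k)) \<ge> 0)" (is "_ \<longleftrightarrow> ?r \<and> ?l") for \<omega>
    proof
      assume n: "near_min N h k \<omega>"
      show "?r \<and> ?l"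
      proof (intro conjI allI impI)
        fix j assume "j \<le> N - k"
        then show "h + (potential \<omega> (int k + int j) - potential \<omega> (int k)) \<ge> 0"
          using n k by (auto simp: near_min_def dest!: spec[of _ "k + j"])
      next
        fix j assume "j \<le> k"
        then show "h + (potential \<omega> (int k - int j) - potential \<omega> (int k)) \<ge> 0"
          using n k by (auto simp: near_min_def of_nat_diff dest!: spec[of _ "k - j"])
      qed
    next
      assume rl: "?r \<and> ?l"
      show "near_min N h k \<omega>"
        unfolding near_min_def
      proof (intro allI impI)
        fix i assume i: "i \<le> N"
        show "potential \<omega> (int k) \<le> potential \<omega> (int i) + h"
        proof (cases "k \<le> i")
          case True
          with i rl show ?thesis by (auto simp: of_nat_diff dest!: spec[of _ "i - k"])
        next
          case False
          with rl show ?thesis by (auto simp: of_nat_diff dest!: spec[of _ "k - i"])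
        qed
      qed
    qed
    then show ?thesis by (auto simp: potential_forward potential_backward)
  qed
  have "measure Fields (?R \<inter> ?L) = measure Fields ?R * measure Fields ?L"
  proof (rule prob_Int_determined[OF R(1) L(1), where K = "{int k<..int N}" and L = "{0<..int k}"])
    have "(\<Sum>i<j. log_ratio (\<omega> (int k + 1 + int i))) = (\<Sum>i<j. log_ratio (\<omega>' (int k + 1 + int i)))"
      if "\<forall>i\<in>{int k<..int N}. \<omega> i = \<omega>' i" "j \<le> N - k" for \<omega> \<omega>' :: "int \<Rightarrow> real" and j
      using that k by (intro sum.cong refl arg_cong[where f = log_ratio]) auto
    then show "determined_by {int k<..int N} ?R" unfolding determined_by_def by auto
    have "(\<Sum>i<j. - log_ratio (\<omega> (int k - int i))) = (\<Sum>i<j. - log_ratio (\<omega>' (int k - int i)))"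
      if "\<forall>i\<in>{0<..int k}. \<omega> i = \<omega>' i" "j \<le> k" for \<omega> \<omega>' :: "int \<Rightarrow> real" and j
      using that k by (intro sum.cong refl arg_cong[where f = "\<lambda>x. - log_ratio x"]) auto
    then show "determined_by {0<..int k} ?L" unfolding determined_by_def mem_Collect_eq fst_conv by (metis (no_types, lifting))
  qed auto
  also have "\<dots> \<le> (Up.persist_rate * (h + 1) / sqrt (Suc (N - k))) * (Up.persist_rate * (h + 1) / sqrt (Suc k))"
  proof -
    have "Down.persist_rate = Up.persist_rate" by (simp add: Down.persist_rate_def Up.persist_rate_def)
    then show ?thesis
      unfolding R L using Up.stay_nonneg_le_sqrt[OF h, of "N - k"] Down.stay_nonneg_le_sqrt[OF h, of k]
        Up.stay_bounds(1)[of "{0..}" "N - k" h] Down.stay_bounds(1)[of "{0..}" k h]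
      by (intro mult_mono) auto
  qed
  also have "\<dots> = (Up.persist_rate * (h + 1))\<^sup>2 * (1 / (sqrt (Suc k) * sqrt (Suc (N - k))))"
    by (simp add: power2_eq_square)
  finally show ?thesis by (simp only: eq)
qed

text \<open>The expected number of sites within the height \<open>h\<close> of the minimum is of order \<open>h\<^sup>2\<close>, however
  long the interval is.\<close>
lemma sum_prob_near_min:
  assumes h: "0 \<le> h"
  shows "(\<Sum>k\<le>N. measure Fields {p. near_min N h k (fst p)}) \<le> 8 * (Up.persist_rate * (h + 1))\<^sup>2"
proof -
  have "(\<Sum>k\<le>N. measure Fields {p. near_min N h k (fst p)}) \<le>
    (\<Sum>k\<le>N. (Up.persist_rate * (h + 1))\<^sup>2 * (1 / (sqrt (Suc k) * sqrt (Suc (N - k)))))"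
    using h by (intro sum_mono prob_near_min) auto
  also have "\<dots> = (Up.persist_rate * (h + 1))\<^sup>2 * (\<Sum>k\<le>N. 1 / (sqrt (Suc k) * sqrt (Suc (N - k))))"
    by (simp only: sum_distrib_left)
  also have "\<dots> \<le> (Up.persist_rate * (h + 1))\<^sup>2 * 8"
    using sum_inverse_sqrt_conv by (intro mult_left_mono) auto
  finally show ?thesis by simp
qed

definition depth :: "nat \<Rightarrow> nat \<Rightarrow> (int \<Rightarrow> real) \<Rightarrow> real" where
  "depth N k \<omega> = potential \<omega> (int k) - Min ((\<lambda>i. potential \<omega> (int i)) ` {..N})"

lemma depth_le_iff: "depth N k \<omega> \<le> h \<longleftrightarrow> near_min N h k \<omega>"
proof -
  have "depth N k \<omega> \<le> h \<longleftrightarrow> potential \<omega> (int k) - h \<le> Min ((\<lambda>i. potential \<omega> (int i)) ` {..N})"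
    unfolding depth_def by linarith
  also have "\<dots> \<longleftrightarrow> near_min N h k \<omega>" by (subst Min_ge_iff) (auto simp: near_min_def algebra_simps)
  finally show ?thesis .
qed

lemma depth_nonneg: "k \<le> N \<Longrightarrow> 0 \<le> depth N k \<omega>"
  by (auto simp: depth_def intro!: Min_le)

lemma depth_argmin:
  assumes "b \<le> N" "\<And>i. i \<le> N \<Longrightarrow> potential \<omega> (int b) \<le> potential \<omega> (int i)"
  shows "depth N k \<omega> = potential \<omega> (int k) - potential \<omega> (int b)"
proof -
  have "Min ((\<lambda>i. potential \<omega> (int i)) ` {..N}) = potential \<omega> (int b)"
    using assms by (intro Min_eqI) auto
  then show ?thesis by (simp add: depth_def)
qed

lemma measurable_near_min: "{p. near_min N h k (fst p)} \<in> sets Fields"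
proof -
  have "{p. near_min N h k (fst p)} = (\<Inter>i\<in>{..N}. {p \<in> space Fields. potential (fst p) (int k) \<le> potential (fst p) (int i) + h})"
    by (auto simp: near_min_def space_Fields)
  also have "\<dots> \<in> sets Fields"
    by (intro sets.finite_INT borel_measurable_le borel_measurable_add measurable_potential_fst) auto
  finally show ?thesis .
qed

lemma measurable_depth: "depth N k \<in> borel_measurable Env"
  unfolding depth_def
  by (intro borel_measurable_diff measurable_potential borel_measurable_Min) auto

lemma measurable_depth_fst [measurable]: "(\<lambda>p. depth N k (fst p)) \<in> borel_measurable Fields"
  by (rule measurable_compose[OF measurable_fst measurable_depth])

text \<open>The sites are sorted by dyadic heights above the minimum: up to constants, at most \<open>4 ^ i\<close> of
  them have a height of order \<open>2 ^ i\<close>.\<close>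

lemma sum_nn_integral_depth:
  fixes \<phi> :: "real \<Rightarrow> ennreal"
  assumes anti: "\<And>a b. 0 \<le> a \<Longrightarrow> a \<le> b \<Longrightarrow> \<phi> b \<le> \<phi> a"
  shows "(\<Sum>k\<le>N. \<integral>\<^sup>+ p. \<phi> (depth N k (fst p)) \<partial>Fields) \<le>
    (\<Sum>i. \<phi> (2 ^ i - 1) * ennreal (8 * (Up.persist_rate * 2 ^ Suc i)\<^sup>2))"
proof -
  let ?A = "\<lambda>i k. {p :: (int \<Rightarrow> real) \<times> (int \<Rightarrow> real). near_min N (2 ^ Suc i - 1) k (fst p)}"
  have "(\<integral>\<^sup>+ p. \<phi> (depth N k (fst p)) \<partial>Fields) \<le> (\<Sum>i. \<phi> (2 ^ i - 1) * emeasure Fields (?A i k))" if k: "k \<le> N" for k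
  proof -
    have "\<phi> (depth N k \<omega>) \<le> (\<Sum>i. \<phi> (2 ^ i - 1) * indicator (?A i k) (\<omega>, \<xi>))" for \<omega> \<xi>
    proof -
      let ?d = "depth N k \<omega>"
      have ex: "\<exists>i. ?d \<le> 2 ^ Suc i - 1"
      proof -
        obtain i where "?d + 1 < 2 ^ i" using real_arch_pow[of 2 "?d + 1"] by auto
        then have "?d \<le> 2 ^ Suc i - 1" by simp (smt (verit) zero_le_power)
        then show ?thesis ..
      qed
      define i where "i = (LEAST i. ?d \<le> 2 ^ Suc i - 1)"
      have i: "?d \<le> 2 ^ Suc i - 1" unfolding i_def using ex by (rule LeastI_ex)
      have low: "2 ^ i - 1 \<le> ?d"
      proof (cases i)
        case 0
        then show ?thesis using depth_nonneg[OF k] by simp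
      next
        case (Suc j)
        then show ?thesis using not_less_Least[of j "\<lambda>i. ?d \<le> 2 ^ Suc i - 1"] by (auto simp: i_def)
      qed
      have "\<phi> ?d \<le> \<phi> (2 ^ i - 1)" using low by (intro anti) auto
      also have "\<dots> = \<phi> (2 ^ i - 1) * indicator (?A i k) (\<omega>, \<xi>)"
        using i depth_le_iff by simp
      also have "\<dots> \<le> (\<Sum>i. \<phi> (2 ^ i - 1) * indicator (?A i k) (\<omega>, \<xi>))"
        using sum_le_suminf[of "\<lambda>i. \<phi> (2 ^ i - 1) * indicator (?A i k) (\<omega>, \<xi>)" "{i}"]
        by (simp only: sum.insert finite.emptyI sum.empty empty_iff not_False_eq_True add_0_right summableI zero_le simp_thms finite.insertI)
      finally show ?thesis .
    qed
    then have "(\<integral>\<^sup>+ p. \<phi> (depth N k (fst p)) \<partial>Fields) \<le> (\<integral>\<^sup>+ p. (\<Sum>i. \<phi> (2 ^ i - 1) * indicator (?A i k) p) \<partial>Fields)"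
      by (intro nn_integral_mono) (auto simp del: power_Suc)
    also have "\<dots> = (\<Sum>i. \<phi> (2 ^ i - 1) * emeasure Fields (?A i k))"
    proof (subst nn_integral_suminf)
      show "(\<lambda>p. \<phi> (2 ^ i - 1) * indicator (?A i k) p) \<in> borel_measurable Fields" for i
        by (intro borel_measurable_times_ennreal borel_measurable_indicator borel_measurable_const measurable_near_min)
    qed (simp add: nn_integral_cmult_indicator measurable_near_min del: power_Suc)
    finally show ?thesis .
  qed
  then have "(\<Sum>k\<le>N. \<integral>\<^sup>+ p. \<phi> (depth N k (fst p)) \<partial>Fields) \<le> (\<Sum>k\<le>N. \<Sum>i. \<phi> (2 ^ i - 1) * emeasure Fields (?A i k))"
    by (intro sum_mono) auto
  also have "\<dots> = (\<Sum>i. \<Sum>k\<le>N. \<phi> (2 ^ i - 1) * emeasure Fields (?A i k))"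
    by (intro suminf_sum[symmetric]) auto
  also have "\<dots> \<le> (\<Sum>i. \<phi> (2 ^ i - 1) * ennreal (8 * (Up.persist_rate * 2 ^ Suc i)\<^sup>2))"
  proof (intro suminf_le)
    fix i
    have "(\<Sum>k\<le>N. emeasure Fields (?A i k)) = ennreal (\<Sum>k\<le>N. measure Fields (?A i k))"
      by (simp add: ES.emeasure_eq_measure sum_ennreal)
    also have "\<dots> \<le> ennreal (8 * (Up.persist_rate * (2 ^ Suc i - 1 + 1))\<^sup>2)"
      by (intro ennreal_leI sum_prob_near_min) (use one_le_power[of "2 :: real" "Suc i"] in linarith)
    finally show "(\<Sum>k\<le>N. \<phi> (2 ^ i - 1) * emeasure Fields (?A i k)) \<le> \<phi> (2 ^ i - 1) * ennreal (8 * (Up.persist_rate * 2 ^ Suc i)\<^sup>2)"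
      unfolding sum_distrib_left[symmetric] by (intro mult_left_mono) simp_all
  qed auto
  finally show ?thesis .
qed

end

text \<open>Here \<open>g\<close> is the cost of a scenery value.  At a site of height \<open>d\<close> above the bottom of a valley
  the cost has the weight \<open>exp (- d)\<close>, and \<open>g_tail\<close> bounds the mean of this contribution after
  truncation at \<open>1\<close>.  The exponent \<open>2\<close> that \<open>g_tail\<close> has to beat is the exponent of \<open>h\<^sup>2\<close> in
  \<open>sum_prob_near_min\<close>.\<close>
locale sinai_scenery = sinai_environment +
  fixes g :: "real \<Rightarrow> real" and D \<epsilon> :: real
  assumes g_measurable [measurable]: "g \<in> borel_measurable borel"
    and g_nonneg: "\<And>x. 0 \<le> g x"
    and D_nonneg: "0 \<le> D" and \<epsilon>_pos: "0 < \<epsilon>"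
    and g_tail: "\<And>d. 0 \<le> d \<Longrightarrow> (\<integral>\<^sup>+ x. ennreal (min 1 (g x * exp (- d))) \<partial>\<rho>) \<le> ennreal (D / (1 + d) powr (2 + \<epsilon>))"
    and g_zero: "0 < measure \<rho> {x. g x = 0}"
begin

lemma nn_integral_Scen:
  assumes [measurable]: "f \<in> borel_measurable borel"
  shows "(\<integral>\<^sup>+ \<xi>. f (\<xi> k) \<partial>Scen) = (\<integral>\<^sup>+ x. f x \<partial>\<rho>)"
proof -
  have "(\<integral>\<^sup>+ x. f x \<partial>\<rho>) = (\<integral>\<^sup>+ x. f x \<partial>distr Scen \<rho> (\<lambda>\<xi>. \<xi> k))"
    by (simp add: S.PiM_component)
  also have "\<dots> = (\<integral>\<^sup>+ \<xi>. f (\<xi> k) \<partial>Scen)" by (intro nn_integral_distr) auto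
  finally show ?thesis ..
qed

lemma prob_scenery_large:
  assumes t: "0 \<le> t" and B: "finite B"
  shows "{p. \<exists>k\<in>B. exp t < g (snd p k)} \<in> sets Fields"
    "measure Fields {p. \<exists>k\<in>B. exp t < g (snd p k)} \<le> card B * (D / (1 + t) powr (2 + \<epsilon>))"
proof -
  have one: "{p. exp t < g (snd p k)} \<in> sets Fields" for k
  proof -
    have "{p \<in> space Fields. exp t < g (snd p k)} \<in> sets Fields" by measurable
    then show ?thesis by (simp add: space_Fields)
  qed
  have un: "{p. \<exists>k\<in>B. exp t < g (snd p k)} = (\<Union>k\<in>B. {p. exp t < g (snd p k)})" by auto
  show "{p. \<exists>k\<in>B. exp t < g (snd p k)} \<in> sets Fields"
    unfolding un using B one by (intro sets.finite_UN) auto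
  have "emeasure Fields {p. exp t < g (snd p k)} \<le> ennreal (D / (1 + t) powr (2 + \<epsilon>))" for k
  proof -
    have "emeasure Fields {p. exp t < g (snd p k)} = (\<integral>\<^sup>+ p. indicator {p. exp t < g (snd p k)} p \<partial>Fields)"
      using one by simp
    also have "\<dots> \<le> (\<integral>\<^sup>+ p. ennreal (min 1 (g (snd p k) * exp (- t))) \<partial>Fields)"
    proof (intro nn_integral_mono)
      fix p :: "(int \<Rightarrow> real) \<times> (int \<Rightarrow> real)"
      have "exp t * exp (- t) \<le> g (snd p k) * exp (- t)" if "exp t < g (snd p k)"
        using that by (intro mult_right_mono) auto
      then show "indicator {p. exp t < g (snd p k)} p \<le> ennreal (min 1 (g (snd p k) * exp (- t)))"
        by (auto simp: exp_minus split: split_indicator)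
    qed
    also have "\<dots> = (\<integral>\<^sup>+ \<omega>. \<integral>\<^sup>+ \<xi>. ennreal (min 1 (g (\<xi> k) * exp (- t))) \<partial>Scen \<partial>Env)"
      by (subst S.nn_integral_fst[symmetric]) simp_all
    also have "\<dots> = (\<integral>\<^sup>+ x. ennreal (min 1 (g x * exp (- t))) \<partial>\<rho>)"
      by (simp add: nn_integral_Scen[of "\<lambda>x. ennreal (min 1 (g x * exp (- t)))"] E.emeasure_space_1)
    also have "\<dots> \<le> ennreal (D / (1 + t) powr (2 + \<epsilon>))" by (rule g_tail[OF t])
    finally show ?thesis .
  qed
  then have "measure Fields {p. exp t < g (snd p k)} \<le> D / (1 + t) powr (2 + \<epsilon>)" for k
    using D_nonneg t by (simp add: ES.emeasure_eq_measure)
  then have "(\<Sum>k\<in>B. measure Fields {p. exp t < g (snd p k)}) \<le> (\<Sum>k\<in>B. D / (1 + t) powr (2 + \<epsilon>))"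
    by (intro sum_mono) auto
  moreover have "measure Fields {p. \<exists>k\<in>B. exp t < g (snd p k)} \<le> (\<Sum>k\<in>B. measure Fields {p. exp t < g (snd p k)})"
    unfolding un using B one by (intro ES.finite_measure_subadditive_finite) auto
  ultimately show "measure Fields {p. \<exists>k\<in>B. exp t < g (snd p k)} \<le> card B * (D / (1 + t) powr (2 + \<epsilon>))" by simp
qed

definition valley_sum :: "nat \<Rightarrow> (int \<Rightarrow> real) \<Rightarrow> (int \<Rightarrow> real) \<Rightarrow> real" where
  "valley_sum N \<omega> \<xi> = (\<Sum>k\<in>{1..N}. g (\<xi> (int k)) * exp (- depth N k \<omega>))"

lemma measurable_valley_sum [measurable]: "(\<lambda>p. valley_sum N (fst p) (snd p)) \<in> borel_measurable Fields"
  unfolding valley_sum_def by measurable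

definition tight_const :: real where
  "tight_const = 32 * Up.persist_rate\<^sup>2 * D / (1 - 2 powr (- \<epsilon> / 2))"

text \<open>The sum may fail to have a mean.  But a sum of nonnegative terms that exceeds \<open>1\<close> is still at
  least \<open>1\<close> after all terms have been truncated at \<open>1\<close>, and the means of the truncated terms are
  bounded by \<open>g_tail\<close>.  The factor \<open>1 / C\<close> counts as an additional height \<open>ln C\<close> of all sites.
  Half of \<open>\<epsilon>\<close> makes the sum over dyadic heights converge, the other half gives the decay in \<open>C\<close>.\<close>
lemma prob_valley_sum_large:
  assumes C: "1 \<le> C"
  shows "measure Fields {p. C < valley_sum N (fst p) (snd p)} \<le> tight_const * (1 + ln C) powr (- \<epsilon> / 2)"
proof -
  define \<phi> where "\<phi> d = ennreal (D / (1 + (d + ln C)) powr (2 + \<epsilon>))" for d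
  have lnC: "0 \<le> ln C" using C by simp
  have meas: "{p. C < valley_sum N (fst p) (snd p)} \<in> sets Fields"
  proof -
    have "{p \<in> space Fields. C < valley_sum N (fst p) (snd p)} \<in> sets Fields" by measurable
    then show ?thesis by (simp add: space_Fields)
  qed
  have sum_min: "1 \<le> (\<Sum>k\<in>A. min 1 (a k))" if "1 < (\<Sum>k\<in>A. a k)" "finite A" "\<And>k. 0 \<le> a k" for A :: "nat set" and a :: "nat \<Rightarrow> real"
  proof (cases "\<exists>k\<in>A. 1 \<le> a k")
    case True
    then obtain k where k: "k \<in> A" "1 \<le> a k" by auto
    then have "1 = min 1 (a k)" by simp
    also have "\<dots> \<le> (\<Sum>k\<in>A. min 1 (a k))" using k that by (intro member_le_sum) auto
    finally show ?thesis .
  next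
    case False
    then have "(\<Sum>k\<in>A. min 1 (a k)) = (\<Sum>k\<in>A. a k)" by (intro sum.cong) auto
    with that show ?thesis by simp
  qed
  let ?a = "\<lambda>k p. g (snd p (int k)) * exp (- (depth N k (fst p) + ln C))"
  have "emeasure Fields {p. C < valley_sum N (fst p) (snd p)} = (\<integral>\<^sup>+ p. indicator {p. C < valley_sum N (fst p) (snd p)} p \<partial>Fields)"
    using meas by simp
  also have "\<dots> \<le> (\<integral>\<^sup>+ p. (\<Sum>k\<in>{1..N}. ennreal (min 1 (?a k p))) \<partial>Fields)"
  proof (intro nn_integral_mono)
    fix p :: "(int \<Rightarrow> real) \<times> (int \<Rightarrow> real)"
    have "1 \<le> (\<Sum>k\<in>{1..N}. min 1 (?a k p))" if "C < valley_sum N (fst p) (snd p)"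
    proof (rule sum_min)
      have "(\<Sum>k\<in>{1..N}. ?a k p) = valley_sum N (fst p) (snd p) / C"
        using C unfolding valley_sum_def sum_divide_distrib
        by (intro sum.cong refl) (simp add: exp_diff exp_minus field_simps)
      then show "1 < (\<Sum>k\<in>{1..N}. ?a k p)" using that C by simp
    qed (auto simp: g_nonneg)
    then have "ennreal 1 \<le> (\<Sum>k\<in>{1..N}. ennreal (min 1 (?a k p)))" if "C < valley_sum N (fst p) (snd p)"
      using that by (subst sum_ennreal) (auto simp: g_nonneg intro!: ennreal_leI)
    then show "indicator {p. C < valley_sum N (fst p) (snd p)} p \<le> (\<Sum>k\<in>{1..N}. ennreal (min 1 (?a k p)))"
      by (simp split: split_indicator)
  qed
  also have "\<dots> = (\<Sum>k\<in>{1..N}. \<integral>\<^sup>+ p. ennreal (min 1 (?a k p)) \<partial>Fields)"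
    by (rule nn_integral_sum) simp
  also have "\<dots> \<le> (\<Sum>k\<in>{1..N}. \<integral>\<^sup>+ p. \<phi> (depth N k (fst p)) \<partial>Fields)"
  proof (intro sum_mono)
    fix k assume k: "k \<in> {1..N}"
    have "(\<integral>\<^sup>+ p. ennreal (min 1 (?a k p)) \<partial>Fields) =
        (\<integral>\<^sup>+ \<omega>. \<integral>\<^sup>+ \<xi>. ennreal (min 1 (g (\<xi> (int k)) * exp (- (depth N k \<omega> + ln C)))) \<partial>Scen \<partial>Env)"
      by (subst S.nn_integral_fst[symmetric]) simp_all
    also have "\<dots> = (\<integral>\<^sup>+ \<omega>. \<integral>\<^sup>+ x. ennreal (min 1 (g x * exp (- (depth N k \<omega> + ln C)))) \<partial>\<rho> \<partial>Env)"
      by (intro nn_integral_cong nn_integral_Scen) simp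
    also have "\<dots> \<le> (\<integral>\<^sup>+ \<omega>. \<phi> (depth N k \<omega>) \<partial>Env)"
      unfolding \<phi>_def using k lnC by (intro nn_integral_mono g_tail) (auto intro!: add_nonneg_nonneg depth_nonneg)
    also have "\<dots> = (\<integral>\<^sup>+ \<omega>. \<integral>\<^sup>+ \<xi>. \<phi> (depth N k \<omega>) \<partial>Scen \<partial>Env)"
      by (simp add: S.emeasure_space_1)
    also have "\<dots> = (\<integral>\<^sup>+ p. \<phi> (depth N k (fst p)) \<partial>Fields)"
      by (subst S.nn_integral_fst[symmetric]) (simp_all add: \<phi>_def)
    finally show "(\<integral>\<^sup>+ p. ennreal (min 1 (?a k p)) \<partial>Fields) \<le> (\<integral>\<^sup>+ p. \<phi> (depth N k (fst p)) \<partial>Fields)" .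
  qed
  also have "\<dots> \<le> (\<Sum>k\<le>N. \<integral>\<^sup>+ p. \<phi> (depth N k (fst p)) \<partial>Fields)"
    by (intro sum_mono2) auto
  also have "\<dots> \<le> (\<Sum>i. \<phi> (2 ^ i - 1) * ennreal (8 * (Up.persist_rate * 2 ^ Suc i)\<^sup>2))"
  proof (rule sum_nn_integral_depth)
    fix a b :: real assume ab: "0 \<le> a" "a \<le> b"
    have "(1 + (a + ln C)) powr (2 + \<epsilon>) \<le> (1 + (b + ln C)) powr (2 + \<epsilon>)"
      using ab lnC \<epsilon>_pos by (intro powr_mono2) auto
    moreover have "0 < (1 + (a + ln C)) powr (2 + \<epsilon>)" using ab lnC by simp
    ultimately show "\<phi> b \<le> \<phi> a" unfolding \<phi>_def by (intro ennreal_leI divide_left_mono D_nonneg mult_pos_pos) linarith+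
  qed
  also have "\<dots> \<le> (\<Sum>i. ennreal (32 * Up.persist_rate\<^sup>2 * D * (1 + ln C) powr (- \<epsilon> / 2) * (2 powr (- \<epsilon> / 2)) ^ i))"
  proof (intro suminf_le)
    fix i :: nat
    have "(1 + ln C) powr (\<epsilon> / 2) * (2 ^ i) powr (2 + \<epsilon> / 2) \<le> (2 ^ i + ln C) powr (\<epsilon> / 2) * (2 ^ i + ln C) powr (2 + \<epsilon> / 2)"
      using lnC \<epsilon>_pos by (intro mult_mono powr_mono2) auto
    also have "\<dots> = (2 ^ i + ln C) powr (2 + \<epsilon>)" by (simp add: add.commute flip: powr_add)
    finally have low: "(1 + ln C) powr (\<epsilon> / 2) * (2 ^ i) powr (2 + \<epsilon> / 2) \<le> (2 ^ i + ln C) powr (2 + \<epsilon>)" .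
    have "(2 ^ i :: real) powr 2 = 4 ^ i"
      by (simp add: power2_eq_square flip: power_mult_distrib)
    then have p2: "(2 ^ i :: real) powr (2 + \<epsilon> / 2) = 4 ^ i * (2 ^ i) powr (\<epsilon> / 2)"
      by (simp only: powr_add)
    have "(2 ^ i :: real) powr (\<epsilon> / 2) = (2 powr (\<epsilon> / 2)) ^ i"
      by (simp add: powr_power powr_powr mult.commute flip: powr_realpow)
    then have pe: "(2 powr (- \<epsilon> / 2)) ^ i = 1 / (2 ^ i :: real) powr (\<epsilon> / 2)"
      by (simp add: powr_minus_divide power_one_over)
    have "D / (2 ^ i + ln C) powr (2 + \<epsilon>) * (8 * (Up.persist_rate * 2 ^ Suc i)\<^sup>2) =
        32 * Up.persist_rate\<^sup>2 * D * 4 ^ i / (2 ^ i + ln C) powr (2 + \<epsilon>)"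
      by (simp add: power_mult_distrib power2_eq_square flip: power_mult_distrib)
    also have "\<dots> \<le> 32 * Up.persist_rate\<^sup>2 * D * 4 ^ i / ((1 + ln C) powr (\<epsilon> / 2) * (2 ^ i) powr (2 + \<epsilon> / 2))"
    proof (intro divide_left_mono mult_pos_pos low)
      have "0 < 2 ^ i + ln C" "0 < 1 + ln C" using lnC by (simp_all add: add_pos_nonneg)
      then show "0 < (2 ^ i + ln C) powr (2 + \<epsilon>)" "0 < (1 + ln C) powr (\<epsilon> / 2)" "0 < (2 ^ i :: real) powr (2 + \<epsilon> / 2)" by simp_all
    qed (use D_nonneg in simp)
    also have "\<dots> = 32 * Up.persist_rate\<^sup>2 * D * (1 + ln C) powr (- \<epsilon> / 2) * (2 powr (- \<epsilon> / 2)) ^ i"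
      unfolding p2 pe using lnC by (simp add: powr_minus_divide)
    finally have "D / (2 ^ i + ln C) powr (2 + \<epsilon>) * (8 * (Up.persist_rate * 2 ^ Suc i)\<^sup>2) \<le>
        32 * Up.persist_rate\<^sup>2 * D * (1 + ln C) powr (- \<epsilon> / 2) * (2 powr (- \<epsilon> / 2)) ^ i" .
    then show "\<phi> (2 ^ i - 1) * ennreal (8 * (Up.persist_rate * 2 ^ Suc i)\<^sup>2) \<le>
        ennreal (32 * Up.persist_rate\<^sup>2 * D * (1 + ln C) powr (- \<epsilon> / 2) * (2 powr (- \<epsilon> / 2)) ^ i)"
      using D_nonneg by (simp add: \<phi>_def ennreal_leI del: power_Suc flip: ennreal_mult)
  qed auto
  also have "\<dots> = ennreal (\<Sum>i. 32 * Up.persist_rate\<^sup>2 * D * (1 + ln C) powr (- \<epsilon> / 2) * (2 powr (- \<epsilon> / 2)) ^ i)"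
    using D_nonneg \<epsilon>_pos by (intro suminf_ennreal2) (auto intro!: summable_mult summable_geometric simp: powr_less_one)
  also have "(\<Sum>i. 32 * Up.persist_rate\<^sup>2 * D * (1 + ln C) powr (- \<epsilon> / 2) * (2 powr (- \<epsilon> / 2)) ^ i) =
      tight_const * (1 + ln C) powr (- \<epsilon> / 2)"
    using \<epsilon>_pos by (subst suminf_mult) (auto simp: tight_const_def suminf_geometric powr_less_one intro!: summable_geometric)
  finally have "ennreal (measure Fields {p. C < valley_sum N (fst p) (snd p)}) \<le> ennreal (tight_const * (1 + ln C) powr (- \<epsilon> / 2))"
    by (simp add: ES.emeasure_eq_measure)
  moreover have "0 \<le> tight_const"
    using D_nonneg \<epsilon>_pos by (auto simp: tight_const_def powr_less_one less_imp_le intro!: divide_nonneg_nonneg)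
  ultimately show ?thesis by (simp add: ennreal_le_iff)
qed

corollary valley_sum_tight:
  assumes "0 < \<kappa>"
  obtains C where "1 \<le> C" "\<And>N. measure Fields {p. C < valley_sum N (fst p) (snd p)} \<le> \<kappa>"
proof -
  have "((\<lambda>C. tight_const * (1 + ln C) powr (- \<epsilon> / 2)) \<longlongrightarrow> tight_const * 0) at_top"
    using \<epsilon>_pos by (intro tendsto_mult tendsto_const) real_asymp
  then have "\<forall>\<^sub>F C in at_top. tight_const * (1 + ln C) powr (- \<epsilon> / 2) < \<kappa>"
    using assms by (intro order_tendstoD(2)) auto
  then have "\<forall>\<^sub>F C in at_top. tight_const * (1 + ln C) powr (- \<epsilon> / 2) < \<kappa> \<and> 1 \<le> C"
    using eventually_ge_at_top[of "1 :: real"] by eventually_elim auto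
  then obtain C where "tight_const * (1 + ln C) powr (- \<epsilon> / 2) < \<kappa>" "1 \<le> C"
    by (auto simp: eventually_at_top_linorder)
  then show thesis using prob_valley_sum_large[of C] by (intro that[of C]) (auto intro: order_trans less_imp_le)
qed

end

section \<open>Valleys of the potential\<close>

definition forward_path :: "(int \<Rightarrow> real) \<Rightarrow> int \<Rightarrow> nat \<Rightarrow> real" where
  "forward_path \<omega> m k = (\<Sum>i<k. log_ratio (\<omega> (m + 1 + int i)))"

definition backward_path :: "(int \<Rightarrow> real) \<Rightarrow> int \<Rightarrow> nat \<Rightarrow> real" where
  "backward_path \<omega> m k = (\<Sum>i<k. - log_ratio (\<omega> (m - int i)))"

text \<open>A path \<open>u\<close> is cut into blocks of length \<open>l\<close>.  On a good block it moves by at least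
  \<open>\<sigma> * sqrt l\<close> in the direction \<open>s\<close>, upwards for \<open>s = 1\<close> and downwards for \<open>s = - 1\<close>, and it
  stays in a strip around its value at the start of the block.  The shape of a valley is derived
  from these two properties.\<close>
definition block_ok :: "real \<Rightarrow> real \<Rightarrow> real \<Rightarrow> nat \<Rightarrow> (nat \<Rightarrow> real) \<Rightarrow> nat \<Rightarrow> bool" where
  "block_ok \<sigma> s K l u q \<longleftrightarrow> \<sigma> * sqrt l \<le> s * (u (Suc q * l) - u (q * l)) \<and>
     (\<forall>k\<le>l. \<bar>u (q * l + k) - u (q * l)\<bar> \<le> K * sqrt l)"

lemma block_near:
  assumes "0 < l" "0 \<le> K" "\<And>q. q < n \<Longrightarrow> block_ok \<sigma> (s q) K l u q" "k \<le> n * l"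
  shows "\<bar>u k - u (k div l * l)\<bar> \<le> K * sqrt l" "k div l \<le> n"
proof -
  show n: "k div l \<le> n" using assms(1,4) by (metis div_le_mono div_mult_self_is_m)
  show "\<bar>u k - u (k div l * l)\<bar> \<le> K * sqrt l"
  proof (cases "k div l < n")
    case True
    have "k mod l \<le> l" using assms(1) by simp
    then have "\<bar>u (k div l * l + k mod l) - u (k div l * l)\<bar> \<le> K * sqrt l"
      using assms(3)[OF True] unfolding block_ok_def by blast
    then show ?thesis by simp
  next
    case False
    with n have "k div l = n" by simp
    then have "k = k div l * l" using assms(4) div_times_less_eq_dividend[of k l] by (metis le_antisym)
    then show ?thesis using assms(2) by simp
  qed
qed

lemma block_monotone:
  assumes "0 \<le> \<sigma>" "\<And>q. a \<le> q \<Longrightarrow> q < b \<Longrightarrow> block_ok \<sigma> s K l u q" "a \<le> x" "x \<le> y" "y \<le> b"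
  shows "(real y - real x) * (\<sigma> * sqrt l) \<le> s * (u (y * l) - u (x * l))"
  using assms(4,5)
proof (induction y rule: dec_induct)
  case (step y)
  have "block_ok \<sigma> s K l u y" using assms(2,3) step by auto
  with step show ?case by (simp add: block_ok_def algebra_simps)
qed simp

lemma near_diff: "\<bar>a - a'\<bar> \<le> t \<Longrightarrow> \<bar>b - b'\<bar> \<le> t \<Longrightarrow> a' \<le> b' \<Longrightarrow> a - b \<le> 2 * (t :: real)"
  by linarith

text \<open>At multiples of \<open>l\<close> the path increases.  Any other point differs from the preceding multiple
  by at most \<open>K * sqrt l\<close>, so the path never falls by more than twice this amount.\<close>
lemma up_blocks:
  assumes "0 < l" "0 \<le> K" "0 \<le> \<sigma>" and ok: "\<And>q. q < r \<Longrightarrow> block_ok \<sigma> 1 K l u q"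
  shows "x \<le> y \<Longrightarrow> y \<le> r * l \<Longrightarrow> u x - u y \<le> 2 * K * sqrt l"
    and "real r * \<sigma> * sqrt l \<le> u (r * l) - u 0"
proof -
  show "u x - u y \<le> 2 * K * sqrt l" if xy: "x \<le> y" "y \<le> r * l"
  proof -
    have near: "\<bar>u k - u (k div l * l)\<bar> \<le> K * sqrt l" "k div l \<le> r" if "k \<le> r * l" for k
      using block_near[of l K r \<sigma> "\<lambda>_. 1" u k] assms(1,2) ok that by auto
    note x = near[OF order_trans[OF xy]] and y = near[OF xy(2)]
    have le: "x div l \<le> y div l" using xy by (intro div_le_mono)
    have up: "(real (y div l) - real (x div l)) * (\<sigma> * sqrt l) \<le> 1 * (u (y div l * l) - u (x div l * l))"
      by (rule block_monotone[where a = 0 and b = r and K = K]) (use assms(3) ok le y(2) in auto)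
    have "0 \<le> (real (y div l) - real (x div l)) * (\<sigma> * sqrt l)"
      using le assms(3) by (intro mult_nonneg_nonneg) auto
    from order_trans[OF this up] have "u (x div l * l) \<le> u (y div l * l)" by simp
    from near_diff[OF x(1) y(1) this] show ?thesis by (simp add: mult.assoc)
  qed
  show "real r * \<sigma> * sqrt l \<le> u (r * l) - u 0"
    using block_monotone[of \<sigma> 0 r 1 K l u 0 r] assms(3) ok by simp
qed

text \<open>A path that descends and then ascends, block by block.  The minimum \<open>b\<close> need not be the
  turning point; a point \<open>y\<close> beyond the turning point is compared with \<open>b\<close>, whose value is below
  that of \<open>x\<close>.\<close>

lemma down_up_blocks:
  assumes l: "0 < l" "0 \<le> K" "0 \<le> \<sigma>"
    and ok: "\<And>q. q < 2 * r \<Longrightarrow> block_ok \<sigma> (if q < r then - 1 else 1) K l u q"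
    and b: "b \<le> 2 * r * l" "\<And>i. i \<le> 2 * r * l \<Longrightarrow> u b \<le> u i"
  shows "x \<le> y \<Longrightarrow> y \<le> b \<Longrightarrow> u y - u x \<le> 2 * K * sqrt l"
    and "u b \<le> u 0 - real r * \<sigma> * sqrt l"
    and "real r * \<sigma> * sqrt l \<le> u (2 * r * l) - u b"
proof -
  have nn: "0 \<le> (real y - real x) * (\<sigma> * sqrt l)" if "x \<le> y" for x y :: nat
    using that l(3) by (intro mult_nonneg_nonneg) auto
  have down: "(real y - real x) * (\<sigma> * sqrt l) \<le> - 1 * (u (y * l) - u (x * l))" if "x \<le> y" "y \<le> r" for x y
  proof (rule block_monotone[where a = 0 and b = r and K = K])
    show "block_ok \<sigma> (- 1) K l u q" if "q < r" for q using ok[of q] that by simp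
  qed (use l that in auto)
  have up: "(real y - real x) * (\<sigma> * sqrt l) \<le> 1 * (u (y * l) - u (x * l))" if "r \<le> x" "x \<le> y" "y \<le> 2 * r" for x y
  proof (rule block_monotone[where a = r and b = "2 * r" and K = K])
    show "block_ok \<sigma> 1 K l u q" if "r \<le> q" "q < 2 * r" for q using ok[of q] that by simp
  qed (use l that in auto)
  show "u y - u x \<le> 2 * K * sqrt l" if xy: "x \<le> y" "y \<le> b"
  proof -
    have le: "x \<le> 2 * r * l" "y \<le> 2 * r * l" using xy b by auto
    have near: "\<bar>u k - u (k div l * l)\<bar> \<le> K * sqrt l" "k div l \<le> 2 * r" if "k \<le> 2 * r * l" for k
      using block_near[of l K "2 * r" \<sigma> "\<lambda>q. if q < r then - 1 else 1" u k] l ok that by auto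
    note x = near[OF le(1)] and y = near[OF le(2)] and bb = near[OF b(1)]
    have d: "x div l \<le> y div l" "y div l \<le> b div l" using xy by (auto intro!: div_le_mono)
    show ?thesis
    proof (cases "y div l \<le> r")
      case True
      have "u (y div l * l) \<le> u (x div l * l)" using order_trans[OF nn[OF d(1)] down[OF d(1) True]] by simp
      from near_diff[OF y(1) x(1) this] show ?thesis by (simp add: mult.assoc)
    next
      case False
      then have "r \<le> y div l" by simp
      from order_trans[OF nn[OF d(2)] up[OF this d(2) bb(2)]] have "u (y div l * l) \<le> u (b div l * l)" by simp
      from near_diff[OF y(1) bb(1) this] b(2)[OF le(1)] show ?thesis by (simp add: mult.assoc)
    qed
  qed
  have "u b \<le> u (r * l)" by (rule b(2)) simp
  moreover have "real r * \<sigma> * sqrt l \<le> u 0 - u (r * l)" using down[of 0 r] by (simp add: algebra_simps)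
  moreover have "real r * \<sigma> * sqrt l \<le> u (2 * r * l) - u (r * l)" using up[of r "2 * r"] by (simp add: algebra_simps)
  ultimately show "u b \<le> u 0 - real r * \<sigma> * sqrt l" "real r * \<sigma> * sqrt l \<le> u (2 * r * l) - u b" by linarith+
qed

context sinai_scenery
begin

lemma potential_forward_path: "potential \<omega> (m + int k) - potential \<omega> m = forward_path \<omega> m k"
  by (simp add: forward_path_def potential_forward)

lemma potential_backward_path: "potential \<omega> (m - int k) - potential \<omega> m = backward_path \<omega> m k"
  by (simp add: backward_path_def potential_backward)

lemma measurable_paths [measurable]:
  "(\<lambda>p. forward_path (fst p) m k) \<in> borel_measurable Fields"
  "(\<lambda>p. backward_path (fst p) m k) \<in> borel_measurable Fields"
  unfolding forward_path_def backward_path_def by measurable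

definition up_block_set :: "real \<Rightarrow> nat \<Rightarrow> (nat \<Rightarrow> real) set" where
  "up_block_set K l = {y. \<sigma> * sqrt l \<le> (\<Sum>i<l. y i) \<and> (\<forall>k\<le>l. \<bar>\<Sum>i<k. y i\<bar> \<le> K * sqrt l)}"

lemma sets_up_block_set: "up_block_set K l \<in> sets (PiM UNIV (\<lambda>_. borel))"
proof -
  have "{y \<in> space (PiM (UNIV :: nat set) (\<lambda>_. borel)). \<sigma> * sqrt l \<le> (\<Sum>i<l. y i) \<and> (\<forall>k\<le>l. \<bar>\<Sum>i<k. y i\<bar> \<le> K * sqrt l)}
      \<in> sets (PiM UNIV (\<lambda>_. borel))" by measurable
  then show ?thesis by (simp add: up_block_set_def space_PiM)
qed

text \<open>Rising and falling blocks of the potential have the same probability bound \<open>p\<close>, at any place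
  and in any direction of reading.\<close>
definition block_bound :: "real \<Rightarrow> real \<Rightarrow> bool" where
  "block_bound p K \<longleftrightarrow> 0 < p \<and> 1 \<le> K \<and> (\<forall>\<^sub>F l in sequentially. \<forall>t :: nat \<Rightarrow> int. inj t \<longrightarrow>
       p \<le> measure Fields {z. (\<lambda>k. log_ratio (fst z (t k))) \<in> up_block_set K l} \<and>
       p \<le> measure Fields {z. (\<lambda>k. - log_ratio (fst z (t k))) \<in> up_block_set K l})"

lemma block_bound_exists: "\<exists>p K. block_bound p K"
proof -
  obtain p1 K1 where 1: "0 < p1" "1 \<le> K1" "\<And>K. K1 \<le> K \<Longrightarrow> \<forall>\<^sub>F l in sequentially. p1 \<le> measure Up.Steps (up_block_set K l)"
    by (rule Up.up_block[folded up_block_set_def]) blast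
  obtain p2 K2 where 2: "0 < p2" "1 \<le> K2" "\<And>K. K2 \<le> K \<Longrightarrow> \<forall>\<^sub>F l in sequentially. p2 \<le> measure Down.Steps (up_block_set K l)"
    by (rule Down.up_block[folded up_block_set_def]) blast
  have s: "sets Up.Steps = sets (PiM (UNIV :: nat set) (\<lambda>_. borel :: real measure))"
    "sets Down.Steps = sets (PiM (UNIV :: nat set) (\<lambda>_. borel :: real measure))"
    by (auto intro!: sets_PiM_cong)
  have m: "(\<lambda>w. - log_ratio w) \<in> borel_measurable borel" by measurable
  have "block_bound (min p1 p2) (max K1 K2)"
    unfolding block_bound_def
  proof (intro conjI)
    have K: "K1 \<le> max K1 K2" "K2 \<le> max K1 K2" by auto
    show "\<forall>\<^sub>F l in sequentially. \<forall>t :: nat \<Rightarrow> int. inj t \<longrightarrow>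
       min p1 p2 \<le> measure Fields {z. (\<lambda>k. log_ratio (fst z (t k))) \<in> up_block_set (max K1 K2) l} \<and>
       min p1 p2 \<le> measure Fields {z. (\<lambda>k. - log_ratio (fst z (t k))) \<in> up_block_set (max K1 K2) l}"
      using 1(3)[OF K(1)] 2(3)[OF K(2)]
    proof eventually_elim
      case (elim l)
      then show ?case
        using prob_Env_steps(2)[OF _ measurable_log_ratio, of _ "up_block_set (max K1 K2) l"]
          prob_Env_steps(2)[OF _ m, of _ "up_block_set (max K1 K2) l"] sets_up_block_set s
        by (auto simp: min_le_iff_disj)
    qed
  qed (use 1 2 in auto)
  then show ?thesis by blast
qed

lemma block_ok_forward:
  "block_ok \<sigma> 1 K l (forward_path \<omega> m) q \<longleftrightarrow> (\<lambda>k. log_ratio (\<omega> (m + 1 + int (q * l) + int k))) \<in> up_block_set K l"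
  "block_ok \<sigma> (- 1) K l (forward_path \<omega> m) q \<longleftrightarrow> (\<lambda>k. - log_ratio (\<omega> (m + 1 + int (q * l) + int k))) \<in> up_block_set K l"
proof -
  have e: "forward_path \<omega> m (q * l + k) - forward_path \<omega> m (q * l) = (\<Sum>i<k. log_ratio (\<omega> (m + 1 + int (q * l) + int i)))" for k
    unfolding forward_path_def by (induction k) (simp_all add: algebra_simps)
  have e': "forward_path \<omega> m (Suc q * l) - forward_path \<omega> m (q * l) = (\<Sum>i<l. log_ratio (\<omega> (m + 1 + int (q * l) + int i)))"
    using e[of l] by (simp add: add.commute)
  show "block_ok \<sigma> 1 K l (forward_path \<omega> m) q \<longleftrightarrow> (\<lambda>k. log_ratio (\<omega> (m + 1 + int (q * l) + int k))) \<in> up_block_set K l"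
    "block_ok \<sigma> (- 1) K l (forward_path \<omega> m) q \<longleftrightarrow> (\<lambda>k. - log_ratio (\<omega> (m + 1 + int (q * l) + int k))) \<in> up_block_set K l"
    unfolding block_ok_def e e' up_block_set_def by (simp_all add: sum_negf)
qed

lemma block_ok_backward:
  "block_ok \<sigma> 1 K l (backward_path \<omega> m) q \<longleftrightarrow> (\<lambda>k. - log_ratio (\<omega> (m - int (q * l) - int k))) \<in> up_block_set K l"
proof -
  have e: "backward_path \<omega> m (q * l + k) - backward_path \<omega> m (q * l) = (\<Sum>i<k. - log_ratio (\<omega> (m - int (q * l) - int i)))" for k
    unfolding backward_path_def by (induction k) (simp_all add: algebra_simps)
  have e': "backward_path \<omega> m (Suc q * l) - backward_path \<omega> m (q * l) = (\<Sum>i<l. - log_ratio (\<omega> (m - int (q * l) - int i)))"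
    using e[of l] by (simp add: add.commute)
  show ?thesis unfolding block_ok_def e e' up_block_set_def by simp
qed

lemma up_block_set_cong:
  assumes "\<And>i. i < l \<Longrightarrow> y i = y' i"
  shows "y \<in> up_block_set K l \<longleftrightarrow> y' \<in> up_block_set K l"
proof -
  have "(\<Sum>i<k. y i) = (\<Sum>i<k. y' i)" if "k \<le> l" for k using assms that by (intro sum.cong) auto
  then show ?thesis by (simp add: up_block_set_def)
qed

lemma prob_blocks:
  fixes t :: "nat \<Rightarrow> nat \<Rightarrow> int" and sg :: "nat \<Rightarrow> real"
  assumes p: "0 \<le> p" and inj: "\<And>q. inj (t q)" and disj: "disjoint_family_on (\<lambda>q. t q ` {..<l}) {..<n}"
    and sg: "\<And>q. sg q \<in> {1, - 1}"
    and each: "\<And>t :: nat \<Rightarrow> int. inj t \<Longrightarrow>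
       p \<le> measure Fields {z. (\<lambda>k. log_ratio (fst z (t k))) \<in> up_block_set K l} \<and>
       p \<le> measure Fields {z. (\<lambda>k. - log_ratio (fst z (t k))) \<in> up_block_set K l}"
  shows "{z. \<forall>q<n. (\<lambda>k. sg q * log_ratio (fst z (t q k))) \<in> up_block_set K l} \<in> sets Fields"
    "p ^ n \<le> measure Fields {z. \<forall>q<n. (\<lambda>k. sg q * log_ratio (fst z (t q k))) \<in> up_block_set K l}"
proof -
  let ?A = "\<lambda>q. {z :: (int \<Rightarrow> real) \<times> (int \<Rightarrow> real). (\<lambda>k. sg q * log_ratio (fst z (t q k))) \<in> up_block_set K l}"
  have int: "{z. \<forall>q<n. (\<lambda>k. sg q * log_ratio (fst z (t q k))) \<in> up_block_set K l} = space Fields \<inter> (\<Inter>q\<in>{..<n}. ?A q)"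
    by (auto simp: space_Fields)
  have s: "sets (PiM UNIV (\<lambda>_. distr \<mu> borel f)) = sets (PiM (UNIV :: nat set) (\<lambda>_. borel :: real measure))" for f :: "real \<Rightarrow> real"
    by (auto intro!: sets_PiM_cong)
  have A: "?A q \<in> sets Fields" "p \<le> measure Fields (?A q)" for q
  proof -
    show "?A q \<in> sets Fields"
      using sets_up_block_set s by (intro prob_Env_steps(1) inj) auto
    show "p \<le> measure Fields (?A q)" using sg[of q] each[OF inj[of q]] by auto
  qed
  show "{z. \<forall>q<n. (\<lambda>k. sg q * log_ratio (fst z (t q k))) \<in> up_block_set K l} \<in> sets Fields"
    unfolding int using A by (cases "n = 0") auto
  show "p ^ n \<le> measure Fields {z. \<forall>q<n. (\<lambda>k. sg q * log_ratio (fst z (t q k))) \<in> up_block_set K l}"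
  proof (cases "n = 0")
    case True
    then show ?thesis using ES.prob_space by (simp add: space_Fields)
  next
    case False
    have det: "determined_by (t q ` {..<l}) (?A q)" for q
    proof (rule determined_byI)
      fix \<omega> \<omega>' \<xi> \<xi>' :: "int \<Rightarrow> real"
      assume "\<And>i. i \<in> t q ` {..<l} \<Longrightarrow> \<omega> i = \<omega>' i \<and> \<xi> i = \<xi>' i" and A: "(\<omega>, \<xi>) \<in> ?A q"
      then have "(\<lambda>k. sg q * log_ratio (\<omega> (t q k))) \<in> up_block_set K l \<longleftrightarrow> (\<lambda>k. sg q * log_ratio (\<omega>' (t q k))) \<in> up_block_set K l"
        by (intro up_block_set_cong) simp
      with A show "(\<omega>', \<xi>') \<in> ?A q" by simp
    qed
    have "p ^ n = (\<Prod>q<n. p)" by simp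
    also have "\<dots> \<le> (\<Prod>q<n. measure Fields (?A q))" using A p by (intro prod_mono) auto
    also have "\<dots> = measure Fields (\<Inter>q\<in>{..<n}. ?A q)"
      using False A det disj by (intro prob_INT_determined[symmetric]) auto
    finally show ?thesis unfolding int by (simp add: space_Fields)
  qed
qed

text \<open>The unit of height is \<open>h\<close>.  To the left the potential rises away from the origin up to a wall
  of height \<open>L * h\<close>.  To the right it descends to a bottom \<open>b\<close> and then rises to a second wall.
  The bounds \<open>2 * K * h\<close> limit what the walk has to climb on its way to \<open>b\<close>, and so they limit
  the time that it needs; \<open>L\<close> will be a large multiple of \<open>K\<close>, so that the walls hold the walk
  for much longer.  The weighted sum is, up to a constant factor, the cost per step once \<open>b\<close> is
  reached.\<close>
definition left_ok :: "nat \<Rightarrow> real \<Rightarrow> real \<Rightarrow> real \<Rightarrow> (nat \<Rightarrow> real) \<Rightarrow> (nat \<Rightarrow> real) \<Rightarrow> bool" where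
  "left_ok n h K L u s \<longleftrightarrow> (\<forall>y\<le>n. \<forall>x\<le>y. u x - u y \<le> 2 * K * h) \<and> L * h \<le> u n \<and> (\<forall>k<n. g (s k) \<le> exp (K * h))"

definition right_ok :: "nat \<Rightarrow> real \<Rightarrow> real \<Rightarrow> real \<Rightarrow> real \<Rightarrow> (nat \<Rightarrow> real) \<Rightarrow> (nat \<Rightarrow> real) \<Rightarrow> bool" where
  "right_ok n h K L \<kappa> u s \<longleftrightarrow> (\<exists>b\<le>n. (\<forall>y\<le>b. \<forall>x\<le>y. u y - u x \<le> 2 * K * h) \<and> u b \<le> - L * h \<and> L * h \<le> u n - u b \<and>
     (\<Sum>k\<in>{1..n}. g (s k) * exp (- (u k - u b))) \<le> \<kappa>) \<and> (\<forall>k\<in>{1..n}. g (s k) \<le> exp (K * h))"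

definition left_valley :: "int \<Rightarrow> nat \<Rightarrow> real \<Rightarrow> real \<Rightarrow> real \<Rightarrow> ((int \<Rightarrow> real) \<times> (int \<Rightarrow> real)) set" where
  "left_valley m n h K L = {p. left_ok n h K L (backward_path (fst p) m) (\<lambda>k. snd p (m - int k))}"

definition right_valley :: "int \<Rightarrow> nat \<Rightarrow> real \<Rightarrow> real \<Rightarrow> real \<Rightarrow> real \<Rightarrow> ((int \<Rightarrow> real) \<times> (int \<Rightarrow> real)) set" where
  "right_valley m n h K L \<kappa> = {p. right_ok n h K L \<kappa> (forward_path (fst p) m) (\<lambda>k. snd p (m + int k))}"

lemma sets_left_valley: "left_valley m n h K L \<in> sets Fields"
proof -
  have "{p \<in> space Fields. left_ok n h K L (backward_path (fst p) m) (\<lambda>k. snd p (m - int k))} \<in> sets Fields"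
    unfolding left_ok_def by measurable
  then show ?thesis by (simp add: left_valley_def space_Fields)
qed

lemma sets_right_valley: "right_valley m n h K L \<kappa> \<in> sets Fields"
proof -
  have "{p \<in> space Fields. right_ok n h K L \<kappa> (forward_path (fst p) m) (\<lambda>k. snd p (m + int k))} \<in> sets Fields"
    unfolding right_ok_def by measurable
  then show ?thesis by (simp add: right_valley_def space_Fields)
qed

lemma determined_left_valley: "determined_by {m - int n<..m} (left_valley m n h K L)"
proof (rule determined_byI)
  fix \<omega> \<omega>' \<xi> \<xi>' :: "int \<Rightarrow> real"
  assume eq: "\<And>i. i \<in> {m - int n<..m} \<Longrightarrow> \<omega> i = \<omega>' i \<and> \<xi> i = \<xi>' i" and v: "(\<omega>, \<xi>) \<in> left_valley m n h K L"
  have "backward_path \<omega>' m k = backward_path \<omega> m k" if "k \<le> n" for k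
    using eq that unfolding backward_path_def by (intro sum.cong refl arg_cong[where f = "\<lambda>x. - log_ratio x"]) auto
  moreover have "\<xi>' (m - int k) = \<xi> (m - int k)" if "k < n" for k using eq[of "m - int k"] that by auto
  ultimately show "(\<omega>', \<xi>') \<in> left_valley m n h K L" using v by (simp add: left_valley_def left_ok_def)
qed

lemma right_ok_cong:
  assumes "\<And>k. k \<le> n \<Longrightarrow> u' k = u k" "\<And>k. k \<in> {1..n} \<Longrightarrow> s' k = s k" "right_ok n h K L \<kappa> u s"
  shows "right_ok n h K L \<kappa> u' s'"
proof -
  obtain b where b: "b \<le> n" "\<forall>y\<le>b. \<forall>x\<le>y. u y - u x \<le> 2 * K * h" "u b \<le> - L * h" "L * h \<le> u n - u b"
    "(\<Sum>k\<in>{1..n}. g (s k) * exp (- (u k - u b))) \<le> \<kappa>" and "\<forall>k\<in>{1..n}. g (s k) \<le> exp (K * h)"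
    using assms(3) by (auto simp: right_ok_def)
  moreover have "(\<Sum>k\<in>{1..n}. g (s' k) * exp (- (u' k - u' b))) = (\<Sum>k\<in>{1..n}. g (s k) * exp (- (u k - u b)))"
    using assms(1,2) b(1) by (intro sum.cong refl) simp
  ultimately show ?thesis
    unfolding right_ok_def using assms(1,2) by (intro conjI exI[of _ b]) auto
qed

lemma determined_right_valley: "determined_by {m<..m + int n} (right_valley m n h K L \<kappa>)"
proof (rule determined_byI)
  fix \<omega> \<omega>' \<xi> \<xi>' :: "int \<Rightarrow> real"
  assume eq: "\<And>i. i \<in> {m<..m + int n} \<Longrightarrow> \<omega> i = \<omega>' i \<and> \<xi> i = \<xi>' i" and v: "(\<omega>, \<xi>) \<in> right_valley m n h K L \<kappa>"
  have f: "forward_path \<omega>' m k = forward_path \<omega> m k" if "k \<le> n" for k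
    using eq that unfolding forward_path_def by (intro sum.cong refl arg_cong[where f = log_ratio]) auto
  have s: "\<xi>' (m + int k) = \<xi> (m + int k)" if "k \<in> {1..n}" for k using eq[of "m + int k"] that by auto
  show "(\<omega>', \<xi>') \<in> right_valley m n h K L \<kappa>"
    using right_ok_cong[OF f s] v by (simp add: right_valley_def)
qed

lemma prob_right_valley_shift: "measure Fields (right_valley m n h K L \<kappa>) = measure Fields (right_valley 0 n h K L \<kappa>)"
proof -
  have "right_valley m n h K L \<kappa> = (\<lambda>(\<omega>, \<xi>). (\<lambda>i. \<omega> (i + m), \<lambda>i. \<xi> (i + m))) -` right_valley 0 n h K L \<kappa>"
    by (auto simp: right_valley_def forward_path_def[abs_def] algebra_simps)
  then show ?thesis using prob_Fields_reindex(2)[of "\<lambda>i. i + m", OF _ sets_right_valley] by simp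
qed

text \<open>The number of sites is of order \<open>l\<close>, while a given site is so expensive with a probability of
  order \<open>l powr - (1 + \<epsilon> / 2)\<close>.\<close>
lemma large_scenery_negligible:
  assumes "0 < K" "0 < \<kappa>"
  shows "\<forall>\<^sub>F l in sequentially. \<forall>B. finite B \<and> card B \<le> n * l \<longrightarrow> measure Fields {p. \<exists>k\<in>B. exp (K * sqrt l) < g (snd p k)} \<le> \<kappa>"
proof -
  have "((\<lambda>l :: nat. real n * real l * (D / (1 + K * sqrt l) powr (2 + \<epsilon>))) \<longlongrightarrow> 0) sequentially"
  proof -
    have "((\<lambda>l :: nat. real l / (1 + K * sqrt l) powr (2 + \<epsilon>)) \<longlongrightarrow> 0) sequentially"
      using assms(1) \<epsilon>_pos by real_asymp
    from tendsto_mult_left[OF this, of "real n * D"] show ?thesis by (simp add: mult_ac)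
  qed
  then have "\<forall>\<^sub>F l :: nat in sequentially. real n * real l * (D / (1 + K * sqrt l) powr (2 + \<epsilon>)) < \<kappa>"
    using assms(2) by (rule order_tendstoD(2))
  then show ?thesis
  proof eventually_elim
    case (elim l)
    show ?case
    proof (intro allI impI)
      fix B :: "int set" assume B: "finite B \<and> card B \<le> n * l"
      have "measure Fields {p. \<exists>k\<in>B. exp (K * sqrt l) < g (snd p k)} \<le> card B * (D / (1 + K * sqrt l) powr (2 + \<epsilon>))"
        using B assms(1) by (intro prob_scenery_large) auto
      also have "\<dots> \<le> (real n * real l) * (D / (1 + K * sqrt l) powr (2 + \<epsilon>))"
        using B D_nonneg by (intro mult_right_mono) (auto simp flip: of_nat_mult)
      finally show "measure Fields {p. \<exists>k\<in>B. exp (K * sqrt l) < g (snd p k)} \<le> \<kappa>" using elim by simp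
    qed
  qed
qed

end

text \<open>A centred step without positive values vanishes almost surely, against \<open>\<sigma> > 0\<close>.\<close>
lemma (in bounded_centred_step) positive_step:
  "\<exists>a>0. 0 < measure \<tau> {y. a \<le> y}"
proof (rule ccontr)
  assume contr: "\<not> (\<exists>a>0. 0 < measure \<tau> {y. a \<le> y})"
  have z: "measure \<tau> {y. a \<le> y} = 0" if "0 < a" for a
  proof -
    have "\<not> 0 < measure \<tau> {y. a \<le> y}" using contr that by blast
    then show ?thesis using measure_nonneg[of \<tau> "{y. a \<le> y}"] by linarith
  qed
  have "AE y in \<tau>. \<forall>n :: nat. y < 1 / Suc n"
  proof (subst AE_all_countable, intro allI)
    fix n :: nat
    have "{y. 1 / Suc n \<le> y} \<in> null_sets \<tau>"
      using z[of "1 / Suc n"] by (auto simp: null_sets_def T.emeasure_eq_measure sets_step)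
    then show "AE y in \<tau>. y < 1 / Suc n" by (rule AE_I') auto
  qed
  then have neg: "AE y in \<tau>. 0 \<le> - y"
  proof eventually_elim
    case (elim y)
    show ?case
    proof (rule ccontr)
      assume "\<not> 0 \<le> - y"
      then obtain n where "inverse (real (Suc n)) < y" using reals_Archimedean[of y] by auto
      with elim show False by (auto simp: inverse_eq_divide dest: spec[of _ n])
    qed
  qed
  have "(\<integral>y. - y \<partial>\<tau>) = 0" by (simp add: mean)
  then have "AE y in \<tau>. - y = 0" using neg by (subst (asm) integral_nonneg_eq_0_iff_AE) auto
  then have "AE y in \<tau>. y\<^sup>2 = 0" by eventually_elim simp
  then have "(\<integral>y. y\<^sup>2 \<partial>\<tau>) = 0" by (rule integral_eq_zero_AE)
  then show False using variance \<sigma>_pos by simp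
qed

context sinai_scenery
begin

lemma disjoint_blocks:
  assumes "\<And>q k. t q k = a + s * int (q * l + k)" "s = 1 \<or> s = - 1"
  shows "disjoint_family_on (\<lambda>q. t q ` {..<l}) I"
  unfolding disjoint_family_on_def
proof (intro ballI impI)
  fix q q' :: nat assume "q \<noteq> q'"
  have "q * l + k \<noteq> q' * l + k'" if "k < l" "k' < l" for k k'
    using \<open>q \<noteq> q'\<close> that by (metis add.commute add_cancel_right_left div_less div_mult_self3 not_less_zero)
  then show "t q ` {..<l} \<inter> t q' ` {..<l} = {}"
    using assms(2) by (auto simp: assms(1) simp del: of_nat_add of_nat_mult)
qed

text \<open>Good blocks in a row have probability \<open>p ^ r\<close>, which does not depend on \<open>l\<close>; the expensive
  sites take away at most half of it.\<close>
lemma prob_left_valley: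
  assumes B: "block_bound p K"
  shows "\<forall>\<^sub>F l in sequentially. \<forall>m. p ^ r / 2 \<le> measure Fields (left_valley m (r * l) (sqrt l) K (r * \<sigma>))"
proof -
  have p: "0 < p" "1 \<le> K" and ev: "\<forall>\<^sub>F l in sequentially. \<forall>t :: nat \<Rightarrow> int. inj t \<longrightarrow>
       p \<le> measure Fields {z. (\<lambda>k. log_ratio (fst z (t k))) \<in> up_block_set K l} \<and>
       p \<le> measure Fields {z. (\<lambda>k. - log_ratio (fst z (t k))) \<in> up_block_set K l}"
    using B by (auto simp: block_bound_def)
  have K: "0 < K" "0 < p ^ r / 2" using p by auto
  from ev large_scenery_negligible[OF K, of r] eventually_gt_at_top[of 0]
  show ?thesis
  proof eventually_elim
    case (elim l)
    show ?case
    proof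
      fix m :: int
      let ?t = "\<lambda>q k. m - int (q * l) - int k"
      let ?A = "{z. \<forall>q<r. (\<lambda>k. - 1 * log_ratio (fst z (?t q k))) \<in> up_block_set K l} :: ((int \<Rightarrow> real) \<times> (int \<Rightarrow> real)) set"
      let ?S = "{m - int (r * l)<..m}"
      let ?B = "{z. \<exists>k\<in>?S. exp (K * sqrt l) < g (snd z k)} :: ((int \<Rightarrow> real) \<times> (int \<Rightarrow> real)) set"
      have d: "disjoint_family_on (\<lambda>q. ?t q ` {..<l}) {..<r}"
        by (rule disjoint_blocks[where a = m and s = "- 1"]) auto
      have card: "nat (int r * int l) = r * l" by (simp add: nat_mult_distrib)
      have A: "?A \<in> sets Fields" "p ^ r \<le> measure Fields ?A"
        using prob_blocks[of p ?t l r "\<lambda>_. - 1" K] p d elim(1) by (auto simp: inj_on_def)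
      have Bm: "?B \<in> sets Fields" "measure Fields ?B \<le> p ^ r / 2"
        using prob_scenery_large(1)[of "K * sqrt l" ?S] elim(2)[rule_format, of ?S] p by (auto simp: card)
      have "p ^ r / 2 \<le> measure Fields ?A - measure Fields ?B" using A Bm by simp
      also have "\<dots> \<le> measure Fields (?A - ?B)"
        using A Bm ES.finite_measure_Diff'[of ?A ?B] ES.finite_measure_mono[of "?A \<inter> ?B" ?B] by auto
      also have "\<dots> \<le> measure Fields (left_valley m (r * l) (sqrt l) K (r * \<sigma>))"
      proof (rule ES.finite_measure_mono[OF subsetI sets_left_valley])
        fix z assume z: "z \<in> ?A - ?B"
        then have ok: "block_ok \<sigma> 1 K l (backward_path (fst z) m) q" if "q < r" for q
          using that by (simp add: block_ok_backward)
        have "g (snd z (m - int k)) \<le> exp (K * sqrt l)" if "k < r * l" for k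
        proof (rule ccontr)
          assume "\<not> ?thesis"
          moreover have "m - int k \<in> ?S" using that by (simp del: of_nat_mult)
          ultimately have "z \<in> ?B" by (auto simp: not_le simp del: of_nat_mult)
          with z show False by blast
        qed
        moreover have "backward_path (fst z) m 0 = 0" by (simp add: backward_path_def)
        ultimately show "z \<in> left_valley m (r * l) (sqrt l) K (r * \<sigma>)"
          unfolding left_valley_def left_ok_def mem_Collect_eq
          using up_blocks[OF elim(3) _ _ ok] p \<sigma>_pos by auto
      qed
      finally show "p ^ r / 2 \<le> measure Fields (left_valley m (r * l) (sqrt l) K (r * \<sigma>))" .
    qed
  qed
qed

text \<open>The right side of a valley before anything is inserted: the weighted cost is bounded by a
  constant \<open>C\<close>, which need not be small.\<close>
definition pre_valley :: "nat \<Rightarrow> nat \<Rightarrow> real \<Rightarrow> real \<Rightarrow> ((int \<Rightarrow> real) \<times> (int \<Rightarrow> real)) set" where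
  "pre_valley r l K C = {z. (\<forall>q<2 * r. block_ok \<sigma> (if q < r then - 1 else 1) K l (forward_path (fst z) 0) q) \<and>
     valley_sum (2 * r * l) (fst z) (snd z) \<le> C \<and> (\<forall>k\<in>{1..2 * r * l}. g (snd z (int k)) \<le> exp (K * sqrt l))}"

lemma sets_pre_valley: "pre_valley r l K C \<in> sets Fields"
proof -
  have "{z \<in> space Fields. (\<forall>q<2 * r. block_ok \<sigma> (if q < r then - 1 else 1) K l (forward_path (fst z) 0) q) \<and>
     valley_sum (2 * r * l) (fst z) (snd z) \<le> C \<and> (\<forall>k\<in>{1..2 * r * l}. g (snd z (int k)) \<le> exp (K * sqrt l))} \<in> sets Fields"
    unfolding block_ok_def by measurable
  then show ?thesis by (simp add: pre_valley_def space_Fields)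
qed

lemma prob_pre_valley:
  assumes B: "block_bound p K"
  obtains C where "1 \<le> C" "\<forall>\<^sub>F l in sequentially. p ^ (2 * r) / 2 \<le> measure Fields (pre_valley r l K C)"
proof -
  have p: "0 < p" "1 \<le> K" and ev: "\<forall>\<^sub>F l in sequentially. \<forall>t :: nat \<Rightarrow> int. inj t \<longrightarrow>
       p \<le> measure Fields {z. (\<lambda>k. log_ratio (fst z (t k))) \<in> up_block_set K l} \<and>
       p \<le> measure Fields {z. (\<lambda>k. - log_ratio (fst z (t k))) \<in> up_block_set K l}"
    using B by (auto simp: block_bound_def)
  have K: "0 < K" "0 < p ^ (2 * r) / 4" using p by auto
  obtain C where C: "1 \<le> C" "\<And>N. measure Fields {z. C < valley_sum N (fst z) (snd z)} \<le> p ^ (2 * r) / 4"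
    by (rule valley_sum_tight[OF K(2)]) blast
  show thesis
  proof (rule that[OF C(1)])
    show "\<forall>\<^sub>F l in sequentially. p ^ (2 * r) / 2 \<le> measure Fields (pre_valley r l K C)"
      using ev large_scenery_negligible[OF K, of "2 * r"] eventually_gt_at_top[of 0]
    proof eventually_elim
      case (elim l)
      let ?t = "\<lambda>q k. 0 + 1 + int (q * l) + int k"
      let ?sg = "\<lambda>q. if q < r then - 1 else 1 :: real"
      let ?A = "{z. \<forall>q<2 * r. (\<lambda>k. ?sg q * log_ratio (fst z (?t q k))) \<in> up_block_set K l} :: ((int \<Rightarrow> real) \<times> (int \<Rightarrow> real)) set"
      let ?S = "int ` {1..2 * r * l}"
      let ?B = "{z. \<exists>k\<in>?S. exp (K * sqrt l) < g (snd z k)} :: ((int \<Rightarrow> real) \<times> (int \<Rightarrow> real)) set"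
      let ?D = "{z. C < valley_sum (2 * r * l) (fst z) (snd z)}"
      have d: "disjoint_family_on (\<lambda>q. ?t q ` {..<l}) {..<2 * r}"
        by (rule disjoint_blocks[where a = 1 and s = 1]) auto
      have A: "?A \<in> sets Fields" "p ^ (2 * r) \<le> measure Fields ?A"
        using prob_blocks[of p ?t l "2 * r" ?sg K] p d elim(1) by (auto simp: inj_on_def)
      have Bm: "?B \<in> sets Fields" "measure Fields ?B \<le> p ^ (2 * r) / 4"
        using prob_scenery_large(1)[of "K * sqrt l" ?S] elim(2)[rule_format, of ?S] p by (auto simp: card_image)
      have Dm: "?D \<in> sets Fields" "measure Fields ?D \<le> p ^ (2 * r) / 4"
      proof -
        have "{z \<in> space Fields. C < valley_sum (2 * r * l) (fst z) (snd z)} \<in> sets Fields" by measurable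
        then show "?D \<in> sets Fields" by (simp add: space_Fields)
      qed (rule C(2))
      have "measure Fields (?B \<union> ?D) \<le> p ^ (2 * r) / 2"
        using measure_Un_le[OF Bm(1) Dm(1)] Bm Dm by simp
      then have "p ^ (2 * r) / 2 \<le> measure Fields ?A - measure Fields (?B \<union> ?D)" using A by simp
      also have "\<dots> \<le> measure Fields (?A - (?B \<union> ?D))"
        using A Bm Dm ES.finite_measure_Diff'[of ?A "?B \<union> ?D"] ES.finite_measure_mono[of "?A \<inter> (?B \<union> ?D)" "?B \<union> ?D"] by auto
      also have "\<dots> \<le> measure Fields (pre_valley r l K C)"
      proof (rule ES.finite_measure_mono[OF subsetI sets_pre_valley])
        fix z assume z: "z \<in> ?A - (?B \<union> ?D)"
        have "block_ok \<sigma> (if q < r then - 1 else 1) K l (forward_path (fst z) 0) q" if "q < 2 * r" for q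
        proof -
          have "(\<lambda>k. ?sg q * log_ratio (fst z (?t q k))) \<in> up_block_set K l" using z that by blast
          then show ?thesis by (cases "q < r") (simp_all add: block_ok_forward)
        qed
        moreover have "g (snd z (int k)) \<le> exp (K * sqrt l)" if "k \<in> {1..2 * r * l}" for k
        proof (rule ccontr)
          assume "\<not> ?thesis"
          then have "z \<in> ?B" using that by (auto simp: not_le intro!: bexI[of _ k])
          with z show False by blast
        qed
        moreover have "valley_sum (2 * r * l) (fst z) (snd z) \<le> C" using z by (auto simp: not_less)
        ultimately show "z \<in> pre_valley r l K C" by (simp add: pre_valley_def)
      qed
      finally show ?case .
    qed
  qed
qed

subsection \<open>Deepening a valley\<close>

text \<open>The insertion of a block at \<open>b\<close> is described by its inverse: \<open>remove_block M b\<close> deletes the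
  sites \<open>b + 1, \<dots>, b + 2 * M\<close>.  This map preserves the law of the fields, and its result is
  independent of the deleted block.\<close>
definition cut :: "nat \<Rightarrow> nat \<Rightarrow> int \<Rightarrow> int" where
  "cut M b i = (if i \<le> int b then i else i + 2 * int M)"

definition remove_block :: "nat \<Rightarrow> nat \<Rightarrow> (int \<Rightarrow> real) \<times> (int \<Rightarrow> real) \<Rightarrow> (int \<Rightarrow> real) \<times> (int \<Rightarrow> real)" where
  "remove_block M b = (\<lambda>(\<omega>, \<xi>). (\<lambda>i. \<omega> (cut M b i), \<lambda>i. \<xi> (cut M b i)))"

definition inserted :: "real \<Rightarrow> nat \<Rightarrow> nat \<Rightarrow> ((int \<Rightarrow> real) \<times> (int \<Rightarrow> real)) set" where
  "inserted a M b = {z. \<forall>j<2 * M. g (snd z (int b + 1 + int j)) = 0 \<and>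
     (if j < M then log_ratio (fst z (int b + 1 + int j)) \<le> - a else a \<le> log_ratio (fst z (int b + 1 + int j)))}"

definition inserted_prob :: "real \<Rightarrow> nat \<Rightarrow> real" where
  "inserted_prob a M = (\<Prod>j<2 * M. measure \<mu> (if j < M then {w. log_ratio w \<le> - a} else {w. a \<le> log_ratio w}) * measure \<rho> {x. g x = 0})"

lemma inj_cut: "inj (cut M b)"
  unfolding cut_def inj_on_def by (auto split: if_splits)

lemma forward_path_Suc: "forward_path \<omega> m (Suc k) = forward_path \<omega> m k + log_ratio (\<omega> (m + 1 + int k))"
  by (simp add: forward_path_def)

text \<open>The inserted block makes the potential fall by at least \<open>a * M\<close> from \<open>b\<close> to the new bottom
  \<open>b + M\<close> and rise again by at least \<open>a * M\<close>.  Every other site lies higher above the new bottom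
  than it did above \<open>b\<close>, by at least \<open>a * M\<close>, so its weight has shrunk by \<open>exp (- a * M)\<close>; the
  inserted sites cost nothing.  As the new bottom is the only minimum, \<open>b\<close> can be read off from
  \<open>z\<close>.\<close>
lemma valley_after_insertion:
  fixes b M r l :: nat and K C a :: real and z :: "(int \<Rightarrow> real) \<times> (int \<Rightarrow> real)"
  defines "u \<equiv> forward_path (fst z) 0" and "N \<equiv> 2 * r * l"
  assumes pre: "remove_block M b z \<in> pre_valley r l K C" and ins: "z \<in> inserted a M b"
    and b: "b \<le> N" "\<And>i. i \<le> N \<Longrightarrow> forward_path (fst (remove_block M b z)) 0 b \<le> forward_path (fst (remove_block M b z)) 0 i"
    and l: "0 < l" "1 \<le> K" "0 < a" "0 < M" "0 \<le> C"
  shows "z \<in> right_valley 0 (N + 2 * M) (sqrt l) K (r * \<sigma>) (C * exp (- a * M))"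
    and "\<And>k. k \<le> N + 2 * M \<Longrightarrow> k \<noteq> b + M \<Longrightarrow> u (b + M) < u k"
proof -
  obtain \<omega> \<xi> where z: "z = (\<omega>, \<xi>)" by (cases z)
  define v where "v = forward_path (fst (remove_block M b z)) 0"
  have v: "v = forward_path (\<lambda>i. \<omega> (cut M b i)) 0" by (simp add: v_def remove_block_def z)
  have ok: "block_ok \<sigma> (if q < r then - 1 else 1) K l v q" if "q < 2 * r" for q
    using pre that by (simp add: pre_valley_def v_def)
  have sc: "g (\<xi> (cut M b (int k))) \<le> exp (K * sqrt l)" if "k \<in> {1..N}" for k
    using pre that by (auto simp: pre_valley_def remove_block_def z N_def)
  have vmin: "v b \<le> v i" if "i \<le> N" for i using b(2)[OF that] by (simp add: v_def)
  have v0: "v 0 = 0" by (simp add: v_def forward_path_def)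
  have Kn: "0 \<le> K" and \<sigma>n: "0 \<le> \<sigma>" using l \<sigma>_pos by auto
  have d1: "v y - v x \<le> 2 * K * sqrt l" if "x \<le> y" "y \<le> b" for x y
    using down_up_blocks(1)[of l K \<sigma> r v b x y] l(1) Kn \<sigma>n ok b(1) vmin that by (simp add: N_def)
  have d2: "v b \<le> v 0 - real r * \<sigma> * sqrt l" "real r * \<sigma> * sqrt l \<le> v N - v b"
    using down_up_blocks(2,3)[of l K \<sigma> r v b] l(1) Kn \<sigma>n ok b(1) vmin by (simp_all add: N_def)
  have depth: "depth N k (fst (remove_block M b z)) = v k - v b" if "k \<le> N" for k
  proof -
    have e: "potential \<omega>' (int k) = forward_path \<omega>' 0 k" for \<omega>' k using potential_forward_path[of \<omega>' 0 k] by simp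
    show ?thesis unfolding v_def e[symmetric] using b unfolding e[symmetric] by (intro depth_argmin) auto
  qed
  have sum: "(\<Sum>k\<in>{1..N}. g (\<xi> (cut M b (int k))) * exp (- (v k - v b))) \<le> C"
  proof -
    have "valley_sum N (fst (remove_block M b z)) (snd (remove_block M b z)) \<le> C"
      using pre by (simp add: pre_valley_def N_def)
    also have "valley_sum N (fst (remove_block M b z)) (snd (remove_block M b z)) =
        (\<Sum>k\<in>{1..N}. g (\<xi> (cut M b (int k))) * exp (- (v k - v b)))"
      unfolding valley_sum_def using depth by (intro sum.cong refl) (auto simp: remove_block_def z)
    finally show ?thesis .
  qed
  have gz: "g (\<xi> (int b + 1 + int j)) = 0" if "j < 2 * M" for j using ins that by (simp add: inserted_def z)
  have dn: "log_ratio (\<omega> (int b + 1 + int j)) \<le> - a" if "j < M" for j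
    using ins that by (auto simp: inserted_def z dest: spec[of _ j])
  have up: "a \<le> log_ratio (\<omega> (int b + 1 + int j))" if "M \<le> j" "j < 2 * M" for j
    using ins that by (auto simp: inserted_def z dest: spec[of _ j])
  have left: "u k = v k" if "k \<le> b" for k
    using that unfolding v u_def forward_path_def z by (intro sum.cong) (auto simp: cut_def)
  have down: "u (b + j) \<le> u (b + i) - a * (real j - real i)" if "i \<le> j" "j \<le> M" for i j
    using that(1,2)
  proof (induction j rule: dec_induct)
    case (step j)
    then show ?case using dn[of j] by (simp add: u_def z forward_path_Suc algebra_simps)
  qed simp
  have upw: "u (b + i) + a * (real j - real i) \<le> u (b + j)" if "M \<le> i" "i \<le> j" "j \<le> 2 * M" for i j
    using that(2,3)
  proof (induction j rule: dec_induct)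
    case (step j)
    then show ?case using up[of j] that(1) by (simp add: u_def z forward_path_Suc algebra_simps)
  qed simp
  have right: "u (k + 2 * M) - u (b + 2 * M) = v k - v b" if "b \<le> k" for k
    using that
  proof (induction k rule: dec_induct)
    case (step k)
    then show ?case by (simp add: v u_def z forward_path_Suc cut_def algebra_simps)
  qed simp
  have bot: "u (b + M) \<le> v b - a * M" using down[of 0 M] left[of b] by simp
  have bot2: "u (b + M) + a * M \<le> u (b + 2 * M)" using upw[of M "2 * M"] by (simp add: algebra_simps)
  have aM: "0 < a * M" using l by simp
  have far: "v k - v b + a * M \<le> u k' - u (b + M)" if "k \<le> b \<and> k' = k \<or> b \<le> k \<and> k' = k + 2 * M" for k k'
    using that
  proof
    assume "k \<le> b \<and> k' = k"
    then show ?thesis using left[of k] bot by simp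
  next
    assume "b \<le> k \<and> k' = k + 2 * M"
    then show ?thesis using right[of k] bot2 by simp
  qed
  show strict: "u (b + M) < u k" if k: "k \<le> N + 2 * M" "k \<noteq> b + M" for k
  proof -
    consider "k \<le> b" | i where "k = b + i" "i < M" | i where "k = b + i" "M < i" "i \<le> 2 * M" | "b + 2 * M < k"
      using k(2) by (metis le_add_diff_inverse linorder_not_less nat_le_linear nat_neq_iff add_less_cancel_left add_le_cancel_left)
    then show ?thesis
    proof cases
      case 1
      then show ?thesis using far[of k k] vmin[of k] b(1) aM by simp
    next
      case 2
      then have "0 < a * (real M - real i)" using l by simp
      then show ?thesis using down[of i M] 2 by simp
    next
      case 3
      then have "0 < a * (real i - real M)" using l by simp
      then show ?thesis using upw[of M i] 3 by simp
    next
      case 4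
      then obtain i where i: "k = i + 2 * M" "b \<le> i" by (metis add.commute add_le_cancel_left le_Suc_ex less_imp_le add_leD2)
      have "0 \<le> v i - v b" using vmin[of i] i k by simp
      then show ?thesis using far[of i k] i aM by simp
    qed
  qed
  show "z \<in> right_valley 0 (N + 2 * M) (sqrt l) K (r * \<sigma>) (C * exp (- a * M))"
    unfolding right_valley_def right_ok_def mem_Collect_eq u_def[symmetric]
  proof (intro conjI exI[of _ "b + M"] allI impI ballI)
    show "b + M \<le> N + 2 * M" using b(1) by simp
    fix y x assume y: "y \<le> b + M" and x: "x \<le> y"
    show "u y - u x \<le> 2 * K * sqrt l"
    proof (cases "y \<le> b")
      case True
      then show ?thesis using d1[OF x True] left x by simp
    next
      case False
      then obtain j where j: "y = b + j" "j \<le> M" using y by (metis add_le_cancel_left le_add_diff_inverse nat_le_linear)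
      have K0: "0 \<le> 2 * K * sqrt l" using Kn by simp
      show ?thesis
      proof (cases "x \<le> b")
        case True
        have "u y \<le> u b" using down[of 0 j] j l by simp (smt (verit) mult_nonneg_nonneg of_nat_0_le_iff)
        then show ?thesis using d1[of x b] left[OF True] left[of b] True by simp
      next
        case False
        then obtain i where i: "x = b + i" "i \<le> j" using x j by (metis add_le_cancel_left le_add_diff_inverse nat_le_linear)
        have "0 \<le> a * (real j - real i)" using i l by simp
        then show ?thesis using down[OF i(2) j(2)] i j K0 by simp
      qed
    qed
  next
    show "u (b + M) \<le> - (r * \<sigma>) * sqrt l" using bot d2(1) v0 aM by simp
    have "v N - v b + a * M \<le> u (N + 2 * M) - u (b + M)" using far[of N "N + 2 * M"] b(1) by simp
    then show "(r * \<sigma>) * sqrt l \<le> u (N + 2 * M) - u (b + M)" using d2(2) aM by simp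
    have "(\<Sum>k\<in>{1..N + 2 * M}. g (snd z (0 + int k)) * exp (- (u k - u (b + M)))) =
        (\<Sum>k\<in>{1..b}. g (\<xi> (int k)) * exp (- (u k - u (b + M)))) +
        ((\<Sum>k\<in>{b<..b + 2 * M}. g (\<xi> (int k)) * exp (- (u k - u (b + M)))) +
         (\<Sum>k\<in>{b + 2 * M<..N + 2 * M}. g (\<xi> (int k)) * exp (- (u k - u (b + M)))))"
    proof -
      have "{1..N + 2 * M} = {1..b} \<union> ({b<..b + 2 * M} \<union> {b + 2 * M<..N + 2 * M})" using b(1) by auto
      then show ?thesis by (simp add: z) (subst sum.union_disjoint; auto intro!: sum.union_disjoint)
    qed
    also have "(\<Sum>k\<in>{b<..b + 2 * M}. g (\<xi> (int k)) * exp (- (u k - u (b + M)))) = 0"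
    proof (intro sum.neutral ballI)
      fix k assume "k \<in> {b<..b + 2 * M}"
      then obtain j where j: "k = b + 1 + j" "j < 2 * M" using le_Suc_ex[of "b + 1" k] by auto
      show "g (\<xi> (int k)) * exp (- (u k - u (b + M))) = 0" using gz[OF j(2)] by (simp add: j(1) add_ac)
    qed
    also have "(\<Sum>k\<in>{b + 2 * M<..N + 2 * M}. g (\<xi> (int k)) * exp (- (u k - u (b + M)))) =
        (\<Sum>k\<in>{b<..N}. g (\<xi> (cut M b (int k))) * exp (- (u (k + 2 * M) - u (b + M))))"
      by (rule sum.reindex_bij_witness[of _ "\<lambda>k. k + 2 * M" "\<lambda>k. k - 2 * M"]) (auto simp: cut_def of_nat_diff)
    also have "(\<Sum>k\<in>{1..b}. g (\<xi> (int k)) * exp (- (u k - u (b + M)))) + (0 +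
        (\<Sum>k\<in>{b<..N}. g (\<xi> (cut M b (int k))) * exp (- (u (k + 2 * M) - u (b + M))))) \<le>
        (\<Sum>k\<in>{1..b}. exp (- a * M) * (g (\<xi> (cut M b (int k))) * exp (- (v k - v b)))) +
        (\<Sum>k\<in>{b<..N}. exp (- a * M) * (g (\<xi> (cut M b (int k))) * exp (- (v k - v b))))"
    proof -
      have le: "g x * exp (- (u k' - u (b + M))) \<le> exp (- a * M) * (g x * exp (- (v k - v b)))"
        if "k \<le> b \<and> k' = k \<or> b \<le> k \<and> k' = k + 2 * M" for k k' x
      proof -
        have "exp (- (u k' - u (b + M))) \<le> exp (- a * M + - (v k - v b))" using far[OF that] by simp
        then have "g x * exp (- (u k' - u (b + M))) \<le> g x * exp (- a * M + - (v k - v b))"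
          by (rule mult_left_mono) (rule g_nonneg)
        then show ?thesis by (simp only: exp_add mult_ac)
      qed
      show ?thesis unfolding add_0_left
      proof (intro add_mono sum_mono)
        fix k assume "k \<in> {1..b}"
        then show "g (\<xi> (int k)) * exp (- (u k - u (b + M))) \<le> exp (- a * M) * (g (\<xi> (cut M b (int k))) * exp (- (v k - v b)))"
          using le[of k k "\<xi> (int k)"] by (simp add: cut_def)
      next
        fix k assume "k \<in> {b<..N}"
        then show "g (\<xi> (cut M b (int k))) * exp (- (u (k + 2 * M) - u (b + M))) \<le> exp (- a * M) * (g (\<xi> (cut M b (int k))) * exp (- (v k - v b)))"
          by (intro le) auto
      qed
    qed
    also have "\<dots> = exp (- a * M) * (\<Sum>k\<in>{1..N}. g (\<xi> (cut M b (int k))) * exp (- (v k - v b)))"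
    proof -
      have "{1..N} = {1..b} \<union> {b<..N}" using b(1) by auto
      then have "(\<Sum>k\<in>{1..N}. f k) = (\<Sum>k\<in>{1..b}. f k) + (\<Sum>k\<in>{b<..N}. f k)" for f :: "nat \<Rightarrow> real"
        by (simp only:) (rule sum.union_disjoint; auto)
      then show ?thesis by (simp only: sum_distrib_left distrib_left)
    qed
    also have "\<dots> \<le> C * exp (- a * M)" using sum by (simp add: mult.commute)
    finally show "(\<Sum>k\<in>{1..N + 2 * M}. g (snd z (0 + int k)) * exp (- (u k - u (b + M)))) \<le> C * exp (- a * M)" .
  next
    fix k assume k: "k \<in> {1..N + 2 * M}"
    consider "k \<le> b" | "b < k" "k \<le> b + 2 * M" | "b + 2 * M < k" by linarith
    then show "g (snd z (0 + int k)) \<le> exp (K * sqrt l)"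
    proof cases
      case 1
      then show ?thesis using sc[of k] k b(1) by (simp add: z cut_def)
    next
      case 2
      then obtain j where j: "k = b + 1 + j" "j < 2 * M" using le_Suc_ex[of "b + 1" k] by auto
      show ?thesis using gz[OF j(2)] by (simp add: z j(1) add_ac)
    next
      case 3
      then have "k - 2 * M \<in> {1..N}" using k by auto
      from sc[OF this] 3 show ?thesis by (simp add: z cut_def of_nat_diff)
    qed
  qed
qed

lemma prob_inserted:
  shows "inserted a M b \<in> sets Fields" "measure Fields (inserted a M b) = inserted_prob a M"
    "determined_by {int b<..int b + 2 * int M} (inserted a M b)"
proof -
  let ?W = "\<lambda>j. if j < M then {w. log_ratio w \<le> - a} else {w. a \<le> log_ratio w}"
  let ?A = "\<lambda>j :: nat. {z. fst z (int b + 1 + int j) \<in> ?W j \<and> snd z (int b + 1 + int j) \<in> {x. g x = 0}}"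
  have "{w \<in> space borel. log_ratio w \<le> - a} \<in> sets borel" "{w \<in> space borel. a \<le> log_ratio w} \<in> sets borel"
    "{x \<in> space borel. g x = 0} \<in> sets borel" by measurable
  then have m: "?W j \<in> sets borel" "{x. g x = 0} \<in> sets borel" for j by simp_all
  have iff: "z \<in> ?A j \<longleftrightarrow> g (snd z (int b + 1 + int j)) = 0 \<and>
     (if j < M then log_ratio (fst z (int b + 1 + int j)) \<le> - a else a \<le> log_ratio (fst z (int b + 1 + int j)))" for z j
    by auto
  have e: "inserted a M b = space Fields \<inter> (\<Inter>j\<in>{..<2 * M}. ?A j)"
    unfolding set_eq_iff inserted_def Int_iff INT_iff iff by (simp add: space_Fields Ball_def)
  have A: "?A j \<in> sets Fields" for j using prob_single_site(1)[OF m] .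
  show "inserted a M b \<in> sets Fields" unfolding e using A by (cases "M = 0") auto
  show "measure Fields (inserted a M b) = inserted_prob a M"
  proof (cases "M = 0")
    case True
    then show ?thesis using ES.prob_space by (simp add: inserted_def inserted_prob_def space_Fields)
  next
    case False
    have "measure Fields (\<Inter>j\<in>{..<2 * M}. ?A j) = (\<Prod>j<2 * M. measure Fields (?A j))"
    proof (rule prob_INT_determined[where K = "\<lambda>j. {int b + 1 + int j}"])
      show "determined_by {int b + 1 + int j} (?A j)" for j by (rule determined_byI) auto
    qed (use False A in \<open>auto simp: disjoint_family_on_def lessThan_empty_iff\<close>)
    also have "\<dots> = inserted_prob a M" unfolding inserted_prob_def by (intro prod.cong refl prob_single_site(2) m)
    finally show ?thesis unfolding e by (simp add: space_Fields)
  qed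
  show "determined_by {int b<..int b + 2 * int M} (inserted a M b)"
  proof (rule determined_byI)
    fix \<omega> \<omega>' \<xi> \<xi>' :: "int \<Rightarrow> real"
    assume eq: "\<And>i. i \<in> {int b<..int b + 2 * int M} \<Longrightarrow> \<omega> i = \<omega>' i \<and> \<xi> i = \<xi>' i" and z: "(\<omega>, \<xi>) \<in> inserted a M b"
    have "\<omega>' (int b + 1 + int j) = \<omega> (int b + 1 + int j) \<and> \<xi>' (int b + 1 + int j) = \<xi> (int b + 1 + int j)" if "j < 2 * M" for j
      using eq[of "int b + 1 + int j"] that by auto
    note same = this
    show "(\<omega>', \<xi>') \<in> inserted a M b"
      unfolding inserted_def mem_Collect_eq fst_conv snd_conv
    proof (intro allI impI)
      fix j assume j: "j < 2 * M"
      then show "g (\<xi>' (int b + 1 + int j)) = 0 \<and> (if j < M then log_ratio (\<omega>' (int b + 1 + int j)) \<le> - a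
          else a \<le> log_ratio (\<omega>' (int b + 1 + int j)))"
        using z[unfolded inserted_def mem_Collect_eq fst_conv snd_conv, rule_format, OF j] same[OF j] by simp
    qed
  qed
qed

text \<open>An insertion at a given site \<open>b\<close> costs the constant factor \<open>inserted_prob a M\<close>.  For different
  \<open>b\<close> the resulting events are disjoint, since the bottom \<open>b + M\<close> is the only minimum of the
  potential.  So no probability is lost in the sum over \<open>b\<close>, although the number of possible \<open>b\<close>
  grows with \<open>l\<close>.\<close>

lemma prob_right_valley_ge:
  fixes a :: real and M :: nat
  assumes l: "0 < l" "1 \<le> K" "0 < a" "0 < M" "0 \<le> C"
  shows "inserted_prob a M * measure Fields (pre_valley r l K C) \<le>
    measure Fields (right_valley 0 (2 * r * l + 2 * M) (sqrt l) K (r * \<sigma>) (C * exp (- a * M)))"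
proof -
  define N where "N = 2 * r * l"
  define Good where "Good b = pre_valley r l K C \<inter> {z. \<forall>i\<le>N. forward_path (fst z) 0 b \<le> forward_path (fst z) 0 i}" for b
  have Good: "Good b \<in> sets Fields" for b
  proof -
    have "{z \<in> space Fields. \<forall>i\<le>N. forward_path (fst z) 0 b \<le> forward_path (fst z) 0 i} \<in> sets Fields" by measurable
    then show ?thesis using sets_pre_valley by (simp add: Good_def space_Fields)
  qed
  define Ev where "Ev b = remove_block M b -` Good b \<inter> inserted a M b" for b
  have vim: "remove_block M b -` Good b \<in> sets Fields" "measure Fields (remove_block M b -` Good b) = measure Fields (Good b)" for b
    unfolding remove_block_def by (rule prob_Fields_reindex[OF inj_cut Good])+
  have det: "determined_by (- {int b<..int b + 2 * int M}) (remove_block M b -` Good b)" for b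
  proof (rule determined_byI)
    fix \<omega> \<omega>' \<xi> \<xi>' :: "int \<Rightarrow> real"
    assume eq: "\<And>i. i \<in> - {int b<..int b + 2 * int M} \<Longrightarrow> \<omega> i = \<omega>' i \<and> \<xi> i = \<xi>' i" and z: "(\<omega>, \<xi>) \<in> remove_block M b -` Good b"
    have "cut M b i \<in> - {int b<..int b + 2 * int M}" for i by (auto simp: cut_def)
    then have "remove_block M b (\<omega>', \<xi>') = remove_block M b (\<omega>, \<xi>)" using eq by (simp add: remove_block_def)
    with z show "(\<omega>', \<xi>') \<in> remove_block M b -` Good b" by simp
  qed
  have Ev: "Ev b \<in> sets Fields" "measure Fields (Ev b) = measure Fields (Good b) * inserted_prob a M" for b
  proof -
    show "Ev b \<in> sets Fields" unfolding Ev_def using vim prob_inserted(1) by auto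
    show "measure Fields (Ev b) = measure Fields (Good b) * inserted_prob a M"
      unfolding Ev_def prob_inserted(2)[where a = a and M = M and b = b, symmetric] vim(2)[symmetric, of b]
      by (rule prob_Int_determined[OF vim(1) prob_inserted(1) det prob_inserted(3)]) auto
  qed
  have props: "z \<in> right_valley 0 (N + 2 * M) (sqrt l) K (r * \<sigma>) (C * exp (- a * M))"
    "\<And>k. k \<le> N + 2 * M \<Longrightarrow> k \<noteq> b + M \<Longrightarrow> forward_path (fst z) 0 (b + M) < forward_path (fst z) 0 k"
    if "z \<in> Ev b" "b \<le> N" for z b
    using valley_after_insertion[of M b z r l K C a] that l by (auto simp: Ev_def Good_def N_def)
  have disj: "disjoint_family_on Ev {..N}"
    unfolding disjoint_family_on_def
  proof (intro ballI impI equals0I)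
    fix b b' z assume b: "b \<in> {..N}" "b' \<in> {..N}" "b \<noteq> b'" and z: "z \<in> Ev b \<inter> Ev b'"
    have "forward_path (fst z) 0 (b + M) < forward_path (fst z) 0 (b' + M)" using props(2)[of z b "b' + M"] b z by auto
    moreover have "forward_path (fst z) 0 (b' + M) < forward_path (fst z) 0 (b + M)" using props(2)[of z b' "b + M"] b z by auto
    ultimately show False by simp
  qed
  have "pre_valley r l K C \<subseteq> (\<Union>b\<in>{..N}. Good b)"
  proof
    fix z assume z: "z \<in> pre_valley r l K C"
    obtain b where "b \<in> {..N}" "\<forall>i\<in>{..N}. forward_path (fst z) 0 b \<le> forward_path (fst z) 0 i"
      using ex_min_if_finite[of "forward_path (fst z) 0 ` {..N}"] by (force simp: not_less)
    with z show "z \<in> (\<Union>b\<in>{..N}. Good b)" by (auto simp: Good_def)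
  qed
  then have "measure Fields (pre_valley r l K C) \<le> measure Fields (\<Union>b\<in>{..N}. Good b)"
    using Good by (intro ES.finite_measure_mono) auto
  also have "\<dots> \<le> (\<Sum>b\<in>{..N}. measure Fields (Good b))"
    using Good by (intro ES.finite_measure_subadditive_finite) auto
  finally have "inserted_prob a M * measure Fields (pre_valley r l K C) \<le> inserted_prob a M * (\<Sum>b\<in>{..N}. measure Fields (Good b))"
    by (rule mult_left_mono) (auto simp: inserted_prob_def intro!: prod_nonneg)
  also have "\<dots> = (\<Sum>b\<in>{..N}. measure Fields (Ev b))" by (simp add: sum_distrib_left Ev(2) mult.commute)
  also have "\<dots> = measure Fields (\<Union>b\<in>{..N}. Ev b)"
    using Ev(1) disj by (intro ES.finite_measure_finite_Union[symmetric]) auto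
  also have "\<dots> \<le> measure Fields (right_valley 0 (N + 2 * M) (sqrt l) K (r * \<sigma>) (C * exp (- a * M)))"
    using props(1) by (intro ES.finite_measure_mono sets_right_valley) auto
  finally show ?thesis by (simp add: N_def)
qed

lemma step_bound_exists:
  "\<exists>a>0. 0 < measure \<mu> {w. log_ratio w \<le> - a} \<and> 0 < measure \<mu> {w. a \<le> log_ratio w}"
proof -
  obtain a1 where a1: "0 < a1" "0 < measure (distr \<mu> borel log_ratio) {y. a1 \<le> y}" using Up.positive_step by auto
  obtain a2 where a2: "0 < a2" "0 < measure (distr \<mu> borel (\<lambda>w. - log_ratio w)) {y. a2 \<le> y}" using Down.positive_step by auto
  have m: "{w. x \<le> log_ratio w} \<in> sets \<mu>" "{w. log_ratio w \<le> x} \<in> sets \<mu>" for x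
  proof -
    have "{w \<in> space borel. x \<le> log_ratio w} \<in> sets borel" "{w \<in> space borel. log_ratio w \<le> x} \<in> sets borel" by measurable
    then show "{w. x \<le> log_ratio w} \<in> sets \<mu>" "{w. log_ratio w \<le> x} \<in> sets \<mu>" by (simp_all add: sets_env)
  qed
  have "measure (distr \<mu> borel log_ratio) {y. a1 \<le> y} = measure \<mu> {w. a1 \<le> log_ratio w}"
    by (subst measure_distr) (auto simp: space_env vimage_def)
  also have "\<dots> \<le> measure \<mu> {w. min a1 a2 \<le> log_ratio w}" using m by (intro E0.finite_measure_mono) auto
  finally have 1: "0 < measure \<mu> {w. min a1 a2 \<le> log_ratio w}" using a1 by simp
  have "measure (distr \<mu> borel (\<lambda>w. - log_ratio w)) {y. a2 \<le> y} = measure \<mu> {w. log_ratio w \<le> - a2}"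
    by (subst measure_distr) (auto simp: space_env vimage_def intro!: arg_cong[where f = "measure \<mu>"])
  also have "\<dots> \<le> measure \<mu> {w. log_ratio w \<le> - min a1 a2}" using m by (intro E0.finite_measure_mono) auto
  finally have 2: "0 < measure \<mu> {w. log_ratio w \<le> - min a1 a2}" using a2 by simp
  show ?thesis using 1 2 a1 a2 by (intro exI[of _ "min a1 a2"]) auto
qed

text \<open>The constant \<open>C\<close> of tightness is uniform in \<open>l\<close>.  Hence \<open>M\<close> can be chosen after \<open>C\<close> and before
  \<open>l\<close>, and so does not depend on \<open>l\<close> either.\<close>
proposition prob_right_valley:
  assumes B: "block_bound p K" and \<kappa>: "0 < \<kappa>"
  obtains M p' where "0 < p'" "\<forall>\<^sub>F l in sequentially. \<forall>m. p' \<le> measure Fields (right_valley m (2 * r * l + 2 * M) (sqrt l) K (r * \<sigma>) \<kappa>)"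
proof -
  obtain C where C: "1 \<le> C" "\<forall>\<^sub>F l in sequentially. p ^ (2 * r) / 2 \<le> measure Fields (pre_valley r l K C)"
    by (rule prob_pre_valley[OF B])
  obtain a where a: "0 < a" "0 < measure \<mu> {w. log_ratio w \<le> - a}" "0 < measure \<mu> {w. a \<le> log_ratio w}"
    using step_bound_exists by auto
  have "((\<lambda>M :: nat. C * exp (- a * M)) \<longlongrightarrow> 0) sequentially" using a(1) by real_asymp
  then have "\<forall>\<^sub>F M :: nat in sequentially. C * exp (- a * M) < \<kappa>" using \<kappa> by (rule order_tendstoD(2))
  then have "\<forall>\<^sub>F M :: nat in sequentially. C * exp (- a * M) < \<kappa> \<and> 0 < M"
    using eventually_gt_at_top[of 0] by eventually_elim auto
  then obtain M :: nat where M: "C * exp (- a * M) < \<kappa>" "0 < M" by (auto simp: eventually_at_top_linorder)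
  have \<theta>: "0 < inserted_prob a M" unfolding inserted_prob_def using a g_zero by (intro prod_pos) auto
  have p: "0 < p" "1 \<le> K" using B by (auto simp: block_bound_def)
  show thesis
  proof (rule that[of "inserted_prob a M * (p ^ (2 * r) / 2)" M])
    show "0 < inserted_prob a M * (p ^ (2 * r) / 2)" using \<theta> p by simp
    show "\<forall>\<^sub>F l in sequentially. \<forall>m. inserted_prob a M * (p ^ (2 * r) / 2) \<le> measure Fields (right_valley m (2 * r * l + 2 * M) (sqrt l) K (r * \<sigma>) \<kappa>)"
      using C(2) eventually_gt_at_top[of 0]
    proof eventually_elim
      case (elim l)
      have "inserted_prob a M * (p ^ (2 * r) / 2) \<le> inserted_prob a M * measure Fields (pre_valley r l K C)" using elim \<theta> by (intro mult_left_mono) auto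
      also have "\<dots> \<le> measure Fields (right_valley 0 (2 * r * l + 2 * M) (sqrt l) K (r * \<sigma>) (C * exp (- a * M)))"
        using elim p a M C(1) by (intro prob_right_valley_ge) auto
      also have "\<dots> \<le> measure Fields (right_valley 0 (2 * r * l + 2 * M) (sqrt l) K (r * \<sigma>) \<kappa>)"
      proof (rule ES.finite_measure_mono[OF subsetI sets_right_valley])
        fix z assume "z \<in> right_valley 0 (2 * r * l + 2 * M) (sqrt l) K (r * \<sigma>) (C * exp (- a * M))"
        then show "z \<in> right_valley 0 (2 * r * l + 2 * M) (sqrt l) K (r * \<sigma>) \<kappa>"
          using M(1) unfolding right_valley_def right_ok_def mem_Collect_eq by (meson order_trans less_imp_le)
      qed
      finally show ?case by (intro allI) (subst prob_right_valley_shift)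
    qed
  qed
qed

end

section \<open>The walk in a valley\<close>

lemma measurable_quenched_position: "(\<lambda>X. f (X i) :: real) \<in> borel_measurable (quenched_law \<omega>)"
proof -
  have "(\<lambda>X. X i) \<in> trajectories \<rightarrow>\<^sub>M count_space UNIV" by simp
  from measurable_compose[OF this, of f borel] have "(\<lambda>X. f (X i)) \<in> borel_measurable trajectories" by simp
  then show ?thesis by (simp only: measurable_cong_sets[OF sets_quenched_law refl])
qed

lemma sets_quenched_cost:
  "{X \<in> space (quenched_law \<omega>). a \<le> (\<Sum>i<n. f (X i) :: real)} \<in> sets (quenched_law \<omega>)"
  by (intro borel_measurable_le borel_measurable_const borel_measurable_sum measurable_quenched_position)

lemma sets_quenched_exit:
  "{X \<in> space (quenched_law \<omega>). \<exists>i\<le>n. X i \<notin> D} \<in> sets (quenched_law \<omega>)"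
proof -
  have "{X \<in> space (quenched_law \<omega>). X i \<notin> D} \<in> sets (quenched_law \<omega>)" for i
  proof -
    have "{X \<in> space (quenched_law \<omega>). 0 < (if X i \<in> D then 0 else 1 :: real)} \<in> sets (quenched_law \<omega>)"
      by (intro borel_measurable_less borel_measurable_const measurable_quenched_position[where f = "\<lambda>x. if x \<in> D then 0 else 1"])
    also have "{X \<in> space (quenched_law \<omega>). 0 < (if X i \<in> D then 0 else 1 :: real)} = {X \<in> space (quenched_law \<omega>). X i \<notin> D}" by auto
    finally show ?thesis .
  qed
  then have "(\<Union>i\<in>{..n}. {X \<in> space (quenched_law \<omega>). X i \<notin> D}) \<in> sets (quenched_law \<omega>)" by (intro sets.finite_UN) auto
  also have "(\<Union>i\<in>{..n}. {X \<in> space (quenched_law \<omega>). X i \<notin> D}) = {X \<in> space (quenched_law \<omega>). \<exists>i\<le>n. X i \<notin> D}" by auto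
  finally show ?thesis .
qed

text \<open>The walk is reversible with respect to \<open>step_weight\<close>; by ellipticity the two summands of the
  weight are comparable.\<close>
lemma (in sinai_environment) environment_weight:
  assumes \<omega>: "\<And>x. \<delta> \<le> \<omega> x \<and> \<omega> x \<le> 1 - \<delta>"
  shows "\<omega> x = exp (- potential \<omega> x) / step_weight (potential \<omega>) x"
    and "step_weight (potential \<omega>) x \<le> (1 + exp c) * exp (- potential \<omega> x)"
proof -
  have w: "0 < \<omega> x" "\<omega> x < 1" using \<omega>[of x] \<delta> by auto
  have e: "potential \<omega> (x - 1) = potential \<omega> x - log_ratio (\<omega> x)" using potential_step[of \<omega> x] by simp
  have sw: "step_weight (potential \<omega>) x = exp (- potential \<omega> x) * (1 + exp (log_ratio (\<omega> x)))"
    unfolding step_weight_def e by (simp add: algebra_simps flip: exp_add)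
  have "1 + exp (log_ratio (\<omega> x)) = 1 / \<omega> x"
    using w by (simp add: log_ratio_def field_simps)
  then show "\<omega> x = exp (- potential \<omega> x) / step_weight (potential \<omega>) x" unfolding sw using w by simp
  have "log_ratio (\<omega> x) \<le> c" using log_ratio_le[of "\<omega> x"] \<omega>[of x] by auto
  then have "1 + exp (log_ratio (\<omega> x)) \<le> 1 + exp c" by simp
  then show "step_weight (potential \<omega>) x \<le> (1 + exp c) * exp (- potential \<omega> x)"
    unfolding sw by (simp add: mult.commute mult_right_mono)
qed

lemma (in sinai_environment) AE_elliptic: "AE z in Fields. \<forall>x. \<delta> \<le> fst z x \<and> fst z x \<le> 1 - \<delta>"
proof (subst AE_all_countable, intro allI)
  fix x :: int
  have "AE \<omega> in Env. \<delta> \<le> \<omega> x \<and> \<omega> x \<le> 1 - \<delta>"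
    using elliptic by (intro AE_PiM_component) (auto intro: E0.prob_space_axioms)
  then have "AE \<omega> in distr Fields Env fst. \<delta> \<le> \<omega> x \<and> \<omega> x \<le> 1 - \<delta>" unfolding S.distr_pair_fst .
  then show "AE z in Fields. \<delta> \<le> fst z x \<and> fst z x \<le> 1 - \<delta>" by (rule AE_distrD[rotated]) simp
qed

text \<open>All heights are measured in units of \<open>T\<close>.  To reach \<open>b\<close> the walk climbs at most \<open>6 * T\<close> at
  once, and a step costs at most \<open>exp T\<close>; so what it pays before it reaches \<open>b\<close> is of order
  \<open>exp (7 * T)\<close>.  The walls are at least \<open>10 * T\<close> above the bottom.  The time \<open>n\<close>, of order
  \<open>exp (8 * T)\<close>, lies in between: it is long enough to make the first cost negligible, and too
  short to leave.\<close>

lemma (in sinai_environment) walk_in_valley: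
  fixes V G :: "int \<Rightarrow> real" and lo hi b m :: int and n :: nat and \<eta> \<kappa> T \<Lambda> :: real
  assumes \<omega>: "\<And>x. \<delta> \<le> \<omega> x \<and> \<omega> x \<le> 1 - \<delta>"
  defines "V \<equiv> potential \<omega>" and "a \<equiv> 1 + exp c" and "W \<equiv> real_of_int (hi - lo)"
  assumes G: "\<And>x. 0 \<le> G x" and order: "lo < 0" "0 \<le> m" "m \<le> b" "b < hi"
    and T: "0 \<le> T" "10 * T \<le> \<Lambda>" and \<eta>: "0 < \<eta>"
    and climb: "\<And>x y. lo \<le> x \<Longrightarrow> x \<le> y \<Longrightarrow> y \<le> b \<Longrightarrow> V y - V x \<le> 6 * T"
    and high: "\<And>x. 0 \<le> x \<Longrightarrow> x \<le> b \<Longrightarrow> V x \<le> 3 * T"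
    and walls: "\<Lambda> - T \<le> V lo" "\<Lambda> \<le> V (hi - 1) - V b" and bottom: "V b \<le> T - \<Lambda>"
    and low: "\<And>x. lo < x \<Longrightarrow> x \<le> m \<Longrightarrow> - 3 * T \<le> V x"
    and G_le: "\<And>x. lo < x \<Longrightarrow> x < hi \<Longrightarrow> G x \<le> exp T"
    and G_sum: "(\<Sum>z\<in>{m<..<hi}. G z * exp (- (V z - V b))) \<le> \<kappa>"
    and n: "exp (8 * T) \<le> n" "n \<le> 2 * exp (8 * T)"
  shows "emeasure (quenched_law \<omega>) {X \<in> space (quenched_law \<omega>). (\<exists>i\<le>n. X i \<notin> {lo<..<hi}) \<or> \<eta> * n \<le> (\<Sum>i<n. G (X i))}
    \<le> ennreal (exp (- T) * (W\<^sup>2 * (1 + 2 * a / \<eta>) + 4) + a * \<kappa> / \<eta>)"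
proof -
  \<comment> \<open>These boundary currents lift \<open>F\<close> to \<open>\<eta> * n\<close> outside the valley.\<close>
  define jl where "jl = \<eta> * n * exp (- V lo)"
  define jr where "jr = \<eta> * n * exp (- V (hi - 1))"
  define F where "F x = poisson_left V G lo jl b x + poisson_right V G hi jr b x" for x
  define S where "S = (\<Sum>z\<in>{lo<..<hi}. step_weight V z * G z)"
  define \<theta> where "\<theta> = (jl + jr + S) / step_weight V b"
  have n0: "0 < real n" using n(1) by (smt (verit) exp_gt_zero)
  have a: "0 < a" by (simp add: a_def add_pos_pos)
  have W1: "1 \<le> W" using order by (simp add: W_def)
  have WW: "W \<le> W\<^sup>2" using W1 by (simp add: power2_eq_square)
  have \<omega>01: "0 \<le> \<omega> x" "\<omega> x \<le> 1" for x using \<omega>[of x] \<delta> by auto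
  have p: "\<omega> x = exp (- V x) / step_weight V x" for x
    unfolding V_def by (rule environment_weight(1)) (rule \<omega>)
  have sw: "step_weight V x \<le> a * exp (- V x)" for x
    unfolding V_def a_def by (rule environment_weight(2)) (rule \<omega>)
  have jl0: "0 \<le> jl" and jr0: "0 \<le> jr" using \<eta> by (auto simp: jl_def jr_def)
  have S0: "0 \<le> S" unfolding S_def using step_weight_pos[of V] G
    by (intro sum_nonneg mult_nonneg_nonneg) (auto simp: less_imp_le)
  have F0: "0 \<le> F x" for x using poisson_nonneg[OF G jl0] poisson_nonneg[OF G jr0] by (simp add: F_def)
  have \<theta>0: "0 \<le> \<theta>" using jl0 jr0 S0 step_weight_pos[of V b] by (simp add: \<theta>_def)
  have lob: "lo < b" using order by simp
  have drift: "\<omega> x * F (x + 1) + (1 - \<omega> x) * F (x - 1) + G x \<le> F x + \<theta>" if "x \<in> {lo<..<hi}" for x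
    unfolding F_def \<theta>_def S_def using that lob order(4) G jl0 jr0 by (intro poisson_drift p) auto
  have out: "\<eta> * n \<le> F x" if "x \<notin> {lo<..<hi}" for x
  proof (cases "x \<le> lo")
    case True
    have "\<eta> * n = jl * exp (V lo)" by (simp add: jl_def flip: exp_add)
    also have "\<dots> \<le> poisson_left V G lo jl b x" using True lob G jl0 by (intro poisson_left_ge) auto
    finally show ?thesis using poisson_nonneg(2)[where g = G and j = jr and V = V and hi = hi and b = b and x = x, OF G jr0] by (simp add: F_def)
  next
    case False
    have "\<eta> * n = jr * exp (V (hi - 1))" by (simp add: jr_def flip: exp_add)
    also have "\<dots> \<le> poisson_right V G hi jr b x" using False that order G jr0 by (intro poisson_right_ge) auto
    finally show ?thesis using poisson_nonneg(1)[where g = G and j = jl and V = V and lo = lo and b = b and x = x, OF G jl0] by (simp add: F_def)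
  qed
  have \<eta>n: "0 < \<eta> * n" using \<eta> n0 by simp
  have bound: "emeasure (quenched_law \<omega>) {X \<in> space (quenched_law \<omega>). (\<exists>i\<le>n. X i \<notin> {lo<..<hi}) \<or> \<eta> * n \<le> (\<Sum>i<n. G (X i))}
      \<le> ennreal ((F 0 + \<theta> * n) / (\<eta> * n))"
    by (rule quenched_stopped_bound[OF F0 G \<theta>0 \<omega>01 drift \<eta>n out])
  \<comment> \<open>What is paid before the bottom is reached.\<close>
  have F_start: "F 0 \<le> W * (\<eta> * n * exp (- 6 * T) + W * (a * exp (7 * T)))"
  proof -
    have card: "real (card {0..<b}) \<le> W" using order by (simp add: W_def)
    have summand: "flux_left V G lo jl y * exp (V y) \<le> \<eta> * n * exp (- 6 * T) + W * (a * exp (7 * T))" if y: "y \<in> {0..<b}" for y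
    proof -
      have Vy: "V y \<le> 3 * T" using y by (intro high) auto
      have "exp (- V lo) * exp (V y) \<le> exp (- 6 * T)" unfolding exp_add[symmetric] using Vy walls(1) T by simp
      from mult_left_mono[OF this, of "\<eta> * n"] have 1: "jl * exp (V y) \<le> \<eta> * n * exp (- 6 * T)"
        using \<eta>n by (simp add: jl_def mult.assoc)
      have "(\<Sum>z\<in>{lo<..y}. step_weight V z * G z * exp (V y)) \<le> (\<Sum>z\<in>{lo<..y}. a * exp (7 * T))"
      proof (rule sum_mono)
        fix z assume z: "z \<in> {lo<..y}"
        have "step_weight V z * G z * exp (V y) \<le> (a * exp (- V z)) * exp T * exp (V y)"
          using z y order G a by (intro mult_right_mono mult_mono sw G_le) auto
        also have "\<dots> = a * exp (T + (V y - V z))" by (simp add: exp_add exp_diff exp_minus field_simps)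
        also have "\<dots> \<le> a * exp (7 * T)" using climb[of z y] z y a by simp
        finally show "step_weight V z * G z * exp (V y) \<le> a * exp (7 * T)" .
      qed
      also have "\<dots> = real (card {lo<..y}) * (a * exp (7 * T))" by simp
      also have "\<dots> \<le> W * (a * exp (7 * T))" using y order a by (intro mult_right_mono) (auto simp: W_def)
      finally have 2: "(\<Sum>z\<in>{lo<..y}. step_weight V z * G z * exp (V y)) \<le> W * (a * exp (7 * T))" .
      show ?thesis using 1 2 by (simp add: flux_left_def distrib_right sum_distrib_right)
    qed
    have "F 0 = poisson_left V G lo jl b 0" using order by (simp add: F_def poisson_right_def)
    also have "\<dots> \<le> real (card {0..<b}) * (\<eta> * n * exp (- 6 * T) + W * (a * exp (7 * T)))"
      unfolding poisson_left_def using summand by (rule sum_bounded_above)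
    also have "\<dots> \<le> W * (\<eta> * n * exp (- 6 * T) + W * (a * exp (7 * T)))"
      using card \<eta>n a W1 by (intro mult_right_mono add_nonneg_nonneg) auto
    finally show ?thesis .
  qed
  have F_part: "F 0 / (\<eta> * n) \<le> exp (- T) * (W\<^sup>2 * (1 + a / \<eta>))"
  proof -
    have "F 0 / (\<eta> * n) \<le> W * (\<eta> * n * exp (- 6 * T) + W * (a * exp (7 * T))) / (\<eta> * n)"
      using F_start \<eta>n by (intro divide_right_mono) auto
    also have "\<dots> = W * exp (- 6 * T) + W\<^sup>2 * a / \<eta> * (exp (7 * T) / n)"
      using \<eta> n0 by (simp add: field_simps power2_eq_square)
    also have "\<dots> \<le> W\<^sup>2 * exp (- T) + W\<^sup>2 * a / \<eta> * exp (- T)"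
    proof (intro add_mono mult_mono mult_left_mono)
      have "exp (7 * T) \<le> exp (- T) * n"
        using mult_left_mono[OF n(1), of "exp (- T)"] by (simp flip: exp_add)
      then show "exp (7 * T) / n \<le> exp (- T)" using n0 by (simp add: field_simps)
    qed (use WW T a \<eta> in auto)
    also have "\<dots> = exp (- T) * (W\<^sup>2 * (1 + a / \<eta>))" by (simp add: algebra_simps)
    finally show ?thesis .
  qed
  \<comment> \<open>What is paid per step at the bottom: the sites up to \<open>m\<close> and both walls are so far above \<open>b\<close>
    that they contribute multiples of \<open>exp (- T)\<close> only, and the rest is bounded by \<open>\<kappa>\<close>.\<close>
  have \<theta>_part: "\<theta> / \<eta> \<le> exp (- T) * (W\<^sup>2 * (a / \<eta>) + 4) + a * \<kappa> / \<eta>"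
  proof -
    have inv: "1 / step_weight V b \<le> exp (V b)"
    proof -
      have "exp (- V b) \<le> step_weight V b" by (simp add: step_weight_def)
      then have "1 / step_weight V b \<le> 1 / exp (- V b)" by (intro divide_left_mono) (auto simp: step_weight_pos)
      then show ?thesis by (simp add: exp_minus field_simps)
    qed
    have "\<theta> = (jl + jr + S) * (1 / step_weight V b)" by (simp add: \<theta>_def)
    also have "\<dots> \<le> (jl + jr + S) * exp (V b)" using inv jl0 jr0 S0 by (intro mult_left_mono) auto
    also have "\<dots> = jl * exp (V b) + jr * exp (V b) + S * exp (V b)" by (simp add: algebra_simps)
    also have "\<dots> \<le> \<eta> * (2 * exp (- T)) + \<eta> * (2 * exp (- T)) + (W\<^sup>2 * a * exp (- T) + a * \<kappa>)"
    proof (intro add_mono)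
      have far: "real n * exp x \<le> 2 * exp (- T)" if "x \<le> - 10 * T" for x
      proof -
        have "real n * exp x \<le> (2 * exp (8 * T)) * exp (- 10 * T)" using n(2) that by (intro mult_mono) auto
        also have "\<dots> = 2 * exp (- 2 * T)" by (simp flip: exp_add)
        also have "\<dots> \<le> 2 * exp (- T)" using T by simp
        finally show ?thesis .
      qed
      have "jl * exp (V b) = \<eta> * (n * exp (V b - V lo))" by (simp add: jl_def exp_diff exp_minus field_simps)
      also have "\<dots> \<le> \<eta> * (2 * exp (- T))" using walls(1) bottom T \<eta> by (intro mult_left_mono far) auto
      finally show "jl * exp (V b) \<le> \<eta> * (2 * exp (- T))" .
      have "jr * exp (V b) = \<eta> * (n * exp (V b - V (hi - 1)))" by (simp add: jr_def exp_diff exp_minus field_simps)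
      also have "\<dots> \<le> \<eta> * (2 * exp (- T))" using walls(2) T \<eta> by (intro mult_left_mono far) auto
      finally show "jr * exp (V b) \<le> \<eta> * (2 * exp (- T))" .
      have split: "{lo<..<hi} = {lo<..m} \<union> {m<..<hi}" using order by auto
      have "S * exp (V b) = (\<Sum>z\<in>{lo<..m}. step_weight V z * G z * exp (V b)) + (\<Sum>z\<in>{m<..<hi}. step_weight V z * G z * exp (V b))"
        unfolding S_def sum_distrib_right split by (rule sum.union_disjoint) auto
      also have "\<dots> \<le> (\<Sum>z\<in>{lo<..m}. a * exp (- T)) + (\<Sum>z\<in>{m<..<hi}. a * (G z * exp (- (V z - V b))))"
      proof (intro add_mono sum_mono)
        fix z assume z: "z \<in> {lo<..m}"
        have "step_weight V z * G z * exp (V b) \<le> (a * exp (- V z)) * exp T * exp (V b)"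
          using z order G a by (intro mult_right_mono mult_mono sw G_le) auto
        also have "\<dots> = a * exp (T + (V b - V z))" by (simp add: exp_add exp_diff exp_minus field_simps)
        also have "\<dots> \<le> a * exp (- T)" using low[of z] bottom z a T by simp
        finally show "step_weight V z * G z * exp (V b) \<le> a * exp (- T)" .
      next
        fix z assume z: "z \<in> {m<..<hi}"
        have "step_weight V z * G z * exp (V b) \<le> (a * exp (- V z)) * G z * exp (V b)"
          using G by (intro mult_right_mono sw) auto
        also have "\<dots> = a * (G z * exp (- (V z - V b)))" by (simp add: exp_diff exp_minus field_simps)
        finally show "step_weight V z * G z * exp (V b) \<le> a * (G z * exp (- (V z - V b)))" .
      qed
      also have "\<dots> \<le> W\<^sup>2 * a * exp (- T) + a * \<kappa>"
      proof (rule add_mono)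
        have "(\<Sum>z\<in>{lo<..m}. a * exp (- T)) = real (card {lo<..m}) * (a * exp (- T))" by simp
        also have "\<dots> \<le> W\<^sup>2 * (a * exp (- T))" using order a WW by (intro mult_right_mono order_trans[OF _ WW]) (auto simp: W_def)
        finally show "(\<Sum>z\<in>{lo<..m}. a * exp (- T)) \<le> W\<^sup>2 * a * exp (- T)" by (simp add: mult.assoc)
        show "(\<Sum>z\<in>{m<..<hi}. a * (G z * exp (- (V z - V b)))) \<le> a * \<kappa>"
          unfolding sum_distrib_left[symmetric] using G_sum a by (intro mult_left_mono) auto
      qed
      finally show "S * exp (V b) \<le> W\<^sup>2 * a * exp (- T) + a * \<kappa>" .
    qed
    finally have "\<theta> / \<eta> \<le> (\<eta> * (2 * exp (- T)) + \<eta> * (2 * exp (- T)) + (W\<^sup>2 * a * exp (- T) + a * \<kappa>)) / \<eta>"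
      using \<eta> by (intro divide_right_mono) auto
    also have "\<dots> = exp (- T) * (W\<^sup>2 * (a / \<eta>) + 4) + a * \<kappa> / \<eta>" using \<eta> by (simp add: field_simps)
    finally show ?thesis .
  qed
  have "(F 0 + \<theta> * n) / (\<eta> * n) = F 0 / (\<eta> * n) + \<theta> / \<eta>" using n0 \<eta> by (simp add: field_simps)
  also have "\<dots> \<le> exp (- T) * (W\<^sup>2 * (1 + a / \<eta>)) + (exp (- T) * (W\<^sup>2 * (a / \<eta>) + 4) + a * \<kappa> / \<eta>)"
    using F_part \<theta>_part by (rule add_mono)
  also have "\<dots> = exp (- T) * (W\<^sup>2 * (1 + 2 * a / \<eta>) + 4) + a * \<kappa> / \<eta>" by (simp add: algebra_simps)
  finally show ?thesis using bound by (meson ennreal_leI order_trans)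
qed

context sinai_scenery
begin

lemma potential_lipschitz:
  assumes \<omega>: "\<And>x. \<delta> \<le> \<omega> x \<and> \<omega> x \<le> 1 - \<delta>"
  shows "\<bar>potential \<omega> x\<bar> \<le> c * \<bar>real_of_int x\<bar>"
proof -
  have l: "\<bar>log_ratio (\<omega> i)\<bar> \<le> c" for i using log_ratio_le \<omega> by blast
  have s: "\<bar>\<Sum>i<k. f i\<bar> \<le> real k * c" if "\<And>i. \<bar>f i\<bar> \<le> c" for f :: "nat \<Rightarrow> real" and k
  proof -
    have "\<bar>\<Sum>i<k. f i\<bar> \<le> (\<Sum>i<k. \<bar>f i\<bar>)" by (rule sum_abs)
    also have "\<dots> \<le> real (card {..<k}) * c" using that by (intro sum_bounded_above) auto
    finally show ?thesis by simp
  qed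
  show ?thesis
  proof (cases "0 \<le> x")
    case True
    then obtain k where "x = int k" using nonneg_int_cases by blast
    then show ?thesis using potential_forward[of \<omega> 0 k] s[of "\<lambda>i. log_ratio (\<omega> (0 + 1 + int i))" k] l by (simp add: mult.commute)
  next
    case False
    then obtain k where "x = - int k" by (intro that[of "nat (- x)"]) simp
    then show ?thesis using potential_backward[of \<omega> 0 k] s[of "\<lambda>i. - log_ratio (\<omega> (0 - int i))" k] l by (simp add: mult.commute)
  qed
qed

text \<open>Between the left and the right part of the valley lies the interval from \<open>- m\<close> to \<open>m\<close>, which
  belongs to smaller scales.  By ellipticity the potential is at most \<open>c * m\<close> there, and the
  scale \<open>h\<close> is so large that this is below \<open>K * h\<close>, whatever the environment looks like.\<close>
lemma walk_in_valley_event: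
  fixes m n h r M :: nat and \<eta> \<kappa> K :: real and z :: "(int \<Rightarrow> real) \<times> (int \<Rightarrow> real)"
  defines "L \<equiv> real r * \<sigma>" and "a \<equiv> 1 + exp c" and "W \<equiv> 2 * real m + 3 * real r * (real h)\<^sup>2 + 2 * real M + 1"
  assumes \<omega>: "\<And>x. \<delta> \<le> fst z x \<and> fst z x \<le> 1 - \<delta>"
    and left: "z \<in> left_valley (- int m) (r * h\<^sup>2) h K L"
    and right: "z \<in> right_valley (int m) (2 * r * h\<^sup>2 + 2 * M) h K L \<kappa>"
    and inner: "\<And>x. x \<in> {- int m<..int m} \<Longrightarrow> g (snd z x) \<le> exp (K * h)"
    and h: "c * m \<le> K * h" "0 < h" and r: "0 < r" and K: "0 \<le> K" "10 * K \<le> L" and \<eta>: "0 < \<eta>"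
    and n: "exp (8 * (K * h)) \<le> n" "n \<le> 2 * exp (8 * (K * h))"
  shows "emeasure (quenched_law (fst z)) {X \<in> space (quenched_law (fst z)). \<eta> * n \<le> (\<Sum>i<n. g (snd z (X i)))}
    \<le> ennreal (exp (- (K * h)) * (W\<^sup>2 * (1 + 2 * a / \<eta>) + 4) + a * \<kappa> / \<eta>)"
proof -
  define V where "V = potential (fst z)"
  define T where "T = K * h"
  have T0: "0 \<le> T" using K by (simp add: T_def)
  define nl where "nl = r * h\<^sup>2"
  define nr where "nr = 2 * r * h\<^sup>2 + 2 * M"
  define lo where "lo = - int m - int nl"
  define hi where "hi = int m + int nr + 1"
  have bw: "V (- int m - int k) = V (- int m) + backward_path (fst z) (- int m) k" for k
    using potential_backward_path[of "fst z" "- int m" k] by (simp add: V_def)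
  have fw: "V (int m + int k) = V (int m) + forward_path (fst z) (int m) k" for k
    using potential_forward_path[of "fst z" "int m" k] by (simp add: V_def)
  have p0: "backward_path (fst z) (- int m) 0 = 0" "forward_path (fst z) (int m) 0 = 0"
    by (simp_all add: backward_path_def forward_path_def)
  have L1: "\<And>x y. x \<le> y \<Longrightarrow> y \<le> nl \<Longrightarrow> backward_path (fst z) (- int m) x - backward_path (fst z) (- int m) y \<le> 2 * T"
    and L2: "L * h \<le> backward_path (fst z) (- int m) nl"
    and L3: "\<And>k. k < nl \<Longrightarrow> g (snd z (- int m - int k)) \<le> exp T"
    using left by (auto simp: left_valley_def left_ok_def nl_def T_def mult.assoc)
  let ?u = "forward_path (fst z) (int m)"
  obtain b where b: "b \<le> nr" and raw: "\<forall>y\<le>b. \<forall>x\<le>y. ?u y - ?u x \<le> 2 * K * h" "?u b \<le> - L * h" "L * h \<le> ?u nr - ?u b"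
    and R4: "(\<Sum>k\<in>{1..nr}. g (snd z (int m + int k)) * exp (- (?u k - ?u b))) \<le> \<kappa>"
    and R5: "\<forall>k\<in>{1..nr}. g (snd z (int m + int k)) \<le> exp (K * h)"
    using right unfolding right_valley_def right_ok_def nr_def[symmetric] mem_Collect_eq by blast
  have R1: "?u y - ?u x \<le> 2 * T" if "x \<le> y" "y \<le> b" for x y
    using raw(1) that by (simp add: T_def mult.assoc)
  have R2: "?u b \<le> - (L * h)" and R3: "L * h \<le> ?u nr - ?u b" using raw(2,3) by simp_all
  have inV: "\<bar>V x\<bar> \<le> T" if "\<bar>x\<bar> \<le> int m" for x
  proof -
    have "\<bar>V x\<bar> \<le> c * \<bar>real_of_int x\<bar>" unfolding V_def by (rule potential_lipschitz[OF \<omega>])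
    also have "\<dots> \<le> c * real m" using that c_pos by (intro mult_left_mono) linarith+
    finally show ?thesis using h(1) by (simp add: T_def)
  qed
  have Vm: "\<bar>V (int m)\<bar> \<le> T" "\<bar>V (- int m)\<bar> \<le> T" using inV by auto
  have leftk: "\<exists>k. x = - int m - int k \<and> k \<le> nl" if "lo \<le> x" "x \<le> - int m" for x
    using that by (intro exI[of _ "nat (- int m - x)"]) (auto simp: lo_def)
  have rightk: "\<exists>k. x = int m + int k \<and> k \<le> b" if "int m \<le> x" "x \<le> int m + int b" for x
    using that by (intro exI[of _ "nat (x - int m)"]) auto
  have low: "- 3 * T \<le> V x" if x: "lo \<le> x" "x \<le> int m" for x
  proof (cases "x \<le> - int m")
    case True
    then obtain k where k: "x = - int m - int k" "k \<le> nl" using leftk x by blast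
    show ?thesis using L1[of 0 k] k bw[of k] p0 Vm by simp
  next
    case False
    then show ?thesis using inV[of x] x T0 by (simp add: abs_le_iff)
  qed
  have high: "V x \<le> 3 * T" if x: "- int m \<le> x" "x \<le> int m + int b" for x
  proof (cases "int m \<le> x")
    case True
    then obtain k where k: "x = int m + int k" "k \<le> b" using rightk x by blast
    show ?thesis using R1[of 0 k] k fw[of k] p0 Vm by simp
  next
    case False
    then show ?thesis using inV[of x] x T0 by (simp add: abs_le_iff)
  qed
  have "emeasure (quenched_law (fst z)) {X \<in> space (quenched_law (fst z)). (\<exists>i\<le>n. X i \<notin> {lo<..<hi}) \<or> \<eta> * n \<le> (\<Sum>i<n. g (snd z (X i)))}
    \<le> ennreal (exp (- T) * ((real_of_int (hi - lo))\<^sup>2 * (1 + 2 * (1 + exp c) / \<eta>) + 4) + (1 + exp c) * \<kappa> / \<eta>)"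
  proof (rule walk_in_valley[where \<omega> = "fst z" and G = "\<lambda>x. g (snd z x)" and m = "int m" and b = "int m + int b" and \<Lambda> = "L * h", folded V_def])
    have "0 < nl" using r h by (simp add: nl_def)
    then show "lo < 0" by (simp add: lo_def)
    show "10 * T \<le> L * h" using K(2) mult_right_mono[of "10 * K" L h] by (simp add: T_def mult.assoc)
    show "V y - V x \<le> 6 * T" if xy: "lo \<le> x" "x \<le> y" "y \<le> int m + int b" for x y
    proof -
      consider "y \<le> - int m" | "int m \<le> x" | "x \<le> int m" "- int m \<le> y" by linarith
      then show ?thesis
      proof cases
        case 1
        obtain k where k: "x = - int m - int k" "k \<le> nl" using leftk[of x] xy 1 by auto
        obtain k' where k': "y = - int m - int k'" "k' \<le> nl" using leftk[of y] xy 1 by auto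
        have "k' \<le> k" using k k' xy by simp
        then show ?thesis using L1[of k' k] k k' bw[of k] bw[of k'] T0 by simp
      next
        case 2
        obtain k where k: "x = int m + int k" "k \<le> b" using rightk[of x] xy 2 by auto
        obtain k' where k': "y = int m + int k'" "k' \<le> b" using rightk[of y] xy 2 by auto
        have "k \<le> k'" using k k' xy by simp
        then show ?thesis using R1[of k k'] k k' fw[of k] fw[of k'] T0 by simp
      next
        case 3
        then show ?thesis using low[of x] high[of y] xy by simp
      qed
    qed
    show "L * h - T \<le> V lo" using bw[of nl] L2 Vm by (simp add: lo_def)
    show "L * h \<le> V (hi - 1) - V (int m + int b)" using fw[of nr] fw[of b] R3 by (simp add: hi_def)
    show "V (int m + int b) \<le> T - L * h" using fw[of b] R2 Vm by simp
    show "g (snd z x) \<le> exp T" if x: "lo < x" "x < hi" for x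
    proof -
      consider "x \<le> - int m" | "- int m < x" "x \<le> int m" | "int m < x" by linarith
      then show ?thesis
      proof cases
        case 1
        then show ?thesis using L3[of "nat (- int m - x)"] x by (auto simp: lo_def)
      next
        case 2
        then show ?thesis using inner[of x] by (simp add: T_def)
      next
        case 3
        then obtain k where k: "x = int m + int k" "k \<in> {1..nr}"
          using x by (intro that[of "nat (x - int m)"]) (simp_all add: hi_def, arith)
        then show ?thesis using R5 by (simp add: T_def)
      qed
    qed
    have reindex: "(\<Sum>z'\<in>{int m<..<hi}. f z') = (\<Sum>k\<in>{1..nr}. f (int m + int k))" for f :: "int \<Rightarrow> real"
      by (rule sum.reindex_bij_witness[of _ "\<lambda>k. int m + int k" "\<lambda>x. nat (x - int m)"]) (auto simp: hi_def)
    show "(\<Sum>z'\<in>{int m<..<hi}. g (snd z z') * exp (- (V z' - V (int m + int b)))) \<le> \<kappa>"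
      unfolding reindex fw using R4 by simp
    show "int m + int b < hi" using b by (simp add: hi_def)
  qed (use \<omega> low high T0 \<eta> n g_nonneg in \<open>auto simp: T_def\<close>)
  moreover have "real_of_int (hi - lo) = W" by (simp add: hi_def lo_def W_def nl_def nr_def)
  moreover have "emeasure (quenched_law (fst z)) {X \<in> space (quenched_law (fst z)). \<eta> * n \<le> (\<Sum>i<n. g (snd z (X i)))} \<le>
      emeasure (quenched_law (fst z)) {X \<in> space (quenched_law (fst z)). (\<exists>i\<le>n. X i \<notin> {lo<..<hi}) \<or> \<eta> * n \<le> (\<Sum>i<n. g (snd z (X i)))}"
  proof (rule emeasure_mono)
    have "{X \<in> space (quenched_law (fst z)). (\<exists>i\<le>n. X i \<notin> {lo<..<hi}) \<or> \<eta> * n \<le> (\<Sum>i<n. g (snd z (X i)))} =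
        {X \<in> space (quenched_law (fst z)). \<exists>i\<le>n. X i \<notin> {lo<..<hi}} \<union>
        {X \<in> space (quenched_law (fst z)). \<eta> * n \<le> (\<Sum>i<n. g (snd z (X i)))}" by auto
    then show "{X \<in> space (quenched_law (fst z)). (\<exists>i\<le>n. X i \<notin> {lo<..<hi}) \<or> \<eta> * n \<le> (\<Sum>i<n. g (snd z (X i)))} \<in> sets (quenched_law (fst z))"
      using sets.Un[OF sets_quenched_exit sets_quenched_cost[where f = "\<lambda>x. g (snd z x)"]] by simp
  qed auto
  ultimately show ?thesis by (simp add: T_def a_def)
qed

end

section \<open>Good valleys at infinitely many scales\<close>

text \<open>The second Borel--Cantelli lemma for probabilities bounded from below: the product bound
  \<open>(1 - q) ^ Suc n\<close> tends to \<open>0\<close>.\<close>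
lemma (in iid_fields) independent_infinitely_often:
  fixes E :: "nat \<Rightarrow> ((int \<Rightarrow> real) \<times> (int \<Rightarrow> real)) set"
  assumes E: "\<And>j. E j \<in> sets Fields" "\<And>j. determined_by (K j) (E j)" and K: "disjoint_family K"
    and q: "0 < q" "\<And>j. q \<le> measure Fields (E j)"
  shows "AE z in Fields. \<forall>j\<^sub>0. \<exists>j\<ge>j\<^sub>0. z \<in> E j"
proof (subst AE_all_countable, intro allI)
  fix j\<^sub>0 :: nat
  have C: "- E j \<in> sets Fields" for j
    using sets.compl_sets[OF E(1), of j] by (simp add: space_Fields Compl_eq_Diff_UNIV)
  have C': "measure Fields (- E j) \<le> 1 - q" for j
    using ES.prob_compl[OF E(1), of j] q(2)[of j] by (simp add: space_Fields Compl_eq_Diff_UNIV)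
  let ?N = "{z. \<forall>j\<ge>j\<^sub>0. z \<notin> E j}"
  have N: "?N \<in> sets Fields"
  proof -
    have "?N = (\<Inter>j\<in>{j\<^sub>0..}. - E j)" by auto
    then show ?thesis using C by (simp add: sets.countable_INT')
  qed
  have bound: "measure Fields ?N \<le> (1 - q) ^ Suc n" for n
  proof -
    have "measure Fields ?N \<le> measure Fields (\<Inter>j\<in>{j\<^sub>0..j\<^sub>0 + n}. - E j)"
      using C by (intro ES.finite_measure_mono) auto
    also have "\<dots> = (\<Prod>j\<in>{j\<^sub>0..j\<^sub>0 + n}. measure Fields (- E j))"
      using C K by (intro prob_INT_determined[where K = K] determined_by_Compl E(2)) (auto simp: disjoint_family_on_def)
    also have "\<dots> \<le> (\<Prod>j\<in>{j\<^sub>0..j\<^sub>0 + n}. 1 - q)" using C' by (intro prod_mono) auto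
    finally show ?thesis by simp
  qed
  have "q \<le> 1" using q(2)[of 0] ES.prob_le_1[of "E 0"] by linarith
  then have "(\<lambda>n. (1 - q) ^ Suc n) \<longlonglongrightarrow> 0" using q(1) by (intro LIMSEQ_Suc LIMSEQ_power_zero) auto
  then have "measure Fields ?N \<le> 0" using bound by (intro LIMSEQ_le_const) auto
  then have "measure Fields ?N = 0" using measure_nonneg[of Fields ?N] by linarith
  then have "?N \<in> null_sets Fields" using N by (simp add: null_sets_def ES.emeasure_eq_measure)
  then show "AE z in Fields. \<exists>j\<ge>j\<^sub>0. z \<in> E j" by (rule AE_I') auto
qed

text \<open>Let \<open>m = scale_start k r M j\<close>.  The scale \<open>j\<close> uses sites outside \<open>{- m<..m}\<close>, and its unit of
  height is \<open>k * (m + 1) * 2 ^ j\<close>.  Owing to the factor \<open>m + 1\<close> this unit dominates the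
  potential at the inner sites, and owing to the factor \<open>2 ^ j\<close> the probabilities that some
  inner site is expensive are summable.\<close>

definition scale_height :: "nat \<Rightarrow> nat \<Rightarrow> nat \<Rightarrow> nat" where
  "scale_height k m j = k * (m + 1) * 2 ^ j"

primrec scale_start :: "nat \<Rightarrow> nat \<Rightarrow> nat \<Rightarrow> nat \<Rightarrow> nat" where
  "scale_start k r M 0 = 0"
| "scale_start k r M (Suc j) = scale_start k r M j + 2 * r * (scale_height k (scale_start k r M j) j)\<^sup>2 + 2 * M"

context sinai_scenery
begin

text \<open>At infinitely many scales there are a wall on the left and a valley on the right of the inner
  interval, and at
  all but finitely many scales no inner site is expensive.  At such a scale of height \<open>h\<close> the
  walk is observed at a time \<open>n\<close> close to \<open>exp (8 * K * h)\<close>; the number of sites of the valley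
  is polynomial in \<open>h\<close> and so does not matter against \<open>exp (- K * h)\<close>.\<close>
lemma frequently_localized:
  assumes \<eta>: "0 < \<eta>" and \<kappa>: "0 < \<kappa>"
  shows "AE z in Fields. \<forall>N. \<exists>n\<ge>N.
    emeasure (quenched_law (fst z)) {X \<in> space (quenched_law (fst z)). \<eta> * n \<le> (\<Sum>i<n. g (snd z (X i)))} \<le> ennreal \<kappa>"
proof -
  obtain p K where B: "block_bound p K" using block_bound_exists by blast
  then have p: "0 < p" and K: "1 \<le> K" by (auto simp: block_bound_def)
  \<comment> \<open>That many blocks build walls of height \<open>10 * K * h\<close>, as \<open>walk_in_valley_event\<close> requires.\<close>
  define r where "r = nat \<lceil>10 * K / \<sigma>\<rceil> + 1"
  define L where "L = real r * \<sigma>"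
  have r: "0 < r" by (simp add: r_def)
  have L: "10 * K \<le> L"
  proof -
    have "10 * K / \<sigma> \<le> real r" unfolding r_def by linarith
    then show ?thesis using \<sigma>_pos by (simp add: L_def field_simps)
  qed
  define a where "a = 1 + exp c"
  have a: "0 < a" by (simp add: a_def add_pos_pos)
  \<comment> \<open>Half of \<open>\<kappa>\<close> is left for the terms that vanish as \<open>h\<close> grows.\<close>
  define \<kappa>' where "\<kappa>' = \<kappa> * \<eta> / (2 * a)"
  have \<kappa>': "0 < \<kappa>'" using \<kappa> \<eta> a by (simp add: \<kappa>'_def)
  obtain M p' where p': "0 < p'"
    and right: "\<forall>\<^sub>F l in sequentially. \<forall>m. p' \<le> measure Fields (right_valley m (2 * r * l + 2 * M) (sqrt l) K L \<kappa>')"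
    unfolding L_def by (rule prob_right_valley[OF B \<kappa>', of r]) blast
  have "\<forall>\<^sub>F l in sequentially. (\<forall>m. p ^ r / 2 \<le> measure Fields (left_valley m (r * l) (sqrt l) K L)) \<and>
      (\<forall>m. p' \<le> measure Fields (right_valley m (2 * r * l + 2 * M) (sqrt l) K L \<kappa>'))"
    using prob_left_valley[OF B, of r, folded L_def] right by eventually_elim auto
  then obtain l0 where l0: "\<And>l m. l0 \<le> l \<Longrightarrow> p ^ r / 2 \<le> measure Fields (left_valley m (r * l) (sqrt l) K L)"
    "\<And>l m. l0 \<le> l \<Longrightarrow> p' \<le> measure Fields (right_valley m (2 * r * l + 2 * M) (sqrt l) K L \<kappa>')"
    by (auto simp: eventually_at_top_linorder)
  \<comment> \<open>Then heights are large enough for the probability bounds and exceed \<open>c * m\<close>.\<close>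
  define k where "k = l0 + 1 + nat \<lceil>c\<rceil>"
  have k: "l0 \<le> k" "1 \<le> k" "c \<le> k" using c_pos unfolding k_def by (simp_all, linarith)
  define mm where "mm j = scale_start k r M j" for j
  define hh where "hh j = scale_height k (mm j) j" for j
  have mm_Suc: "mm (Suc j) = mm j + 2 * r * (hh j)\<^sup>2 + 2 * M" for j by (simp add: mm_def hh_def)
  have hh_ge: "k * (mm j + 1) \<le> hh j" "(mm j + 1) * 2 ^ j \<le> hh j" for j
  proof -
    have "k * (mm j + 1) * 1 \<le> k * (mm j + 1) * 2 ^ j" by (intro mult_left_mono) auto
    then show "k * (mm j + 1) \<le> hh j" by (simp add: hh_def scale_height_def)
    have "1 * ((mm j + 1) * 2 ^ j) \<le> k * ((mm j + 1) * 2 ^ j)" using k by (intro mult_right_mono) auto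
    then show "(mm j + 1) * 2 ^ j \<le> hh j" by (simp only: hh_def scale_height_def mult.assoc mult_1)
  qed
  have hh: "k \<le> hh j" "mm j \<le> hh j" "2 ^ j \<le> hh j" "1 \<le> hh j" "j \<le> hh j" for j
  proof -
    have "k * 1 \<le> k * (mm j + 1)" "1 * mm j \<le> k * (mm j + 1)" using k by (intro mult_mono; simp)+
    with hh_ge(1)[of j] show "k \<le> hh j" "mm j \<le> hh j" by simp_all
    with k show "1 \<le> hh j" by simp
    have "1 * 2 ^ j \<le> (mm j + 1) * 2 ^ j" by (intro mult_right_mono) auto
    with hh_ge(2)[of j] show *: "2 ^ j \<le> hh j" by simp
    have "j < 2 ^ j" by (rule less_exp)
    with * show "j \<le> hh j" by linarith
  qed
  have c_hh: "c * mm j \<le> K * hh j" for j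
  proof -
    have "c * mm j \<le> real k * real (mm j + 1)" using k c_pos by (intro mult_mono) auto
    also have "\<dots> \<le> real (hh j)" using hh_ge(1)[of j] by (metis of_nat_le_iff of_nat_mult)
    also have "\<dots> \<le> K * hh j" using K mult_right_mono[of 1 K "real (hh j)"] by simp
    finally show ?thesis .
  qed
  have l0hh: "l0 \<le> (hh j)\<^sup>2" for j
    using k(1) hh(1,4)[of j] by (simp add: power2_eq_square) (meson le_square order_trans)
  define El where "El j = left_valley (- int (mm j)) (r * (hh j)\<^sup>2) (hh j) K L" for j
  define Er where "Er j = right_valley (int (mm j)) (2 * r * (hh j)\<^sup>2 + 2 * M) (hh j) K L \<kappa>'" for j
  define Ki where "Ki j = {- int (mm (Suc j))<..- int (mm j)} \<union> {int (mm j)<..int (mm (Suc j))}" for j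
  have detl: "determined_by {- int (mm (Suc j))<..- int (mm j)} (El j)"
    and detr: "determined_by {int (mm j)<..int (mm (Suc j))} (Er j)" for j
    unfolding El_def Er_def mm_Suc
    by (rule determined_by_mono[OF determined_left_valley], auto, rule determined_by_mono[OF determined_right_valley], auto)
  have mono_mm: "mm i \<le> mm j" if "i \<le> j" for i j
    using that by (induction j rule: dec_induct) (auto simp: mm_Suc)
  have io: "AE z in Fields. \<forall>j\<^sub>0. \<exists>j\<ge>j\<^sub>0. z \<in> El j \<inter> Er j"
  proof (rule independent_infinitely_often[where K = Ki and q = "p ^ r / 2 * p'"])
    have s: "sqrt (real ((hh j)\<^sup>2)) = real (hh j)" for j by simp
    show "El j \<inter> Er j \<in> sets Fields" for j
      unfolding El_def Er_def using sets_left_valley sets_right_valley by auto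
    show "determined_by (Ki j) (El j \<inter> Er j)" for j
      unfolding Ki_def by (intro determined_by_Int determined_by_mono[OF detl] determined_by_mono[OF detr]) auto
    show "disjoint_family Ki"
      unfolding disjoint_family_on_def
    proof (intro ballI impI)
      fix i j :: nat assume "i \<noteq> j"
      then consider "Suc i \<le> j" | "Suc j \<le> i" by linarith
      then show "Ki i \<inter> Ki j = {}"
        by cases (use mono_mm[of "Suc i" j] mono_mm[of "Suc j" i] in \<open>auto simp: Ki_def\<close>)
    qed
    show "0 < p ^ r / 2 * p'" using p p' by simp
    show "p ^ r / 2 * p' \<le> measure Fields (El j \<inter> Er j)" for j
    proof -
      have "measure Fields (El j \<inter> Er j) = measure Fields (El j) * measure Fields (Er j)"
        by (rule prob_Int_determined[OF _ _ detl detr]) (auto simp: El_def Er_def sets_left_valley sets_right_valley)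
      moreover have "p ^ r / 2 \<le> measure Fields (El j)"
        using l0(1)[OF l0hh, of "- int (mm j)" j] unfolding s El_def .
      moreover have "p' \<le> measure Fields (Er j)"
        using l0(2)[OF l0hh, of "int (mm j)" j] unfolding s Er_def .
      ultimately show ?thesis using p p' mult_mono[of "p ^ r / 2" "measure Fields (El j)" p' "measure Fields (Er j)"]
        by (metis less_imp_le measure_nonneg)
    qed
  qed
  define Bad where "Bad j = {z :: (int \<Rightarrow> real) \<times> (int \<Rightarrow> real). \<exists>x\<in>{- int (mm j)<..int (mm j)}. exp (K * hh j) < g (snd z x)}" for j
  have inner: "AE z in Fields. \<forall>\<^sub>F j in sequentially. z \<in> space Fields - Bad j"
  proof (rule borel_cantelli_AE1)
    have Kh: "0 \<le> K * hh j" for j using K by simp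
    show "Bad j \<in> sets Fields" for j unfolding Bad_def by (rule prob_scenery_large[OF Kh]) simp
    show "emeasure Fields (Bad j) < \<infinity>" for j by (simp add: ES.emeasure_eq_measure)
    have "measure Fields (Bad j) \<le> 2 * D * (1 / 2) ^ j" for j
    proof -
      have "measure Fields (Bad j) \<le> card {- int (mm j)<..int (mm j)} * (D / (1 + K * hh j) powr (2 + \<epsilon>))"
        unfolding Bad_def by (rule prob_scenery_large[OF Kh]) simp
      also have "\<dots> \<le> (2 * real (mm j + 1)) * (D / (real (mm j + 1) * 2 ^ j))"
      proof (rule mult_mono)
        have "real ((mm j + 1) * 2 ^ j) \<le> real (hh j)" using hh_ge(2)[of j] by (rule of_nat_mono)
        then have "real (mm j + 1) * 2 ^ j \<le> real (hh j)" by (simp only: of_nat_mult of_nat_power of_nat_numeral)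
        also have "\<dots> \<le> 1 + K * hh j" using K mult_right_mono[of 1 K "real (hh j)"] by simp
        also have "\<dots> = (1 + K * hh j) powr 1" using Kh[of j] by simp
        also have "\<dots> \<le> (1 + K * hh j) powr (2 + \<epsilon>)" using Kh[of j] \<epsilon>_pos by (intro powr_mono) auto
        finally have le: "real (mm j + 1) * 2 ^ j \<le> (1 + K * hh j) powr (2 + \<epsilon>)" .
        have pos: "0 < real (mm j + 1) * 2 ^ j" by simp
        show "D / (1 + K * hh j) powr (2 + \<epsilon>) \<le> D / (real (mm j + 1) * 2 ^ j)"
          by (rule divide_left_mono[OF le D_nonneg]) (rule mult_pos_pos[OF less_le_trans[OF pos le] pos])
        show "0 \<le> D / (1 + K * hh j) powr (2 + \<epsilon>)" using D_nonneg by (rule divide_nonneg_nonneg) simp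
      qed auto
      also have "\<dots> = 2 * D * (1 / 2) ^ j"
      proof -
        have "(2 * a) * (D / (a * b)) = 2 * D * (1 / b)" if "a \<noteq> 0" for a b :: real using that by simp
        from this[of "real (mm j + 1)" "2 ^ j"] show ?thesis by (simp add: power_one_over)
      qed
      finally show ?thesis .
    qed
    then have le: "norm (measure Fields (Bad j)) \<le> 2 * D * (1 / 2) ^ j" if "0 \<le> j" for j by simp
    have "summable (\<lambda>j. 2 * D * (1 / 2 :: real) ^ j)" by (rule summable_mult) (rule summable_geometric, simp)
    then show "summable (\<lambda>j. measure Fields (Bad j))" by (rule summable_comparison_test') (rule le)
  qed
  define A where "A = 3 + 3 * real r + 2 * real M"
  have "((\<lambda>h :: nat. exp (- (K * h)) * ((A * (real h)\<^sup>2)\<^sup>2 * (1 + 2 * a / \<eta>) + 4)) \<longlongrightarrow> 0) sequentially"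
  proof -
    have "((\<lambda>h :: nat. exp (- (K * h)) * (B * ((real h)\<^sup>2)\<^sup>2 + 4)) \<longlongrightarrow> 0) sequentially" for B
      using K by real_asymp
    from this[of "A\<^sup>2 * (1 + 2 * a / \<eta>)"] show ?thesis by (simp add: power_mult_distrib mult_ac)
  qed
  then have "\<forall>\<^sub>F h :: nat in sequentially. exp (- (K * h)) * ((A * (real h)\<^sup>2)\<^sup>2 * (1 + 2 * a / \<eta>) + 4) < \<kappa> / 2"
    using \<kappa> by (intro order_tendstoD(2)) auto
  then obtain h0 where h0: "\<And>h :: nat. h0 \<le> h \<Longrightarrow> exp (- (K * h)) * ((A * (real h)\<^sup>2)\<^sup>2 * (1 + 2 * a / \<eta>) + 4) < \<kappa> / 2"
    by (auto simp: eventually_at_top_linorder)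
  show ?thesis using io inner AE_elliptic
  proof eventually_elim
    case (elim z)
    then obtain j1 where j1: "\<And>j. j1 \<le> j \<Longrightarrow> z \<notin> Bad j" by (auto simp: eventually_at_top_linorder)
    show ?case
    proof
      fix N
      obtain j where j: "j \<ge> max j1 (max h0 N)" and z: "z \<in> El j" "z \<in> Er j" using elim(1) by blast
      define h where "h = hh j"
      define n where "n = nat \<lceil>exp (8 * (K * h))\<rceil>"
      define W where "W = 2 * real (mm j) + 3 * real r * (real h)\<^sup>2 + 2 * real M + 1"
      have h: "h0 \<le> h" "N \<le> h" "1 \<le> h" "mm j \<le> h" using j hh[of j] by (auto simp: h_def)
      have Kh: "1 \<le> K * h" using mult_mono[of 1 K 1 "real h"] K h by simp
      have "1 \<le> exp (8 * (K * h))" using Kh by simp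
      then have n: "exp (8 * (K * h)) \<le> n" "n \<le> 2 * exp (8 * (K * h))" unfolding n_def by linarith+
      have "real N \<le> real h" using h by simp
      also have "\<dots> \<le> K * h" using K mult_right_mono[of 1 K "real h"] by simp
      also have "\<dots> \<le> exp (8 * (K * h))" using exp_ge_add_one_self[of "8 * (K * h)"] Kh by linarith
      finally have nN: "N \<le> n" using n(1) by linarith
      have W: "W \<le> A * (real h)\<^sup>2" "0 \<le> W"
      proof -
        have "real h * 1 \<le> real h * real h" using h by (intro mult_left_mono) auto
        moreover have "real (mm j) \<le> real h" "1 \<le> (real h)\<^sup>2" using h by simp_all
        moreover have "real M * 1 \<le> real M * (real h)\<^sup>2" using h by (intro mult_left_mono) auto
        ultimately show "W \<le> A * (real h)\<^sup>2" unfolding W_def A_def by (simp add: algebra_simps power2_eq_square)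
      qed (simp add: W_def)
      have "emeasure (quenched_law (fst z)) {X \<in> space (quenched_law (fst z)). \<eta> * n \<le> (\<Sum>i<n. g (snd z (X i)))}
          \<le> ennreal (exp (- (K * h)) * (W\<^sup>2 * (1 + 2 * a / \<eta>) + 4) + a * \<kappa>' / \<eta>)"
        unfolding W_def a_def
      proof (rule walk_in_valley_event)
        show "\<delta> \<le> fst z x \<and> fst z x \<le> 1 - \<delta>" for x using elim(3) by blast
        show "z \<in> left_valley (- int (mm j)) (r * h\<^sup>2) h K (real r * \<sigma>)" using z by (simp add: El_def h_def L_def)
        show "z \<in> right_valley (int (mm j)) (2 * r * h\<^sup>2 + 2 * M) h K (real r * \<sigma>) \<kappa>'" using z by (simp add: Er_def h_def L_def)
        show "g (snd z x) \<le> exp (K * h)" if "x \<in> {- int (mm j)<..int (mm j)}" for x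
          using j1[of j] j that by (auto simp: Bad_def h_def not_less)
      qed (use c_hh[of j] h r K L \<eta> n in \<open>auto simp: h_def L_def\<close>)
      also have "\<dots> \<le> ennreal \<kappa>"
      proof (rule ennreal_leI)
        have "W\<^sup>2 \<le> (A * (real h)\<^sup>2)\<^sup>2" using W by (intro power_mono) auto
        then have "exp (- (K * h)) * (W\<^sup>2 * (1 + 2 * a / \<eta>) + 4) \<le> exp (- (K * h)) * ((A * (real h)\<^sup>2)\<^sup>2 * (1 + 2 * a / \<eta>) + 4)"
          using a \<eta> by (intro mult_left_mono add_right_mono mult_right_mono) auto
        also have "\<dots> < \<kappa> / 2" using h0[OF h(1)] .
        finally have "exp (- (K * h)) * (W\<^sup>2 * (1 + 2 * a / \<eta>) + 4) < \<kappa> / 2" .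
        moreover have "a * \<kappa>' / \<eta> = \<kappa> / 2" using a \<eta> by (simp add: \<kappa>'_def)
        moreover have "x + y \<le> \<kappa>" if "x < \<kappa> / 2" "y = \<kappa> / 2" for x y :: real using that by simp
        ultimately show "exp (- (K * h)) * (W\<^sup>2 * (1 + 2 * a / \<eta>) + 4) + a * \<kappa>' / \<eta> \<le> \<kappa>" by blast
      qed
      finally show "\<exists>n\<ge>N. emeasure (quenched_law (fst z)) {X \<in> space (quenched_law (fst z)). \<eta> * n \<le> (\<Sum>i<n. g (snd z (X i)))} \<le> ennreal \<kappa>"
        using nN by blast
    qed
  qed
qed

text \<open>If infinitely many events have a quenched probability of at most \<open>\<kappa>\<close>, then the probability
  that all but finitely many of them occur is at most \<open>\<kappa>\<close>; and \<open>\<kappa>\<close> is arbitrary.\<close>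

proposition AE_frequently_small_cost:
  assumes \<eta>: "0 < \<eta>"
  shows "AE z in Fields. AE X in quenched_law (fst z). \<forall>N. \<exists>n\<ge>N. (\<Sum>i<n. g (snd z (X i))) < \<eta> * n"
proof -
  have "AE z in Fields. \<forall>k. \<forall>N. \<exists>n\<ge>N.
    emeasure (quenched_law (fst z)) {X \<in> space (quenched_law (fst z)). \<eta> * n \<le> (\<Sum>i<n. g (snd z (X i)))} \<le> ennreal (1 / Suc k)"
    by (subst AE_all_countable) (intro allI frequently_localized \<eta>, simp)
  then show ?thesis
  proof eventually_elim
    case (elim z)
    show ?case
    proof (subst AE_all_countable, intro allI)
      fix N
      let ?C = "{X \<in> space (quenched_law (fst z)). \<forall>n\<ge>N. \<eta> * n \<le> (\<Sum>i<n. g (snd z (X i)))}"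
      have C: "?C \<in> sets (quenched_law (fst z))"
      proof -
        have "(\<Inter>n\<in>{N..}. {X \<in> space (quenched_law (fst z)). \<eta> * n \<le> (\<Sum>i<n. g (snd z (X i)))}) \<in> sets (quenched_law (fst z))"
          by (intro sets.countable_INT' sets_quenched_cost[where f = "\<lambda>x. g (snd z x)"] image_subsetI) auto
        also have "(\<Inter>n\<in>{N..}. {X \<in> space (quenched_law (fst z)). \<eta> * n \<le> (\<Sum>i<n. g (snd z (X i)))}) = ?C" by auto
        finally show ?thesis .
      qed
      have "emeasure (quenched_law (fst z)) ?C \<le> ennreal (1 / Suc k)" for k
      proof -
        obtain n where n: "n \<ge> N" "emeasure (quenched_law (fst z)) {X \<in> space (quenched_law (fst z)). \<eta> * n \<le> (\<Sum>i<n. g (snd z (X i)))} \<le> ennreal (1 / Suc k)"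
          using elim by blast
        have "emeasure (quenched_law (fst z)) ?C \<le> emeasure (quenched_law (fst z)) {X \<in> space (quenched_law (fst z)). \<eta> * n \<le> (\<Sum>i<n. g (snd z (X i)))}"
          using n(1) by (intro emeasure_mono sets_quenched_cost[where f = "\<lambda>x. g (snd z x)"]) auto
        with n(2) show ?thesis by (rule order_trans[rotated])
      qed
      moreover have "(\<lambda>k. ennreal (1 / Suc k)) \<longlonglongrightarrow> ennreal 0"
        by (intro tendsto_ennrealI) real_asymp
      ultimately have "emeasure (quenched_law (fst z)) ?C \<le> 0" by (intro LIMSEQ_le_const[of _ 0]) auto
      then have "?C \<in> null_sets (quenched_law (fst z))" using C by (simp add: null_sets_def)
      then show "AE X in quenched_law (fst z). \<exists>n\<ge>N. (\<Sum>i<n. g (snd z (X i))) < \<eta> * n"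
        by (rule AE_I') (auto simp: not_less)
    qed
  qed
qed

end

section \<open>Heavy scenery\<close>

lemma poisson_left_le:
  assumes V: "\<And>x. \<bar>x\<bar> \<le> L \<Longrightarrow> \<bar>V x\<bar> \<le> H" and sw: "\<And>x. step_weight V x \<le> a * exp (- V x)" and L: "0 \<le> (L :: int)" and a: "0 \<le> a"
  shows "poisson_left V (\<lambda>_. 1) (- L) 0 L 0 \<le> 2 * (real_of_int L)\<^sup>2 * a * exp (2 * H)"
proof -
  have "flux_left V (\<lambda>_. 1) (- L) 0 y * exp (V y) \<le> 2 * real_of_int L * (a * exp (2 * H))" if y: "y \<in> {0..<L}" for y
  proof -
    have "flux_left V (\<lambda>_. 1) (- L) 0 y * exp (V y) = (\<Sum>z\<in>{- L<..y}. step_weight V z * exp (V y))"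
      by (simp add: flux_left_def sum_distrib_right)
    also have "\<dots> \<le> (\<Sum>z\<in>{- L<..y}. a * exp (2 * H))"
    proof (rule sum_mono)
      fix z assume z: "z \<in> {- L<..y}"
      have "step_weight V z * exp (V y) \<le> (a * exp (- V z)) * exp (V y)" by (intro mult_right_mono sw) auto
      also have "\<dots> = a * exp (V y - V z)" by (simp add: exp_diff exp_minus field_simps)
      also have "\<dots> \<le> a * exp (2 * H)"
      proof -
        have "\<bar>V y\<bar> \<le> H" "\<bar>V z\<bar> \<le> H" using y z by (auto intro!: V)
        then have "V y - V z \<le> 2 * H" by linarith
        then show ?thesis using a by (intro mult_left_mono) auto
      qed
      finally show "step_weight V z * exp (V y) \<le> a * exp (2 * H)" .
    qed
    also have "\<dots> = real (card {- L<..y}) * (a * exp (2 * H))" by simp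
    also have "\<dots> \<le> 2 * real_of_int L * (a * exp (2 * H))" using y a by (intro mult_right_mono) auto
    finally show ?thesis .
  qed
  then have "poisson_left V (\<lambda>_. 1) (- L) 0 L 0 \<le> real (card {0..<L}) * (2 * real_of_int L * (a * exp (2 * H)))"
    unfolding poisson_left_def by (intro sum_bounded_above) auto
  also have "\<dots> = 2 * (real_of_int L)\<^sup>2 * a * exp (2 * H)" using L by (simp add: power2_eq_square)
  finally show ?thesis .
qed

text \<open>The walk cannot jump over a site.\<close>
lemma nearest_neighbour_visits:
  fixes X :: "nat \<Rightarrow> int"
  assumes X: "X 0 = 0" "\<And>i. \<bar>X (Suc i) - X i\<bar> = 1" and i: "L \<le> \<bar>X i\<bar>"
  shows "(\<forall>x\<in>{1..L}. \<exists>j\<le>i. X j = x) \<or> (\<forall>x\<in>{1..L}. \<exists>j\<le>i. X j = - x)"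
proof (cases "0 \<le> X i")
  case True
  have "\<exists>j\<le>i. X j = x" if "x \<in> {1..L}" for x
    using nat0_intermed_int_val[of i X x] X i True that by auto
  then show ?thesis by blast
next
  case False
  have "\<exists>j\<le>i. X j = - x" if x: "x \<in> {1..L}" for x
  proof -
    have "\<bar>- X (i' + 1) - - X i'\<bar> \<le> 1" for i' using X(2)[of i'] by (simp add: abs_minus_commute)
    then obtain j where "j \<le> i" "- X j = x"
      using nat0_intermed_int_val[of i "\<lambda>j. - X j" x] X(1) i False x by auto
    then show ?thesis by (intro exI[of _ j]) auto
  qed
  then show ?thesis by blast
qed

lemma walk_in_scenery_le:
  assumes a: "\<And>x. \<xi> x \<le> a" "0 \<le> a" and j: "j \<le> n" "\<xi> (X j) \<le> - s"
  shows "walk_in_scenery \<xi> X n \<le> n * a - s"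
proof -
  have "walk_in_scenery \<xi> X n = \<xi> (X j) + (\<Sum>i\<in>{..n} - {j}. \<xi> (X i))"
    unfolding walk_in_scenery_def using j(1) by (intro sum.remove) auto
  also have "(\<Sum>i\<in>{..n} - {j}. \<xi> (X i)) \<le> real (card ({..n} - {j})) * a"
    using a by (intro sum_bounded_above) auto
  also have "real (card ({..n} - {j})) * a = n * a" using j(1) by simp
  finally show ?thesis using j(2) by simp
qed

text \<open>A site seen by the time \<open>2 ^ 2 ^ k\<close> stays in the sum until \<open>2 ^ 2 ^ Suc k\<close>, and its value,
  divided by any time \<open>n\<close> before that, is at most \<open>- (2 ^ k)\<close>.  The other terms contribute at
  most \<open>a\<close> to the average.\<close>

lemma walk_in_scenery_diverges:
  assumes a: "\<And>x. \<xi> x \<le> a" "0 \<le> a"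
    and seen: "\<forall>\<^sub>F k in sequentially. \<exists>j\<le>2 ^ 2 ^ k. \<xi> (X j) \<le> - (2 ^ k * 2 ^ 2 ^ Suc k)"
  shows "LIM n sequentially. walk_in_scenery \<xi> X n / real n :> at_bot"
proof -
  obtain k0 where k0: "\<And>k. k0 \<le> k \<Longrightarrow> \<exists>j\<le>2 ^ 2 ^ k. \<xi> (X j) \<le> - (2 ^ k * 2 ^ 2 ^ Suc k)"
    using seen by (auto simp: eventually_at_top_linorder)
  show ?thesis
    unfolding filterlim_at_bot eventually_at_top_linorder
  proof
    fix C :: real
    obtain k1 :: nat where k1: "a - C < 2 ^ k1" using real_arch_pow[of 2 "a - C"] by auto
    define k2 where "k2 = max k0 k1"
    show "\<exists>N. \<forall>n\<ge>N. walk_in_scenery \<xi> X n / real n \<le> C"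
    proof (intro exI allI impI)
      fix n :: nat assume n: "2 ^ 2 ^ k2 \<le> n"
      have ex: "\<exists>k. n < 2 ^ 2 ^ k"
      proof
        have "n < 2 ^ n" by (rule less_exp)
        also have "(2 :: nat) ^ n \<le> 2 ^ 2 ^ n" by (intro power_increasing) (auto intro: less_imp_le less_exp)
        finally show "n < 2 ^ 2 ^ n" .
      qed
      define k' where "k' = (LEAST k. n < 2 ^ 2 ^ k)"
      have k': "n < 2 ^ 2 ^ k'" unfolding k'_def using ex by (rule LeastI_ex)
      have "k2 < k'"
      proof (rule ccontr)
        assume "\<not> k2 < k'"
        then have "(2 :: nat) ^ 2 ^ k' \<le> 2 ^ 2 ^ k2" by (intro power_increasing) auto
        with k' n show False by simp
      qed
      then obtain k where k: "k' = Suc k" "k2 \<le> k" by (cases k') auto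
      have "\<not> n < 2 ^ 2 ^ k" using not_less_Least[of k "\<lambda>k. n < 2 ^ 2 ^ k"] k(1) by (simp add: k'_def)
      then have lo: "2 ^ 2 ^ k \<le> n" by simp
      have "k0 \<le> k" using k(2) by (simp add: k2_def)
      then obtain j where j: "j \<le> 2 ^ 2 ^ k" "\<xi> (X j) \<le> - (2 ^ k * 2 ^ 2 ^ Suc k)" using k0 by blast
      have "walk_in_scenery \<xi> X n \<le> n * a - 2 ^ k * 2 ^ 2 ^ Suc k"
        using j lo by (intro walk_in_scenery_le[OF a, of j]) auto
      also have "\<dots> \<le> n * a - 2 ^ k * n"
      proof -
        have "real n \<le> real (2 ^ 2 ^ Suc k)" using k'[unfolded k(1)] by (intro of_nat_mono) (rule less_imp_le)
        then have "real n \<le> 2 ^ 2 ^ Suc k" by (simp only: of_nat_power of_nat_numeral)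
        then show ?thesis by (intro diff_mono mult_left_mono) auto
      qed
      also have "\<dots> = n * (a - 2 ^ k)" by (simp add: algebra_simps)
      also have "\<dots> \<le> n * C"
      proof -
        have "(2 :: real) ^ k1 \<le> 2 ^ k" using k(2) by (intro power_increasing) (auto simp: k2_def)
        then have "a - 2 ^ k \<le> C" using k1 by linarith
        then show ?thesis by (intro mult_left_mono) auto
      qed
      finally have "walk_in_scenery \<xi> X n \<le> n * C" .
      moreover have "0 < real n" using lo by (metis of_nat_0_less_iff pos2 zero_less_power less_le_trans)
      ultimately show "walk_in_scenery \<xi> X n / real n \<le> C" by (simp add: field_simps)
    qed
  qed
qed

context sinai_environment
begin

lemma quenched_exit_time:
  assumes \<omega>: "\<And>x. \<delta> \<le> \<omega> x \<and> \<omega> x \<le> 1 - \<delta>" and V: "\<And>x. \<bar>x\<bar> \<le> L \<Longrightarrow> \<bar>potential \<omega> x\<bar> \<le> H"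
    and L: "0 < L" and n: "0 < n"
  shows "emeasure (quenched_law \<omega>) {X \<in> space (quenched_law \<omega>). \<forall>i\<le>n. X i \<in> {- L<..<L}}
    \<le> ennreal (2 * (real_of_int L)\<^sup>2 * (1 + exp c) * exp (2 * H) / n)"
proof -
  let ?F = "poisson_left (potential \<omega>) (\<lambda>_. 1) (- L) 0 L"
  have p: "\<omega> x = exp (- potential \<omega> x) / step_weight (potential \<omega>) x" for x by (rule environment_weight(1)) (rule \<omega>)
  have sw: "step_weight (potential \<omega>) x \<le> (1 + exp c) * exp (- potential \<omega> x)" for x by (rule environment_weight(2)) (rule \<omega>)
  have "emeasure (quenched_law \<omega>) {X \<in> space (quenched_law \<omega>). \<forall>i\<le>n. X i \<in> {- L<..<L}} \<le> ennreal (?F 0 / n)"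
  proof (rule quenched_exit_bound[OF _ _ _ _ n])
    show "0 \<le> ?F x" for x by (rule poisson_nonneg) auto
    show "0 \<le> \<omega> x" "\<omega> x \<le> 1" for x using \<omega>[of x] \<delta> by auto
    show "\<omega> x * ?F (x + 1) + (1 - \<omega> x) * ?F (x - 1) + 1 \<le> ?F x" if "x \<in> {- L<..<L}" for x
      using poisson_left_drift[OF p, of "- L" x L "\<lambda>_. 1" 0] that by simp
  qed
  also have "\<dots> \<le> ennreal (2 * (real_of_int L)\<^sup>2 * (1 + exp c) * exp (2 * H) / n)"
    using poisson_left_le[OF V sw, of L] L by (intro ennreal_leI divide_right_mono) (auto simp: add_nonneg_nonneg)
  finally show ?thesis .
qed

lemma prob_potential_large:
  assumes H: "0 < H"
  shows "{z. \<exists>x. \<bar>x\<bar> \<le> int L \<and> H \<le> \<bar>potential (fst z) x\<bar>} \<in> sets Fields"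
    "measure Fields {z. \<exists>x. \<bar>x\<bar> \<le> int L \<and> H \<le> \<bar>potential (fst z) x\<bar>} \<le> 2 * (L * \<sigma>\<^sup>2 / H\<^sup>2)"
proof -
  let ?S = "{y :: nat \<Rightarrow> real. \<forall>k\<le>L. 0 + (\<Sum>i<k. y i) \<in> {-H<..<H}}"
  let ?R = "{p. (\<lambda>i. log_ratio (fst p (0 + 1 + int i))) \<in> ?S} :: ((int \<Rightarrow> real) \<times> (int \<Rightarrow> real)) set"
  let ?L = "{p. (\<lambda>i. - log_ratio (fst p (0 - int i))) \<in> ?S} :: ((int \<Rightarrow> real) \<times> (int \<Rightarrow> real)) set"
  let ?B = "{z. \<exists>x. \<bar>x\<bar> \<le> int L \<and> H \<le> \<bar>potential (fst z) x\<bar>} :: ((int \<Rightarrow> real) \<times> (int \<Rightarrow> real)) set"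
  have injR: "inj (\<lambda>i. 0 + 1 + int i)" and injL: "inj (\<lambda>i. 0 - int i)" by (auto simp: inj_on_def)
  have m: "(\<lambda>w. - log_ratio w) \<in> borel_measurable borel" by measurable
  have R: "?R \<in> sets Fields" "1 - L * \<sigma>\<^sup>2 / H\<^sup>2 \<le> measure Fields ?R"
    using prob_Env_steps[OF injR measurable_log_ratio Up.measurable_stay1[of "{-H<..<H}" L 0]]
      Up.stay_strip_ge[OF H, of 0 L] by (simp_all add: Up.stay_def)
  have Lm: "?L \<in> sets Fields" "1 - L * \<sigma>\<^sup>2 / H\<^sup>2 \<le> measure Fields ?L"
    using prob_Env_steps[OF injL m Down.measurable_stay1[of "{-H<..<H}" L 0]]
      Down.stay_strip_ge[OF H, of 0 L] by (simp_all add: Down.stay_def)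
  have eq: "?B = (space Fields - ?R) \<union> (space Fields - ?L)"
  proof -
    have f: "potential \<omega> (int k) = (\<Sum>i<k. log_ratio (\<omega> (0 + 1 + int i)))" "potential \<omega> (- int k) = (\<Sum>i<k. - log_ratio (\<omega> (0 - int i)))" for \<omega> k
      using potential_forward[of \<omega> 0 k] potential_backward[of \<omega> 0 k] by simp_all
    have x: "(\<exists>x. \<bar>x\<bar> \<le> int L \<and> P x) \<longleftrightarrow> (\<exists>k\<le>L. P (int k)) \<or> (\<exists>k\<le>L. P (- int k))" for P
    proof safe
      fix x assume x: "\<bar>x\<bar> \<le> int L" "P x" "\<not> (\<exists>k\<le>L. P (- int k))"
      have "0 \<le> x"
      proof (rule ccontr)
        assume "\<not> 0 \<le> x"
        then show False using x by (auto dest!: spec[of _ "nat (- x)"])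
      qed
      then show "\<exists>k\<le>L. P (int k)" using x by (intro exI[of _ "nat x"]) auto
    next
      fix k assume "k \<le> L" "P (int k)"
      then show "\<exists>x. \<bar>x\<bar> \<le> int L \<and> P x" by (intro exI[of _ "int k"]) auto
    next
      fix k assume "k \<le> L" "P (- int k)"
      then show "\<exists>x. \<bar>x\<bar> \<le> int L \<and> P x" by (intro exI[of _ "- int k"]) auto
    qed
    have abs: "H \<le> \<bar>t\<bar> \<longleftrightarrow> \<not> (0 + t \<in> {-H<..<H})" for t :: real by auto
    show ?thesis unfolding x f abs space_Fields by blast
  qed
  have c: "measure Fields (space Fields - ?R) \<le> L * \<sigma>\<^sup>2 / H\<^sup>2" "measure Fields (space Fields - ?L) \<le> L * \<sigma>\<^sup>2 / H\<^sup>2"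
    using ES.prob_compl[OF R(1)] ES.prob_compl[OF Lm(1)] R(2) Lm(2) by linarith+
  show "?B \<in> sets Fields" unfolding eq using R(1) Lm(1) by (intro sets.Un sets.compl_sets)
  have "measure Fields ?B \<le> measure Fields (space Fields - ?R) + measure Fields (space Fields - ?L)"
    unfolding eq using R(1) Lm(1) by (intro measure_Un_le sets.compl_sets)
  then show "measure Fields ?B \<le> 2 * (L * \<sigma>\<^sup>2 / H\<^sup>2)" using add_mono[OF c] by simp
qed

text \<open>The exponent lies strictly between \<open>2 - \<epsilon>\<close> and \<open>2\<close>.  Below \<open>2\<close>, the potential on the interval
  is small against \<open>2 ^ k\<close>, the logarithm of the time; above \<open>2 - \<epsilon>\<close>, there are enough sites for
  an extreme scenery value.\<close>
definition range_scale :: "real \<Rightarrow> nat \<Rightarrow> nat" where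
  "range_scale \<epsilon> k = nat \<lceil>2 powr (k * (2 - \<epsilon> / 2))\<rceil>"

lemma range_scale:
  assumes "0 < \<epsilon>" "\<epsilon> \<le> 1"
  shows "2 powr (k * (2 - \<epsilon> / 2)) \<le> range_scale \<epsilon> k" "range_scale \<epsilon> k \<le> 2 * 2 powr (k * (2 - \<epsilon> / 2))"
    "range_scale \<epsilon> k \<le> 2 * (4 :: real) ^ k" "0 < range_scale \<epsilon> k"
proof -
  have "(2 :: real) powr 0 \<le> 2 powr (k * (2 - \<epsilon> / 2))" using assms by (intro powr_mono mult_nonneg_nonneg) auto
  then have ge1: "1 \<le> (2 :: real) powr (k * (2 - \<epsilon> / 2))" by simp
  show le: "2 powr (k * (2 - \<epsilon> / 2)) \<le> range_scale \<epsilon> k" unfolding range_scale_def by linarith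
  show le2: "range_scale \<epsilon> k \<le> 2 * 2 powr (k * (2 - \<epsilon> / 2))" unfolding range_scale_def using ge1 by linarith
  have "k * (2 - \<epsilon> / 2) \<le> real (2 * k)" using mult_left_mono[of "2 - \<epsilon> / 2" 2 "real k"] assms by simp
  then have "(2 :: real) powr (k * (2 - \<epsilon> / 2)) \<le> 2 powr real (2 * k)" by (intro powr_mono) auto
  also have "\<dots> = 4 ^ k" by (simp add: powr_realpow power_mult del: of_nat_mult)
  finally show "range_scale \<epsilon> k \<le> 2 * (4 :: real) ^ k" using le2 by linarith
  show "0 < range_scale \<epsilon> k" using le ge1 by linarith
qed

lemma powr_scale: "(2 :: real) powr (k * (2 - \<epsilon> / 2)) = 4 ^ k * (2 powr (- \<epsilon> / 2)) ^ k"
proof -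
  have "(2 :: real) powr (k * (2 - \<epsilon> / 2)) = 2 powr (real (2 * k) + real k * (- \<epsilon> / 2))" by (simp add: algebra_simps)
  also have "\<dots> = 2 powr real (2 * k) * 2 powr (real k * (- \<epsilon> / 2))" by (rule powr_add)
  also have "2 powr (real k * (- \<epsilon> / 2)) = (2 powr (- \<epsilon> / 2)) ^ k" by (simp add: powr_power mult.commute)
  also have "(2 :: real) powr real (2 * k) = 4 ^ k" by (simp add: powr_realpow power_mult del: of_nat_mult)
  finally show ?thesis .
qed

lemma summable_scale: "0 < \<epsilon> \<Longrightarrow> summable (\<lambda>k. C * (2 powr (- \<epsilon> / 2)) ^ k :: real)"
  by (intro summable_mult summable_geometric) (simp add: powr_less_one)

text \<open>The potential up to the distance \<open>L\<close> is of order \<open>sqrt L\<close>, which is smaller than \<open>2 ^ k\<close> by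
  the factor \<open>2 powr (- k * \<epsilon> / 4)\<close>; the squares of these factors are summable, as the
  Borel--Cantelli lemma needs.\<close>
lemma AE_potential_small:
  assumes \<epsilon>: "0 < \<epsilon>" "\<epsilon> \<le> 1"
  shows "AE z in Fields. \<forall>\<^sub>F k in sequentially. \<forall>x. \<bar>x\<bar> \<le> int (range_scale \<epsilon> k) \<longrightarrow> \<bar>potential (fst z) x\<bar> \<le> 2 ^ k / 8"
proof -
  let ?A = "\<lambda>k. {z :: (int \<Rightarrow> real) \<times> (int \<Rightarrow> real). \<exists>x. \<bar>x\<bar> \<le> int (range_scale \<epsilon> k) \<and> 2 ^ k / 8 \<le> \<bar>potential (fst z) x\<bar>}"
  have A: "?A k \<in> sets Fields" for k by (rule prob_potential_large) simp
  have "measure Fields (?A k) \<le> 256 * \<sigma>\<^sup>2 * (2 powr (- \<epsilon> / 2)) ^ k" for k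
  proof -
    have "measure Fields (?A k) \<le> 2 * (range_scale \<epsilon> k * \<sigma>\<^sup>2 / (2 ^ k / 8)\<^sup>2)" by (rule prob_potential_large) simp
    also have "\<dots> = 128 * \<sigma>\<^sup>2 * (range_scale \<epsilon> k / 4 ^ k)"
      by (simp add: power_divide power2_eq_square field_simps flip: power_mult_distrib)
    also have "\<dots> \<le> 128 * \<sigma>\<^sup>2 * (2 * (4 ^ k * (2 powr (- \<epsilon> / 2)) ^ k) / 4 ^ k)"
      using range_scale(2)[OF \<epsilon>, of k] by (intro mult_left_mono divide_right_mono) (auto simp: powr_scale)
    also have "\<dots> = 256 * \<sigma>\<^sup>2 * (2 powr (- \<epsilon> / 2)) ^ k" by simp
    finally show ?thesis .
  qed
  then have "summable (\<lambda>k. measure Fields (?A k))"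
    by (intro summable_comparison_test'[OF summable_scale[OF \<epsilon>(1)], where N = 0]) auto
  then have "AE z in Fields. \<forall>\<^sub>F k in sequentially. z \<in> space Fields - ?A k"
    by (intro borel_cantelli_AE1 A) (simp_all add: ES.emeasure_eq_measure)
  then show ?thesis
  proof eventually_elim
    case (elim z)
    then show ?case
    proof eventually_elim
      case (elim k)
      then have "\<bar>potential (fst z) x\<bar> < 2 ^ k / 8" if "\<bar>x\<bar> \<le> int (range_scale \<epsilon> k)" for x
        using that by (simp only: Diff_iff mem_Collect_eq not_ex de_Morgan_conj not_le) (meson not_le)
      then show ?case by (auto intro: less_imp_le)
    qed
  qed
qed

text \<open>The expected exit time is at most polynomial in \<open>2 ^ k\<close> times \<open>exp (2 ^ k / 4)\<close>, while the
  available time \<open>2 ^ 2 ^ k\<close> is at least \<open>exp (2 ^ k / 2)\<close>.\<close>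
lemma AE_quenched_exits:
  assumes \<epsilon>: "0 < \<epsilon>" "\<epsilon> \<le> 1" and \<omega>: "\<And>x. \<delta> \<le> \<omega> x \<and> \<omega> x \<le> 1 - \<delta>"
    and V: "\<forall>\<^sub>F k in sequentially. \<forall>x. \<bar>x\<bar> \<le> int (range_scale \<epsilon> k) \<longrightarrow> \<bar>potential \<omega> x\<bar> \<le> 2 ^ k / 8"
  shows "AE X in quenched_law \<omega>. \<forall>\<^sub>F k in sequentially. \<exists>i\<le>2 ^ 2 ^ k. int (range_scale \<epsilon> k) \<le> \<bar>X i\<bar>"
proof -
  interpret Q: prob_space "quenched_law \<omega>" by (rule prob_space_quenched_law)
  let ?L = "\<lambda>k. int (range_scale \<epsilon> k)"
  let ?A = "\<lambda>k. {X \<in> space (quenched_law \<omega>). \<forall>i\<le>2 ^ 2 ^ k. X i \<in> {- ?L k<..<?L k}}"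
  have A: "?A k \<in> sets (quenched_law \<omega>)" for k
  proof -
    have "?A k = space (quenched_law \<omega>) - {X \<in> space (quenched_law \<omega>). \<exists>i\<le>2 ^ 2 ^ k. X i \<notin> {- ?L k<..<?L k}}" by blast
    then show ?thesis using sets.compl_sets[OF sets_quenched_exit] by simp
  qed
  define C where "C = 8 * (1 + exp c)"
  have C: "0 < C" by (simp add: C_def add_pos_pos)
  have "((\<lambda>x :: real. x ^ 5 * exp (- x / 4)) \<longlongrightarrow> 0) at_top" by real_asymp
  moreover have "filterlim (\<lambda>k :: nat. (2 :: real) ^ k) at_top sequentially" by real_asymp
  ultimately have "((\<lambda>k :: nat. ((2 :: real) ^ k) ^ 5 * exp (- (2 ^ k) / 4)) \<longlongrightarrow> 0) sequentially"
    by (rule filterlim_compose)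
  then have "\<forall>\<^sub>F k :: nat in sequentially. ((2 :: real) ^ k) ^ 5 * exp (- (2 ^ k) / 4) < 1"
    by (rule order_tendstoD(2)) simp
  then have "\<forall>\<^sub>F k in sequentially. norm (measure (quenched_law \<omega>) (?A k)) \<le> C * (1 / 2) ^ k"
    using V
  proof eventually_elim
    case (elim k)
    have "emeasure (quenched_law \<omega>) (?A k) \<le> ennreal (2 * (real_of_int (?L k))\<^sup>2 * (1 + exp c) * exp (2 * (2 ^ k / 8)) / real (2 ^ 2 ^ k))"
      using elim(2) range_scale(4)[OF \<epsilon>, of k] by (intro quenched_exit_time[OF \<omega>]) auto
    then have "measure (quenched_law \<omega>) (?A k) \<le> 2 * (real (range_scale \<epsilon> k))\<^sup>2 * (1 + exp c) * exp (2 * (2 ^ k / 8)) / real (2 ^ 2 ^ k)"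
      by (subst (asm) Q.emeasure_eq_measure) (simp add: ennreal_le_iff add_nonneg_nonneg)
    also have "\<dots> \<le> 2 * (2 * 4 ^ k)\<^sup>2 * (1 + exp c) * exp (2 ^ k / 4) / real (2 ^ 2 ^ k)"
      using range_scale(3)[OF \<epsilon>, of k] by (intro divide_right_mono mult_mono mult_left_mono power_mono) (auto simp: add_nonneg_nonneg)
    also have "\<dots> \<le> 2 * (2 * 4 ^ k)\<^sup>2 * (1 + exp c) * exp (- (2 ^ k) / 4)"
    proof -
      have "exp (1 / 2 :: real) \<le> 2"
      proof (rule power2_le_imp_le)
        show "(exp (1 / 2))\<^sup>2 \<le> (2 :: real)\<^sup>2" using exp_le by (simp flip: exp_of_nat_mult)
      qed simp
      then have "exp (1 / 2 :: real) ^ 2 ^ k \<le> 2 ^ 2 ^ k" by (intro power_mono) auto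
      then have "exp (2 ^ k / 2 :: real) \<le> 2 ^ 2 ^ k" by (simp flip: exp_of_nat_mult)
      then have "exp (2 ^ k / 4) * exp (2 ^ k / 4 :: real) \<le> 2 ^ 2 ^ k" by (simp flip: exp_add)
      then have "exp (2 ^ k / 4) / real (2 ^ 2 ^ k) \<le> exp (- (2 ^ k) / 4)" by (simp add: exp_minus field_simps)
      from mult_left_mono[OF this, of "2 * (2 * 4 ^ k)\<^sup>2 * (1 + exp c)"] show ?thesis by (simp add: add_nonneg_nonneg)
    qed
    also have "\<dots> = C * (((2 :: real) ^ k) ^ 5 * exp (- (2 ^ k) / 4)) * (1 / 2) ^ k"
    proof -
      have "((4 :: real) ^ k)\<^sup>2 = ((2 :: real) ^ k) ^ 4"
        by (simp add: power2_eq_square power4_eq_xxxx flip: power_mult_distrib)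
      moreover have "((2 :: real) ^ k) ^ 5 * (1 / 2) ^ k = ((2 :: real) ^ k) ^ 4"
        by (simp add: power_one_over power_numeral_reduce)
      ultimately show ?thesis by (simp add: C_def power_mult_distrib)
    qed
    also have "\<dots> \<le> C * 1 * (1 / 2) ^ k" using elim(1) C by (intro mult_right_mono mult_left_mono) auto
    finally show ?case by simp
  qed
  then have "summable (\<lambda>k. measure (quenched_law \<omega>) (?A k))"
    by (rule summable_comparison_test_ev) (intro summable_mult summable_geometric, simp)
  then have "AE X in quenched_law \<omega>. \<forall>\<^sub>F k in sequentially. X \<in> space (quenched_law \<omega>) - ?A k"
    by (intro borel_cantelli_AE1 A) (simp_all add: Q.emeasure_eq_measure)
  then show ?thesis
  proof eventually_elim
    case (elim X)
    then show ?case
    proof eventually_elim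
      case (elim k)
      then obtain i where "i \<le> 2 ^ 2 ^ k" "X i \<notin> {- ?L k<..<?L k}" by blast
      then show ?case by (intro exI[of _ i]) auto
    qed
  qed
qed

text \<open>The logarithm of the required value is of order \<open>2 ^ k\<close>, so one site has it with a probability
  of order at least \<open>2 powr (- k * (2 - \<epsilon>))\<close>.  With \<open>range_scale \<epsilon> k\<close> independent sites the
  expected number of such sites grows geometrically in \<open>k\<close>.\<close>
lemma AE_deep_site:
  assumes \<epsilon>: "0 < \<epsilon>" "\<epsilon> \<le> 1"
    and tail: "\<forall>\<^sub>F s in at_top. 1 / ln s powr (2 - \<epsilon>) \<le> measure \<rho> {x. s < max (- x) 0}"
    and sg: "sg = 1 \<or> sg = - 1"
  shows "AE z in Fields. \<forall>\<^sub>F k in sequentially. \<exists>x\<in>{1..int (range_scale \<epsilon> k)}. snd z (sg * x) \<le> - (2 ^ k * 2 ^ 2 ^ Suc k)"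
proof -
  define s where "s k = (2 :: real) ^ k * 2 ^ 2 ^ Suc k" for k :: nat
  let ?S = "\<lambda>k. {1..int (range_scale \<epsilon> k)}"
  let ?A = "\<lambda>k. {z :: (int \<Rightarrow> real) \<times> (int \<Rightarrow> real). \<forall>x\<in>?S k. - s k < snd z (sg * x)}"
  have single: "{z. fst z i \<in> UNIV \<and> snd z i \<in> {- t<..}} \<in> sets Fields"
    "measure Fields {z. fst z i \<in> UNIV \<and> snd z i \<in> {- t<..}} = measure \<rho> {- t<..}" for i t
    using prob_single_site[of UNIV "{- t<..}" i] E0.prob_space by (simp_all add: space_env)
  have ne: "?S k \<noteq> {}" for k using range_scale(4)[OF \<epsilon>, of k] by auto
  have Aeq: "?A k = (\<Inter>x\<in>?S k. {z. fst z (sg * x) \<in> UNIV \<and> snd z (sg * x) \<in> {- s k<..}})" for k by auto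
  have A: "?A k \<in> sets Fields" for k
    unfolding Aeq using ne single by (intro sets.finite_INT) auto
  have PA: "measure Fields (?A k) = measure \<rho> {- s k<..} ^ range_scale \<epsilon> k" for k
  proof -
    have "measure Fields (?A k) = (\<Prod>x\<in>?S k. measure Fields {z. fst z (sg * x) \<in> UNIV \<and> snd z (sg * x) \<in> {- s k<..}})"
      unfolding Aeq
    proof (rule prob_INT_determined[where K = "\<lambda>x. {sg * x}"])
      show "disjoint_family_on (\<lambda>x. {sg * x}) (?S k)" using sg by (auto simp: disjoint_family_on_def)
      show "determined_by {sg * x} {z. fst z (sg * x) \<in> UNIV \<and> snd z (sg * x) \<in> {- s k<..}}" for x
        by (rule determined_byI) auto
    qed (use ne single in auto)
    then show ?thesis by (simp only: single prod_constant) simp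
  qed
  have s_lim: "filterlim s at_top sequentially"
  proof (rule filterlim_at_top_mono)
    show "filterlim (\<lambda>k :: nat. (2 :: real) ^ k) at_top sequentially" by real_asymp
    have "(2 :: real) ^ k * 1 \<le> s k" for k unfolding s_def by (intro mult_left_mono) (auto simp: one_le_power)
    then show "\<forall>\<^sub>F k in sequentially. (2 :: real) ^ k \<le> s k" by simp
  qed
  have "\<forall>\<^sub>F k in sequentially. 1 / ln (s k) powr (2 - \<epsilon>) \<le> measure \<rho> {x. s k < max (- x) 0}"
    using filterlim_iff[THEN iffD1, OF s_lim, rule_format, OF tail] .
  then have "\<forall>\<^sub>F k in sequentially. norm (measure Fields (?A k)) \<le> 16 * (2 powr (- \<epsilon> / 2)) ^ k"
  proof eventually_elim
    case (elim k)
    define q where "q = measure \<rho> {x. s k < max (- x) 0}"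
    have s0: "1 \<le> s k" unfolding s_def using mult_mono[of 1 "(2 :: real) ^ k" 1 "2 ^ 2 ^ Suc k"] by (simp add: one_le_power)
    have compl: "measure \<rho> {- s k<..} \<le> 1 - q"
    proof -
      have e: "{x. s k < max (- x) 0} = {..<- s k}" using s0 by auto
      have "measure \<rho> {- s k<..} \<le> measure \<rho> (space \<rho> - {..<- s k})"
        by (intro E0.finite_measure_mono S0.finite_measure_mono) (auto simp: space_scen sets_scen)
      also have "\<dots> = 1 - measure \<rho> {..<- s k}" by (rule S0.prob_compl) (simp add: sets_scen)
      finally show ?thesis unfolding q_def e .
    qed
    have ln0: "0 < ln (s k)"
    proof -
      have "1 < s k" unfolding s_def using mult_mono[of 1 "(2 :: real) ^ k" "2" "2 ^ 2 ^ Suc k"] self_le_power[of "2 :: real" "2 ^ Suc k"]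
        by (simp add: one_le_power)
      then show ?thesis by simp
    qed
    have ln_s: "ln (s k) \<le> 4 * 2 ^ k"
    proof -
      have "ln (s k) = (real k + real (2 ^ Suc k)) * ln 2" unfolding s_def
        by (simp add: ln_mult ln_realpow distrib_right del: power_Suc)
      also have "\<dots> \<le> (real k + real (2 ^ Suc k)) * 1" by (intro mult_left_mono) (use ln_2_less_1 in auto)
      also have "\<dots> \<le> 4 * 2 ^ k"
      proof -
        have "real k < 2 ^ k" by (rule of_nat_less_two_power)
        then have "real k + 2 * 2 ^ k \<le> 4 * 2 ^ k" by linarith
        then show ?thesis by simp
      qed
      finally show ?thesis .
    qed
    have q_low: "1 / (4 * 2 ^ k) powr (2 - \<epsilon>) \<le> q"
    proof -
      have "1 / (4 * 2 ^ k) powr (2 - \<epsilon>) \<le> 1 / ln (s k) powr (2 - \<epsilon>)"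
        using ln_s ln0 \<epsilon> by (intro divide_left_mono powr_mono2) auto
      then show ?thesis using elim by (simp add: q_def)
    qed
    have q_pos: "0 < q" using q_low by (rule less_le_trans[rotated]) simp
    have q1: "q \<le> 1" by (simp add: q_def)
    have "(4 * 2 ^ k) powr (2 - \<epsilon>) \<le> (16 :: real) * (2 powr (k * (2 - \<epsilon>)))"
    proof -
      have "(4 :: real) powr (2 - \<epsilon>) \<le> 4 powr 2" using \<epsilon> by (intro powr_mono) auto
      moreover have "((2 :: real) ^ k) powr (2 - \<epsilon>) = 2 powr (k * (2 - \<epsilon>))" by (simp add: powr_powr flip: powr_realpow)
      ultimately show ?thesis by (simp add: powr_mult mult_right_mono)
    qed
    moreover have "2 powr (k * (2 - \<epsilon>)) = (2 :: real) powr (k * (2 - \<epsilon> / 2)) * (2 powr (- \<epsilon> / 2)) ^ k"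
      by (simp add: powr_power algebra_simps flip: powr_add)
    ultimately have "(4 * 2 ^ k) powr (2 - \<epsilon>) \<le> 2 powr (k * (2 - \<epsilon> / 2)) * (16 * (2 powr (- \<epsilon> / 2)) ^ k)"
      by simp
    also have "\<dots> \<le> range_scale \<epsilon> k * (16 * (2 powr (- \<epsilon> / 2)) ^ k)"
      by (rule mult_right_mono[OF range_scale(1)[OF \<epsilon>]]) simp
    finally have "(4 * 2 ^ k) powr (2 - \<epsilon>) \<le> range_scale \<epsilon> k * (16 * (2 powr (- \<epsilon> / 2)) ^ k)" .
    then have "1 / (range_scale \<epsilon> k * (16 * (2 powr (- \<epsilon> / 2)) ^ k)) \<le> 1 / (4 * 2 ^ k) powr (2 - \<epsilon>)"
      by (intro divide_left_mono mult_pos_pos) (auto simp: range_scale(4)[OF \<epsilon>])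
    then have "1 / (range_scale \<epsilon> k * (16 * (2 powr (- \<epsilon> / 2)) ^ k)) \<le> q" using q_low by linarith
    then have qL: "1 / (range_scale \<epsilon> k * q) \<le> 16 * (2 powr (- \<epsilon> / 2)) ^ k"
      using q_pos range_scale(4)[OF \<epsilon>, of k] by (simp add: field_simps)
    have "measure Fields (?A k) \<le> (1 - q) ^ range_scale \<epsilon> k" unfolding PA using compl by (intro power_mono) auto
    also have "\<dots> \<le> exp (- q) ^ range_scale \<epsilon> k" using q1 exp_ge_add_one_self[of "- q"] by (intro power_mono) auto
    also have "\<dots> = exp (- (range_scale \<epsilon> k * q))" by (simp flip: exp_of_nat_mult)
    also have "\<dots> \<le> 1 / (range_scale \<epsilon> k * q)"
    proof -
      have p: "0 < range_scale \<epsilon> k * q" using q_pos range_scale(4)[OF \<epsilon>, of k] by simp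
      have "range_scale \<epsilon> k * q \<le> exp (range_scale \<epsilon> k * q)" using exp_ge_add_one_self[of "range_scale \<epsilon> k * q"] by linarith
      then have "1 / exp (range_scale \<epsilon> k * q) \<le> 1 / (range_scale \<epsilon> k * q)" using p by (intro divide_left_mono) auto
      then show ?thesis by (simp add: exp_minus field_simps)
    qed
    finally show ?case using qL by simp
  qed
  then have "summable (\<lambda>k. measure Fields (?A k))"
    by (rule summable_comparison_test_ev) (rule summable_scale[OF \<epsilon>(1)])
  then have "AE z in Fields. \<forall>\<^sub>F k in sequentially. z \<in> space Fields - ?A k"
    by (intro borel_cantelli_AE1 A) (simp_all add: ES.emeasure_eq_measure)
  then show ?thesis
  proof eventually_elim
    case (elim z)
    then show ?case by eventually_elim (auto simp: not_less s_def)
  qed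
qed

proposition AE_averages_diverge:
  assumes \<epsilon>: "0 < \<epsilon>" "\<epsilon> \<le> 1"
    and tail: "\<forall>\<^sub>F s in at_top. 1 / ln s powr (2 - \<epsilon>) \<le> measure \<rho> {x. s < max (- x) 0}"
    and a: "0 \<le> a" "AE z in Fields. \<forall>x. snd z x \<le> a"
  shows "AE z in Fields. AE X in quenched_law (fst z). LIM n sequentially. walk_in_scenery (snd z) X n / real n :> at_bot"
  using a(2) AE_elliptic AE_potential_small[OF \<epsilon>] AE_deep_site[OF \<epsilon> tail, of 1, simplified] AE_deep_site[OF \<epsilon> tail, of "- 1", simplified]
proof eventually_elim
  case (elim z)
  have "AE X in quenched_law (fst z). \<forall>\<^sub>F k in sequentially. \<exists>i\<le>2 ^ 2 ^ k. int (range_scale \<epsilon> k) \<le> \<bar>X i\<bar>"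
    using elim(2) by (intro AE_quenched_exits \<epsilon> elim(3)) blast
  then show ?case using AE_quenched_nearest_neighbour
  proof eventually_elim
    case walk: (elim X)
    show ?case
    proof (rule walk_in_scenery_diverges[OF _ a(1)])
      show "snd z x \<le> a" for x using elim(1) by blast
      show "\<forall>\<^sub>F k in sequentially. \<exists>j\<le>2 ^ 2 ^ k. snd z (X j) \<le> - (2 ^ k * 2 ^ 2 ^ Suc k)"
        using walk(1) elim(4,5)
      proof eventually_elim
        case k: (elim k)
        obtain i where i: "i \<le> 2 ^ 2 ^ k" "int (range_scale \<epsilon> k) \<le> \<bar>X i\<bar>" using k(1) by blast
        obtain x1 where x1: "x1 \<in> {1..int (range_scale \<epsilon> k)}" "snd z x1 \<le> - (2 ^ k * 2 ^ 2 ^ Suc k)" using k(2) by auto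
        obtain x2 where x2: "x2 \<in> {1..int (range_scale \<epsilon> k)}" "snd z (- x2) \<le> - (2 ^ k * 2 ^ 2 ^ Suc k)" using k(3) by auto
        have "(\<forall>x\<in>{1..int (range_scale \<epsilon> k)}. \<exists>j\<le>i. X j = x) \<or> (\<forall>x\<in>{1..int (range_scale \<epsilon> k)}. \<exists>j\<le>i. X j = - x)"
          using walk(2) i(2) by (intro nearest_neighbour_visits) auto
        then obtain j where "j \<le> i" "X j = x1 \<or> X j = - x2" using x1(1) x2(1) by blast
        then show ?case using x1(2) x2(2) i(1) by (intro exI[of _ j]) auto
      qed
    qed
  qed
qed

end

section \<open>From almost every environment and scenery to the joint law\<close>

lemma iid_law_product:
  assumes "iid_law P"
  shows "P = PiM UNIV (\<lambda>_. distr P borel (\<lambda>\<omega>. \<omega> 0))" "(\<lambda>\<omega>. \<omega> i) \<in> borel_measurable P"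
proof -
  interpret P: prob_space P using assms by (simp add: iid_law_def)
  have sets: "sets P = sets real_fields" using assms by (simp add: iid_law_def)
  show m: "(\<lambda>\<omega>. \<omega> i) \<in> borel_measurable P" for i
    by (simp add: measurable_cong_sets[OF sets refl])
  have law: "distr P borel (\<lambda>\<omega>. \<omega> i) = distr P borel (\<lambda>\<omega>. \<omega> 0)" for i
    using assms unfolding iid_law_def by blast
  have "P.indep_vars (\<lambda>_. borel) (\<lambda>i \<omega>. \<omega> i) UNIV" using assms by (simp add: iid_law_def)
  then have "distr P real_fields (\<lambda>x. \<lambda>i\<in>UNIV. x i) = PiM UNIV (\<lambda>i. distr P borel (\<lambda>\<omega>. \<omega> i))"
    using m by (subst (asm) P.indep_vars_iff_distr_eq_PiM) auto
  also have "distr P real_fields (\<lambda>x. \<lambda>i\<in>UNIV. x i) = P" by (simp add: restrict_UNIV distr_id2 sets)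
  also have "PiM UNIV (\<lambda>i. distr P borel (\<lambda>\<omega>. \<omega> i)) = PiM UNIV (\<lambda>_. distr P borel (\<lambda>\<omega>. \<omega> 0))"
    by (intro arg_cong[where f = "PiM UNIV"] ext law)
  finally show "P = PiM UNIV (\<lambda>_. distr P borel (\<lambda>\<omega>. \<omega> 0))" .
qed

text \<open>The annealed law is a mixture of quenched laws, so that almost sure statements about it split
  into the environment and the walk for a fixed scenery.  Hence the scenery is integrated last.\<close>
lemma measure_annealed_eq_1:
  assumes P: "prob_space P" "sets P = sets real_fields" and Q: "prob_space Q" "sets Q = sets real_fields"
    and meas: "{p \<in> space (annealed_law P \<Otimes>\<^sub>M Q). \<Phi> (fst (fst p)) (snd (fst p)) (snd p)} \<in> sets (annealed_law P \<Otimes>\<^sub>M Q)"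
    and AE: "AE z in P \<Otimes>\<^sub>M Q. AE X in quenched_law (fst z). \<Phi> (fst z) X (snd z)"
  shows "measure (annealed_law P \<Otimes>\<^sub>M Q) {p \<in> space (annealed_law P \<Otimes>\<^sub>M Q). \<Phi> (fst (fst p)) (snd (fst p)) (snd p)} = 1"
proof -
  interpret P: prob_space P by fact
  interpret Q: prob_space Q by fact
  interpret A: prob_space "annealed_law P" by (rule prob_space_annealed_law[OF P])
  interpret AQ: pair_prob_space "annealed_law P" Q ..
  interpret QA: pair_prob_space Q "annealed_law P" ..
  interpret PQ: pair_prob_space P Q ..
  interpret QP: pair_prob_space Q P ..
  note setsA = sets_annealed_law[OF P]
  have swapPQ: "distr (Q \<Otimes>\<^sub>M P) (P \<Otimes>\<^sub>M Q) (\<lambda>(x, y). (y, x)) = P \<Otimes>\<^sub>M Q"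
    by (rule PQ.distr_pair_swap[symmetric])
  have "AE y in Q \<Otimes>\<^sub>M P. AE X in quenched_law (snd y). \<Phi> (snd y) X (fst y)"
  proof -
    have "AE z in distr (Q \<Otimes>\<^sub>M P) (P \<Otimes>\<^sub>M Q) (\<lambda>(x, y). (y, x)). AE X in quenched_law (fst z). \<Phi> (fst z) X (snd z)"
      unfolding swapPQ by (rule AE)
    from AE_distrD[OF measurable_pair_swap' this, unfolded case_prod_unfold fst_conv snd_conv] show ?thesis .
  qed
  from QP.AE_pair[OF this, unfolded fst_conv snd_conv]
  have "AE \<xi> in Q. AE \<omega> in P. AE X in quenched_law \<omega>. \<Phi> \<omega> X \<xi>" .
  then have 1: "AE \<xi> in Q. AE p in annealed_law P. \<Phi> (fst p) (snd p) \<xi>"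
    using AE_space[of Q]
  proof eventually_elim
    case (elim \<xi>)
    have sec: "{p \<in> space (real_fields \<Otimes>\<^sub>M trajectories). \<Phi> (fst p) (snd p) \<xi>} \<in> sets (real_fields \<Otimes>\<^sub>M trajectories)"
    proof -
      have "(\<lambda>p. (p, \<xi>)) -` {p \<in> space (annealed_law P \<Otimes>\<^sub>M Q). \<Phi> (fst (fst p)) (snd (fst p)) (snd p)} \<inter> space (annealed_law P) \<in> sets (annealed_law P)"
        using elim(2) by (intro measurable_sets[OF _ meas] measurable_Pair) auto
      moreover have "(\<lambda>p. (p, \<xi>)) -` {p \<in> space (annealed_law P \<Otimes>\<^sub>M Q). \<Phi> (fst (fst p)) (snd (fst p)) (snd p)} \<inter> space (annealed_law P) =
          {p \<in> space (annealed_law P). \<Phi> (fst p) (snd p) \<xi>}"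
        using elim(2) by (auto simp: space_pair_measure)
      ultimately show ?thesis using setsA sets_eq_imp_space_eq[OF setsA] by simp
    qed
    have kern: "(\<lambda>\<omega>. distr (quenched_law \<omega>) (real_fields \<Otimes>\<^sub>M trajectories) (\<lambda>X. (\<omega>, X))) \<in> P \<rightarrow>\<^sub>M subprob_algebra (real_fields \<Otimes>\<^sub>M trajectories)"
      using measurable_prob_algebraD[OF measurable_quenched_law_Pair] by (simp only: measurable_cong_sets[OF P(2) refl])
    have "(AE p in annealed_law P. \<Phi> (fst p) (snd p) \<xi>) \<longleftrightarrow>
        (AE \<omega> in P. AE p in distr (quenched_law \<omega>) (real_fields \<Otimes>\<^sub>M trajectories) (\<lambda>X. (\<omega>, X)). \<Phi> (fst p) (snd p) \<xi>)"
      unfolding annealed_law_def by (rule AE_bind[OF kern]) (use sec in \<open>simp add: pred_def\<close>)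
    also have "\<dots> \<longleftrightarrow> (AE \<omega> in P. AE X in quenched_law \<omega>. \<Phi> \<omega> X \<xi>)"
    proof (rule AE_cong)
      fix \<omega> assume "\<omega> \<in> space P"
      then have "\<omega> \<in> space real_fields" using sets_eq_imp_space_eq[OF P(2)] by simp
      then have m: "(\<lambda>X. (\<omega>, X)) \<in> quenched_law \<omega> \<rightarrow>\<^sub>M real_fields \<Otimes>\<^sub>M trajectories"
        by (simp only: measurable_cong_sets[OF sets_quenched_law refl]) (intro measurable_Pair measurable_const measurable_ident_sets, auto)
      show "(AE p in distr (quenched_law \<omega>) (real_fields \<Otimes>\<^sub>M trajectories) (\<lambda>X. (\<omega>, X)). \<Phi> (fst p) (snd p) \<xi>) \<longleftrightarrow>
          (AE X in quenched_law \<omega>. \<Phi> \<omega> X \<xi>)"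
        by (subst AE_distr_iff[OF m sec]) simp
    qed
    finally show ?case using elim(1) by simp
  qed
  have "AE p in Q \<Otimes>\<^sub>M annealed_law P. \<Phi> (fst (snd p)) (snd (snd p)) (fst p)"
  proof (rule QA.AE_pair_measure)
    have "(\<lambda>(x, y). (y, x)) -` {p \<in> space (annealed_law P \<Otimes>\<^sub>M Q). \<Phi> (fst (fst p)) (snd (fst p)) (snd p)} \<inter> space (Q \<Otimes>\<^sub>M annealed_law P) \<in> sets (Q \<Otimes>\<^sub>M annealed_law P)"
      by (intro measurable_sets[OF measurable_pair_swap' meas])
    also have "(\<lambda>(x, y). (y, x)) -` {p \<in> space (annealed_law P \<Otimes>\<^sub>M Q). \<Phi> (fst (fst p)) (snd (fst p)) (snd p)} \<inter> space (Q \<Otimes>\<^sub>M annealed_law P) =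
        {p \<in> space (Q \<Otimes>\<^sub>M annealed_law P). \<Phi> (fst (snd p)) (snd (snd p)) (fst p)}"
      by (auto simp: space_pair_measure)
    finally show "{p \<in> space (Q \<Otimes>\<^sub>M annealed_law P). \<Phi> (fst (snd p)) (snd (snd p)) (fst p)} \<in> sets (Q \<Otimes>\<^sub>M annealed_law P)" .
  qed (use 1 in simp)
  then have "AE p in distr (annealed_law P \<Otimes>\<^sub>M Q) (Q \<Otimes>\<^sub>M annealed_law P) (\<lambda>(x, y). (y, x)). \<Phi> (fst (snd p)) (snd (snd p)) (fst p)"
    unfolding QA.distr_pair_swap[symmetric] .
  from AE_distrD[OF measurable_pair_swap' this, unfolded case_prod_unfold fst_conv snd_conv]
  have "AE p in annealed_law P \<Otimes>\<^sub>M Q. \<Phi> (fst (fst p)) (snd (fst p)) (snd p)" .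
  then show ?thesis using meas by (subst AQ.prob_Collect_eq_1) auto
qed

text \<open>With countably many bounds the event of divergence is measurable.\<close>
lemma filterlim_at_bot_nat_iff:
  fixes f :: "'a \<Rightarrow> real"
  shows "filterlim f at_bot F \<longleftrightarrow> (\<forall>k :: nat. \<forall>\<^sub>F x in F. f x \<le> - real k)"
proof
  assume r: "\<forall>k :: nat. \<forall>\<^sub>F x in F. f x \<le> - real k"
  show "filterlim f at_bot F"
    unfolding filterlim_at_bot
  proof
    fix C :: real
    obtain k :: nat where "- C < real k" using reals_Archimedean2 by blast
    then show "\<forall>\<^sub>F x in F. f x \<le> C" using spec[OF r, of k] by (auto elim!: eventually_mono)
  qed
qed (simp add: filterlim_at_bot)

lemma measurable_walk_in_scenery:
  assumes A: "sets A = sets (real_fields \<Otimes>\<^sub>M trajectories)" and Q: "sets Q = sets real_fields"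
  shows "(\<lambda>p. walk_in_scenery (snd p) (snd (fst p)) n) \<in> borel_measurable (A \<Otimes>\<^sub>M Q)"
proof -
  have s: "sets (A \<Otimes>\<^sub>M Q) = sets ((real_fields \<Otimes>\<^sub>M trajectories) \<Otimes>\<^sub>M real_fields)"
    by (rule sets_pair_measure_cong[OF A Q])
  have pos: "(\<lambda>p. snd (fst p) i) \<in> (real_fields \<Otimes>\<^sub>M trajectories) \<Otimes>\<^sub>M real_fields \<rightarrow>\<^sub>M count_space UNIV" for i by measurable
  have "(\<lambda>p. snd p (snd (fst p) i)) \<in> borel_measurable ((real_fields \<Otimes>\<^sub>M trajectories) \<Otimes>\<^sub>M real_fields)" for i
    by (rule measurable_compose_countable[OF _ pos, where f = "\<lambda>x p. snd p x"]) measurable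
  then have "(\<lambda>p. walk_in_scenery (snd p) (snd (fst p)) n) \<in> borel_measurable ((real_fields \<Otimes>\<^sub>M trajectories) \<Otimes>\<^sub>M real_fields)"
    unfolding walk_in_scenery_def by (intro borel_measurable_sum)
  then show ?thesis by (simp only: measurable_cong_sets[OF s refl])
qed

section \<open>Averages of a bounded scenery\<close>

text \<open>If the cost up to \<open>n\<close> is less than \<open>\<eta> * n\<close> with \<open>\<eta> = 1 / Suc k\<close>, then the sum of the first \<open>n\<close>
  scenery values is at least \<open>n * (a - 2 * \<eta>)\<close>.  The sum of the first \<open>n\<close> values is
  \<open>walk_in_scenery \<xi> X (n - 1)\<close>, which is to be divided by \<open>n - 1\<close>; the difference vanishes as
  \<open>n\<close> grows.\<close>
lemma limsup_averages_eq:
  fixes \<xi> :: "int \<Rightarrow> real" and X :: "nat \<Rightarrow> int" and a :: real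
  assumes le: "\<And>x. \<xi> x \<le> a"
    and freq: "\<And>k :: nat. \<forall>N. \<exists>n\<ge>N. (\<Sum>i<n. max 0 (a - 1 / Suc k - \<xi> (X i))) < 1 / Suc k * n"
  shows "limsup (\<lambda>n. ereal (walk_in_scenery \<xi> X n / real n)) = ereal a"
proof (rule antisym)
  have "walk_in_scenery \<xi> X n / real n \<le> a + a / real n" if "0 < n" for n
  proof -
    have "walk_in_scenery \<xi> X n \<le> real (card {..n}) * a"
      unfolding walk_in_scenery_def using le by (intro sum_bounded_above) auto
    then show ?thesis using that by (simp add: field_simps)
  qed
  then have "\<forall>\<^sub>F n in sequentially. ereal (walk_in_scenery \<xi> X n / real n) \<le> ereal (a + a / real n)"
    by (intro eventually_mono[OF eventually_gt_at_top[of "0 :: nat"]]) simp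
  then have "limsup (\<lambda>n. ereal (walk_in_scenery \<xi> X n / real n)) \<le> limsup (\<lambda>n. ereal (a + a / real n))"
    by (rule Limsup_mono)
  also have "limsup (\<lambda>n. ereal (a + a / real n)) = ereal a"
  proof (rule lim_imp_Limsup)
    have "(\<lambda>n. a + a / real n) \<longlonglongrightarrow> a + 0" by (intro tendsto_add tendsto_const lim_const_over_n)
    then show "(\<lambda>n. ereal (a + a / real n)) \<longlonglongrightarrow> ereal a" by simp
  qed simp
  finally show "limsup (\<lambda>n. ereal (walk_in_scenery \<xi> X n / real n)) \<le> ereal a" .
  show "ereal a \<le> limsup (\<lambda>n. ereal (walk_in_scenery \<xi> X n / real n))"
  proof (rule ereal_le_epsilon2)
    fix e :: real assume e: "0 < e"
    obtain k where k: "1 / real (Suc k) < e / 3" using reals_Archimedean[of "e / 3"] e by (auto simp: inverse_eq_divide)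
    define \<eta> where "\<eta> = 1 / real (Suc k)"
    have often: "\<exists>m\<ge>M. a - e \<le> walk_in_scenery \<xi> X m / real m" for M :: nat
    proof -
      obtain M' :: nat where M': "\<bar>a - 2 * \<eta>\<bar> * 3 / e < M'" using reals_Archimedean2 by blast
      obtain n where n: "n \<ge> M + M' + 2" "(\<Sum>i<n. max 0 (a - \<eta> - \<xi> (X i))) < \<eta> * n"
        using freq[of k] unfolding \<eta>_def by blast
      define m where "m = n - 1"
      have nm: "n = Suc m" "M \<le> m" "M' \<le> m" "0 < m" using n(1) by (auto simp: m_def)
      have "(\<Sum>i<n. (a - \<eta>) - max 0 (a - \<eta> - \<xi> (X i))) \<le> (\<Sum>i<n. \<xi> (X i))"
        by (intro sum_mono) auto
      then have "n * (a - \<eta>) - \<eta> * n \<le> walk_in_scenery \<xi> X m"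
        using n(2) by (simp add: walk_in_scenery_def sum_subtractf nm(1) lessThan_Suc_atMost)
      then have low: "m * (a - 2 * \<eta>) + (a - 2 * \<eta>) \<le> walk_in_scenery \<xi> X m" by (simp add: nm(1) algebra_simps)
      have "\<bar>a - 2 * \<eta>\<bar> * 3 / e < m" using M' nm(3) by linarith
      then have "\<bar>a - 2 * \<eta>\<bar> \<le> m * (e / 3)" using e by (simp add: field_simps)
      then have "- (m * (e / 3)) \<le> a - 2 * \<eta>" by linarith
      then have "m * (a - 2 * \<eta>) - m * (e / 3) \<le> walk_in_scenery \<xi> X m" using low by linarith
      moreover have "m * (a - e) \<le> m * (a - 2 * \<eta>) - m * (e / 3)"
      proof -
        have "a - e \<le> a - 2 * \<eta> - e / 3" using k by (simp add: \<eta>_def)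
        from mult_left_mono[OF this, of "real m"] show ?thesis by (simp add: right_diff_distrib)
      qed
      ultimately have "m * (a - e) \<le> walk_in_scenery \<xi> X m" by linarith
      then have "a - e \<le> walk_in_scenery \<xi> X m / real m"
        using nm(4) by (simp add: pos_le_divide_eq mult.commute)
      then show ?thesis using nm(2) by blast
    qed
    have "ereal (a - e) \<le> limsup (\<lambda>n. ereal (walk_in_scenery \<xi> X n / real n))"
      unfolding limsup_INF_SUP
    proof (rule INF_greatest)
      fix M :: nat
      obtain m where "m \<ge> M" "a - e \<le> walk_in_scenery \<xi> X m / real m" using often by blast
      then show "ereal (a - e) \<le> (SUP m\<in>{M..}. ereal (walk_in_scenery \<xi> X m / real m))"
        by (intro SUP_upper2[of m]) auto
    qed
    then have "ereal (a - e) + ereal e \<le> limsup (\<lambda>n. ereal (walk_in_scenery \<xi> X n / real n)) + ereal e"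
      by (rule add_right_mono)
    then show "ereal a \<le> limsup (\<lambda>n. ereal (walk_in_scenery \<xi> X n / real n)) + ereal e" by simp
  qed
qed

text \<open>Split at the value \<open>- exp (d / 4)\<close>.  Below it the truncated cost is at most \<open>1\<close>, with the
  probability given by the tail at the logarithm \<open>d / 4\<close>.  Above it the cost is at most
  \<open>exp (d / 2)\<close> for large \<open>d\<close>, which leaves \<open>exp (- d / 2)\<close>.  Small \<open>d\<close> are absorbed into \<open>D\<close>.\<close>
lemma truncated_tail:
  fixes \<rho> :: "real measure" and a \<eta> \<epsilon> :: real
  assumes \<rho>: "prob_space \<rho>" "sets \<rho> = sets borel" and \<epsilon>: "0 < \<epsilon>" and \<eta>: "0 \<le> \<eta>"
    and tail: "\<forall>\<^sub>F s in at_top. measure \<rho> {x. s < max (- x) 0} \<le> 1 / ln s powr (2 + \<epsilon>)"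
  shows "\<exists>D\<ge>0. \<forall>d\<ge>0. (\<integral>\<^sup>+ x. ennreal (min 1 (max 0 (a - \<eta> - x) * exp (- d))) \<partial>\<rho>) \<le> ennreal (D / (1 + d) powr (2 + \<epsilon>))"
proof -
  interpret \<rho>: prob_space \<rho> by fact
  have [measurable_cong]: "sets \<rho> = sets borel" by fact
  have sp: "space \<rho> = UNIV" using sets_eq_imp_space_eq[OF \<rho>(2)] by simp
  define p where "p = 2 + \<epsilon>"
  have p: "0 < p" using \<epsilon> by (simp add: p_def)
  let ?I = "\<lambda>d. \<integral>\<^sup>+ x. ennreal (min 1 (max 0 (a - \<eta> - x) * exp (- d))) \<partial>\<rho>"
  have lim: "filterlim (\<lambda>d :: real. exp (d / 4)) at_top at_top" by real_asymp
  have "\<forall>\<^sub>F d :: real in at_top. measure \<rho> {x. exp (d / 4) < max (- x) 0} \<le> 1 / ln (exp (d / 4)) powr (2 + \<epsilon>)"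
    using filterlim_iff[THEN iffD1, OF lim, rule_format, OF tail] .
  moreover have "\<forall>\<^sub>F d :: real in at_top. exp (d / 4) + \<bar>a\<bar> \<le> exp (d / 2)" by real_asymp
  moreover have "\<forall>\<^sub>F d :: real in at_top. exp (- d / 2) * (1 + d) powr p \<le> 1"
  proof -
    have "((\<lambda>d :: real. exp (- d / 2) * (1 + d) powr p) \<longlongrightarrow> 0) at_top" by real_asymp
    then have "\<forall>\<^sub>F d :: real in at_top. exp (- d / 2) * (1 + d) powr p < 1" by (rule order_tendstoD(2)) simp
    then show ?thesis by eventually_elim simp
  qed
  ultimately have "\<forall>\<^sub>F d :: real in at_top. ?I d \<le> ennreal ((8 powr p + 1) / (1 + d) powr p)"
    using eventually_ge_at_top[of "1 :: real"]
  proof eventually_elim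
    case (elim d)
    let ?B = "{x. exp (d / 4) < max (- x) 0}"
    have B: "?B \<in> sets \<rho>"
    proof -
      have "{x \<in> space borel. exp (d / 4) < max (- x) 0} \<in> sets borel" by measurable
      then show ?thesis by (simp add: \<rho>(2))
    qed
    have "?I d \<le> (\<integral>\<^sup>+ x. indicator ?B x + ennreal (exp (- d / 2)) \<partial>\<rho>)"
    proof (rule nn_integral_mono)
      fix x
      show "ennreal (min 1 (max 0 (a - \<eta> - x) * exp (- d))) \<le> indicator ?B x + ennreal (exp (- d / 2))"
      proof (cases "x \<in> ?B")
        case True
        have "ennreal (min 1 (max 0 (a - \<eta> - x) * exp (- d))) \<le> ennreal 1" by (intro ennreal_leI) simp
        also have "\<dots> \<le> indicator ?B x + ennreal (exp (- d / 2))" using True by simp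
        finally show ?thesis .
      next
        case False
        have "max 0 (a - \<eta> - x) \<le> exp (d / 2)" using False elim(2) \<eta> by auto
        then have "max 0 (a - \<eta> - x) * exp (- d) \<le> exp (d / 2) * exp (- d)" by (intro mult_right_mono) auto
        also have "\<dots> = exp (- d / 2)" by (simp flip: exp_add)
        finally have "min 1 (max 0 (a - \<eta> - x) * exp (- d)) \<le> exp (- d / 2)" by simp
        then show ?thesis using False by (simp add: ennreal_leI)
      qed
    qed
    also have "\<dots> = emeasure \<rho> ?B + ennreal (exp (- d / 2))"
      using B by (subst nn_integral_add) (auto simp: \<rho>.emeasure_space_1)
    also have "\<dots> = ennreal (measure \<rho> ?B + exp (- d / 2))" by (simp add: \<rho>.emeasure_eq_measure)
    also have "\<dots> \<le> ennreal ((8 powr p + 1) / (1 + d) powr p)"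
    proof (rule ennreal_leI)
      have pos: "0 < (1 + d) powr p" using elim(4) by simp
      have "(1 + d) powr p \<le> (8 * (d / 4)) powr p" using elim(4) p by (intro powr_mono2) auto
      also have "\<dots> = 8 powr p * (d / 4) powr p" by (simp only: powr_mult)
      finally have "1 / (d / 4) powr p \<le> 8 powr p / (1 + d) powr p" using pos elim(4) by (simp add: field_simps)
      moreover have "exp (- d / 2) \<le> 1 / (1 + d) powr p" using elim(3) pos by (simp add: field_simps)
      ultimately show "measure \<rho> ?B + exp (- d / 2) \<le> (8 powr p + 1) / (1 + d) powr p"
        using elim(1) by (simp add: p_def add_divide_distrib)
    qed
    finally show ?case .
  qed
  then obtain d0 where d0: "\<And>d. d0 \<le> d \<Longrightarrow> ?I d \<le> ennreal ((8 powr p + 1) / (1 + d) powr p)"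
    by (auto simp: eventually_at_top_linorder)
  define D where "D = max (8 powr p + 1) ((1 + max 0 d0) powr p)"
  have D: "0 \<le> D" by (simp add: D_def le_max_iff_disj)
  have "?I d \<le> ennreal (D / (1 + d) powr p)" if d: "0 \<le> d" for d
  proof (cases "d0 \<le> d")
    case True
    have "(8 powr p + 1) / (1 + d) powr p \<le> D / (1 + d) powr p" by (intro divide_right_mono) (auto simp: D_def)
    then show ?thesis using d0[OF True] by (meson ennreal_leI order_trans)
  next
    case False
    have "?I d \<le> (\<integral>\<^sup>+ x. ennreal 1 \<partial>\<rho>)" by (intro nn_integral_mono ennreal_leI) simp
    also have "\<dots> = ennreal 1" by (simp add: \<rho>.emeasure_space_1)
    also have "\<dots> \<le> ennreal (D / (1 + d) powr p)"
    proof (rule ennreal_leI)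
      have "(1 + d) powr p \<le> (1 + max 0 d0) powr p" using False d p by (intro powr_mono2) auto
      also have "\<dots> \<le> D" by (simp add: D_def)
      finally show "1 \<le> D / (1 + d) powr p" using d by simp
    qed
    finally show ?thesis .
  qed
  then show ?thesis using D by (auto simp: p_def)
qed

theorem theorem1p1:
  fixes P Q :: "(int \<Rightarrow> real) measure" and a :: ereal
  assumes "iid_law P"
    and "\<exists>\<delta>. 0 < \<delta> \<and> \<delta> < 1 / 2 \<and> measure P {\<omega> \<in> space P. \<delta> \<le> \<omega> 0 \<and> \<omega> 0 \<le> 1 - \<delta>} = 1"
    and "prob_space.expectation P (\<lambda>\<omega>. ln ((1 - \<omega> 0) / \<omega> 0)) = 0"
    and "prob_space.variance P (\<lambda>\<omega>. ln ((1 - \<omega> 0) / \<omega> 0)) > 0"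
    and "iid_law Q"
    and "a = esssup Q (\<lambda>\<xi>. ereal (\<xi> 0))"
    and "a < \<infinity>"
  shows
    "((\<exists>\<epsilon>>0. \<forall>\<^sub>F s in at_top.
        measure Q {\<xi> \<in> space Q. max (- \<xi> 0) 0 > s} \<le> 1 / ln s powr (2 + \<epsilon>)) \<longrightarrow>
     measure (annealed_law P \<Otimes>\<^sub>M Q)
       {((\<omega>, X), \<xi>) \<in> space (annealed_law P \<Otimes>\<^sub>M Q).
          limsup (\<lambda>n. ereal (walk_in_scenery \<xi> X n / real n)) = a} = 1) \<and>
     ((\<exists>\<epsilon>>0. \<forall>\<^sub>F s in at_top.
        measure Q {\<xi> \<in> space Q. max (- \<xi> 0) 0 > s} \<ge> 1 / ln s powr (2 - \<epsilon>)) \<longrightarrow>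
     measure (annealed_law P \<Otimes>\<^sub>M Q)
       {((\<omega>, X), \<xi>) \<in> space (annealed_law P \<Otimes>\<^sub>M Q).
          LIM n sequentially. walk_in_scenery \<xi> X n / real n :> at_bot} = 1)"
proof -
  define \<mu> where "\<mu> = distr P borel (\<lambda>\<omega>. \<omega> 0)"
  define \<rho> where "\<rho> = distr Q borel (\<lambda>\<xi>. \<xi> 0)"
  interpret P: prob_space P using assms(1) by (simp add: iid_law_def)
  interpret Q: prob_space Q using assms(5) by (simp add: iid_law_def)
  have setsP: "sets P = sets real_fields" and setsQ: "sets Q = sets real_fields"
    using assms(1,5) by (simp_all add: iid_law_def)
  note coordP = iid_law_product(2)[OF assms(1)] and coordQ = iid_law_product(2)[OF assms(5)]
  have P: "P = PiM UNIV (\<lambda>_. \<mu>)" and Q: "Q = PiM UNIV (\<lambda>_. \<rho>)"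
    unfolding \<mu>_def \<rho>_def by (rule iid_law_product(1)[OF assms(1)], rule iid_law_product(1)[OF assms(5)])
  interpret \<mu>: prob_space \<mu> unfolding \<mu>_def by (rule P.prob_space_distr[OF coordP])
  interpret \<rho>: prob_space \<rho> unfolding \<rho>_def by (rule Q.prob_space_distr[OF coordQ])
  have sets\<mu>: "sets \<mu> = sets borel" and sets\<rho>: "sets \<rho> = sets borel" by (simp_all add: \<mu>_def \<rho>_def)
  obtain \<delta> where \<delta>: "0 < \<delta>" "\<delta> < 1 / 2" "measure P {\<omega> \<in> space P. \<delta> \<le> \<omega> 0 \<and> \<omega> 0 \<le> 1 - \<delta>} = 1"
    using assms(2) by blast
  have int: "(\<integral>w. f w \<partial>\<mu>) = (\<integral>\<omega>. f (\<omega> 0) \<partial>P)" if "f \<in> borel_measurable borel" for f :: "real \<Rightarrow> real"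
    unfolding \<mu>_def using that by (intro integral_distr coordP) simp
  interpret sinai_environment \<mu> \<rho> \<delta>
  proof unfold_locales
    have "AE \<omega> in P. \<delta> \<le> \<omega> 0 \<and> \<omega> 0 \<le> 1 - \<delta>"
    proof -
      have "{\<omega> \<in> space P. \<delta> \<le> \<omega> 0 \<and> \<omega> 0 \<le> 1 - \<delta>} \<in> sets P" using coordP[of 0] by measurable
      then show ?thesis using \<delta>(3) by (subst (asm) P.prob_Collect_eq_1) auto
    qed
    then show "AE w in \<mu>. \<delta> \<le> w \<and> w \<le> 1 - \<delta>"
      unfolding \<mu>_def using coordP[of 0] by (subst AE_distr_iff) auto
    have mean: "(\<integral>\<omega>. log_ratio (\<omega> 0) \<partial>P) = 0" using assms(3) by (simp add: log_ratio_def)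
    then show "(\<integral>w. log_ratio w \<partial>\<mu>) = 0" by (subst int) auto
    have "0 < (\<integral>\<omega>. (log_ratio (\<omega> 0) - (\<integral>\<omega>. log_ratio (\<omega> 0) \<partial>P))\<^sup>2 \<partial>P)" using assms(4) by (simp add: log_ratio_def)
    then show "0 < (\<integral>w. (log_ratio w)\<^sup>2 \<partial>\<mu>)" using mean by (subst int) auto
  qed (use \<delta> sets\<mu> sets\<rho> in auto)
  have tail: "measure Q {\<xi> \<in> space Q. max (- \<xi> 0) 0 > s} = measure \<rho> {x. s < max (- x) 0}" for s
  proof -
    have "{x \<in> space borel. s < max (- x) 0} \<in> sets borel" by measurable
    then have "measure \<rho> {x. s < max (- x) 0} = measure Q ((\<lambda>\<xi>. \<xi> 0) -` {x. s < max (- x) 0} \<inter> space Q)"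
      unfolding \<rho>_def by (intro measure_distr coordQ) simp
    also have "(\<lambda>\<xi>. \<xi> 0) -` {x. s < max (- x) 0} \<inter> space Q = {\<xi> \<in> space Q. max (- \<xi> 0) 0 > s}" by auto
    finally show ?thesis ..
  qed
  have ess_meas: "(\<lambda>\<xi>. ereal (\<xi> 0)) \<in> borel_measurable Q" using coordQ[of 0] by simp
  have ess: "AE \<xi> in Q. ereal (\<xi> 0) \<le> a" unfolding assms(6) by (rule esssup_AE)
  have "a \<noteq> -\<infinity>"
  proof
    assume "a = -\<infinity>"
    with ess have "AE \<xi> in Q. False" by simp
    then show False by simp
  qed
  then obtain b where b: "a = ereal b" using assms(7) by (cases a) auto
  have AE_le: "AE z in Fields. \<forall>x. snd z x \<le> b"
  proof (subst AE_all_countable, intro allI)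
    fix x :: int
    have "AE y in \<rho>. y \<le> b" unfolding \<rho>_def using ess coordQ[of 0] by (subst AE_distr_iff) (auto simp: b)
    then have "AE \<xi> in Scen. \<xi> x \<le> b" by (intro AE_PiM_component) (auto intro: \<rho>.prob_space_axioms)
    then have "AE \<omega> in Env. AE \<xi> in Scen. \<xi> x \<le> b" by simp
    moreover have "{z \<in> space Fields. snd z x \<le> b} \<in> sets Fields" by measurable
    ultimately show "AE z in Fields. snd z x \<le> b"
      by (intro ES.AE_pair_measure) simp_all
  qed
  have setsA: "sets (annealed_law P) = sets (real_fields \<Otimes>\<^sub>M trajectories)"
    by (rule sets_annealed_law[OF P.prob_space_axioms setsP])
  have meas: "(\<lambda>p. walk_in_scenery (snd p) (snd (fst p)) n) \<in> borel_measurable (annealed_law P \<Otimes>\<^sub>M Q)" for n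
    by (rule measurable_walk_in_scenery[OF setsA setsQ])
  have transfer: "measure (annealed_law P \<Otimes>\<^sub>M Q) {((\<omega>, X), \<xi>) \<in> space (annealed_law P \<Otimes>\<^sub>M Q). \<Phi> X \<xi>} = 1"
    if "{p \<in> space (annealed_law P \<Otimes>\<^sub>M Q). \<Phi> (snd (fst p)) (snd p)} \<in> sets (annealed_law P \<Otimes>\<^sub>M Q)"
      "AE z in Fields. AE X in quenched_law (fst z). \<Phi> X (snd z)" for \<Phi> :: "(nat \<Rightarrow> int) \<Rightarrow> (int \<Rightarrow> real) \<Rightarrow> bool"
  proof -
    have "measure (annealed_law P \<Otimes>\<^sub>M Q) {p \<in> space (annealed_law P \<Otimes>\<^sub>M Q). \<Phi> (snd (fst p)) (snd p)} = 1"
    proof (rule measure_annealed_eq_1[where \<Phi> = "\<lambda>_. \<Phi>", OF P.prob_space_axioms setsP Q.prob_space_axioms setsQ that(1)])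
      show "AE z in P \<Otimes>\<^sub>M Q. AE X in quenched_law (fst z). \<Phi> X (snd z)"
        using that(2) by (simp only: P[symmetric] Q[symmetric])
    qed
    moreover have "{((\<omega>, X), \<xi>) \<in> space (annealed_law P \<Otimes>\<^sub>M Q). \<Phi> X \<xi>} = {p \<in> space (annealed_law P \<Otimes>\<^sub>M Q). \<Phi> (snd (fst p)) (snd p)}"
      by auto
    ultimately show ?thesis by simp
  qed
  show ?thesis
  proof (intro conjI impI)
    assume "\<exists>\<epsilon>>0. \<forall>\<^sub>F s in at_top. measure Q {\<xi> \<in> space Q. max (- \<xi> 0) 0 > s} \<le> 1 / ln s powr (2 + \<epsilon>)"
    then obtain \<epsilon> where \<epsilon>: "0 < \<epsilon>" "\<forall>\<^sub>F s in at_top. measure \<rho> {x. s < max (- x) 0} \<le> 1 / ln s powr (2 + \<epsilon>)"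
      unfolding tail by blast
    have freq: "AE z in Fields. AE X in quenched_law (fst z). \<forall>N. \<exists>n\<ge>N. (\<Sum>i<n. max 0 (b - 1 / Suc k - snd z (X i))) < 1 / Suc k * n" for k
    proof -
      let ?g = "\<lambda>x. max 0 (b - 1 / real (Suc k) - x)"
      obtain D where D: "0 \<le> D" "\<And>d. 0 \<le> d \<Longrightarrow> (\<integral>\<^sup>+ x. ennreal (min 1 (?g x * exp (- d))) \<partial>\<rho>) \<le> ennreal (D / (1 + d) powr (2 + \<epsilon>))"
        using truncated_tail[OF \<rho>.prob_space_axioms sets\<rho> \<epsilon>(1) _ \<epsilon>(2), of "1 / real (Suc k)" b] by auto
      interpret sinai_scenery \<mu> \<rho> \<delta> ?g D \<epsilon>
      proof unfold_locales
        have "ereal (b - 1 / Suc k) < esssup Q (\<lambda>\<xi>. ereal (\<xi> 0))" using b assms(6) by simp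
        then have "0 < emeasure Q {\<xi> \<in> space Q. ereal (b - 1 / Suc k) < ereal (\<xi> 0)}" by (rule esssup_pos_measure[OF ess_meas])
        also have "\<dots> \<le> emeasure Q ((\<lambda>\<xi>. \<xi> 0) -` {x. ?g x = 0} \<inter> space Q)"
        proof (rule emeasure_mono)
          have "{x \<in> space borel. ?g x = 0} \<in> sets borel" by measurable
          then show "(\<lambda>\<xi>. \<xi> 0) -` {x. ?g x = 0} \<inter> space Q \<in> sets Q" by (intro measurable_sets[OF coordQ]) simp
        qed auto
        also have "\<dots> = emeasure \<rho> {x. ?g x = 0}"
        proof -
          have "{x \<in> space borel. ?g x = 0} \<in> sets borel" by measurable
          then show ?thesis unfolding \<rho>_def by (intro emeasure_distr[symmetric] coordQ) simp
        qed
        finally show "0 < measure \<rho> {x. ?g x = 0}" by (simp add: \<rho>.emeasure_eq_measure)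
      qed (use D \<epsilon> in auto)
      show ?thesis by (rule AE_frequently_small_cost) simp
    qed
    have "AE z in Fields. \<forall>k. AE X in quenched_law (fst z). \<forall>N. \<exists>n\<ge>N. (\<Sum>i<n. max 0 (b - 1 / Suc k - snd z (X i))) < 1 / Suc k * n"
      by (subst AE_all_countable) (intro allI freq)
    then have "AE z in Fields. AE X in quenched_law (fst z). limsup (\<lambda>n. ereal (walk_in_scenery (snd z) X n / real n)) = a"
      using AE_le
    proof eventually_elim
      case (elim z)
      have "AE X in quenched_law (fst z). \<forall>k. \<forall>N. \<exists>n\<ge>N. (\<Sum>i<n. max 0 (b - 1 / Suc k - snd z (X i))) < 1 / Suc k * n"
        using elim(1) by (subst AE_all_countable)
      then show ?case
      proof eventually_elim
        case (elim X)
        then show ?case unfolding b using \<open>\<forall>x. snd z x \<le> b\<close> by (intro limsup_averages_eq) blast+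
      qed
    qed
    moreover have "{p \<in> space (annealed_law P \<Otimes>\<^sub>M Q). limsup (\<lambda>n. ereal (walk_in_scenery (snd p) (snd (fst p)) n / real n)) = a} \<in> sets (annealed_law P \<Otimes>\<^sub>M Q)"
    proof -
      note [measurable] = meas
      show ?thesis by measurable
    qed
    ultimately show "measure (annealed_law P \<Otimes>\<^sub>M Q) {((\<omega>, X), \<xi>) \<in> space (annealed_law P \<Otimes>\<^sub>M Q).
          limsup (\<lambda>n. ereal (walk_in_scenery \<xi> X n / real n)) = a} = 1"
      by (intro transfer)
  next
    assume "\<exists>\<epsilon>>0. \<forall>\<^sub>F s in at_top. measure Q {\<xi> \<in> space Q. max (- \<xi> 0) 0 > s} \<ge> 1 / ln s powr (2 - \<epsilon>)"
    then obtain \<epsilon> where \<epsilon>: "0 < \<epsilon>" "\<forall>\<^sub>F s in at_top. 1 / ln s powr (2 - \<epsilon>) \<le> measure \<rho> {x. s < max (- x) 0}"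
      unfolding tail by blast
    \<comment> \<open>A smaller \<open>\<epsilon>\<close> weakens the hypothesis, so \<open>\<epsilon> \<le> 1\<close> may be assumed.\<close>
    have "\<forall>\<^sub>F s :: real in at_top. 1 \<le> ln s" by real_asymp
    with \<epsilon>(2) have "\<forall>\<^sub>F s in at_top. 1 / ln s powr (2 - min \<epsilon> 1) \<le> measure \<rho> {x. s < max (- x) 0}"
    proof eventually_elim
      case (elim s)
      have "ln s powr (2 - \<epsilon>) \<le> ln s powr (2 - min \<epsilon> 1)" using elim(2) by (intro powr_mono) auto
      then have "1 / ln s powr (2 - min \<epsilon> 1) \<le> 1 / ln s powr (2 - \<epsilon>)"
        using elim(2) by (intro divide_left_mono mult_pos_pos) auto
      then show ?case using elim(1) by linarith
    qed
    moreover have "AE z in Fields. \<forall>x. snd z x \<le> max b 0" using AE_le by eventually_elim (auto simp: le_max_iff_disj)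
    ultimately have "AE z in Fields. AE X in quenched_law (fst z). LIM n sequentially. walk_in_scenery (snd z) X n / real n :> at_bot"
      using \<epsilon>(1) by (intro AE_averages_diverge[of "min \<epsilon> 1" "max b 0"]) auto
    moreover have "{p \<in> space (annealed_law P \<Otimes>\<^sub>M Q). LIM n sequentially. walk_in_scenery (snd p) (snd (fst p)) n / real n :> at_bot} \<in> sets (annealed_law P \<Otimes>\<^sub>M Q)"
    proof -
      note [measurable] = meas
      show ?thesis unfolding filterlim_at_bot_nat_iff eventually_sequentially by measurable
    qed
    ultimately show "measure (annealed_law P \<Otimes>\<^sub>M Q) {((\<omega>, X), \<xi>) \<in> space (annealed_law P \<Otimes>\<^sub>M Q).
          LIM n sequentially. walk_in_scenery \<xi> X n / real n :> at_bot} = 1"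
      by (intro transfer)
  qed
qed

end
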